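(* Let $m$ be a multiplicity function and let $H$ be a filter relative to $m$ and $\alpha^*$. Then $S_H$ fails to be a pure isometry if and only if $H$ is equivalent to an eigenfilter.
   Context: Setting: $\Gamma$ is a countable (discrete) abelian group, $\alpha:\Gamma\to\Gamma$ is an injective homomorphism whose image has finite index $N>1$ in $\Gamma$, and $\bigcap_{n}\alpha^n(\Gamma)=\{0\}$. $\widehat\Gamma$ is the (compact) dual group with Haar measure. The dual endomorphism $\alpha^*:\widehat\Gamma\to\widehat\Gamma$, $[\alpha^*(\omega)](\gamma)=\omega(\alpha(\gamma))$, is onto and its kernel has exactly $N$ elements. Sets and functions on $\widehat\Gamma$ are considered up to Haar-null sets, identities and inequalities are understood almost everywhere, and $L^2(\sigma)$ is taken with respect to Haar measure restricted to $\sigma$. A multiplicity function is a Borel function $m:\widehat\Gamma\to\{0,1,2,\dots\}$ with $m(\omega)\le\sum_{\alpha^*(\zeta)=\omega}m(\zeta)$. Put $\sigma_i=\{\omega:m(\omega)\ge i\}$. A filter relative to $m$ and $\alpha^*$ is a (possibly infinite) matrix $H=[h_{i,j}]$ of Borel complex-valued functions on $\widehat\Gamma$, with $h_{i,j}$ supported in $\sigma_j$, such that $\sum_{\alpha^*(\zeta)=\omega}\sum_j h_{i,j}(\zeta)\overline{h_{i',j}(\zeta)}=N\delta_{i,i'}\chi_{\sigma_i}(\omega)$. The Ruelle operator $S_H$ on $\bigoplus_iL^2(\sigma_i)$ is the isometry $[S_H(f)](\omega)=H^t(\omega)f(\alpha^*(\omega))$. An isometry $S$ on a Hilbert space $\mathcal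 K$ is pure if $\bigcap_{n\ge0}S^n(\mathcal K)=\{0\}$. Filters $H,H'$ relative to $m$ and $\alpha^*$ are equivalent if there is a (Borel) matrix-valued function $A$ on $\widehat\Gamma$ with $A(\omega)=\begin{pmatrix}A_1(\omega)&0\\0&0\end{pmatrix}$, $A_1(\omega)$ a unitary matrix of dimension $m(\omega)$, such that $H'(\omega)=A(\alpha^*(\omega))H(\omega)A^*(\omega)$ for almost all $\omega$ ($A^*$ = conjugate transpose). A filter $H$ is an eigenfilter if there is a constant $\lambda$ with $|\lambda|=1$ such that for almost all $\omega$, $H_{1,1}(\omega)=\lambda$ and $H_{1,j}(\omega)=0$ for $j>1$. *)

theory Defs
  imports "HOL-Analysis.Analysis" "HOL-Library.Countable"
begin

section \<open>The dual group of a discrete abelian group\<close>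

typedef (overloaded) ('g::ab_group_add) dual =
  "{\<phi> :: 'g \<Rightarrow> complex. (\<forall>a b. \<phi> (a + b) = \<phi> a * \<phi> b) \<and> (\<forall>a. cmod (\<phi> a) = 1)}"
  morphisms char_eval Abs_dual
  by (rule exI[of _ "\<lambda>_. 1"]) simp

setup_lifting type_definition_dual

instantiation dual :: (ab_group_add) comm_monoid_mult
begin

lift_definition one_dual :: "'a dual" is "\<lambda>_. 1"
  by simp

lift_definition times_dual :: "'a dual \<Rightarrow> 'a dual \<Rightarrow> 'a dual" is "\<lambda>\<phi> \<psi> a. \<phi> a * \<psi> a"
  by (auto simp: norm_mult)

instance
  by standard (transfer; auto simp: mult_ac)+

end

text \<open>
  Pointwise convergence. As the group is discrete this is the compact-open topology; the topology
  on \<open>'a \<Rightarrow> complex\<close> is the product topology.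
\<close>

instantiation dual :: (ab_group_add) topological_space
begin

definition open_dual :: "'a dual set \<Rightarrow> bool" where
  "open_dual U \<longleftrightarrow> (\<exists>V. open V \<and> U = char_eval -` V)"

instance
proof
  show "open (UNIV :: 'a dual set)"
    unfolding open_dual_def by (rule exI[of _ UNIV]) auto
next
  fix S T :: "'a dual set"
  assume "open S" "open T"
  then obtain V W where "open V" "S = char_eval -` V" "open W" "T = char_eval -` W"
    unfolding open_dual_def by blast
  then show "open (S \<inter> T)"
    unfolding open_dual_def by (intro exI[of _ "V \<inter> W"]) auto
next
  fix K :: "'a dual set set"
  assume "\<forall>S\<in>K. open S"
  then have "\<forall>S\<in>K. \<exists>V. open V \<and> S = char_eval -` V"
    unfolding open_dual_def by blast
  then obtain F where F: "\<forall>S\<in>K. open (F S) \<and> S = char_eval -` (F S)"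
    by metis
  then have "open (\<Union>(F ` K))" "\<Union>K = char_eval -` (\<Union>(F ` K))"
    by auto
  then show "open (\<Union>K)"
    unfolding open_dual_def by blast
qed

end

text \<open>
  For a countable group the dual is compact and metrizable, so every finite Borel measure on it is
  regular, and regularity need not be demanded separately. No normalisation is imposed.
\<close>

definition haar_measure :: "'g::{ab_group_add,countable} dual measure \<Rightarrow> bool" where
  "haar_measure \<mu> \<longleftrightarrow>
     sets \<mu> = sets borel \<and> emeasure \<mu> UNIV \<noteq> 0 \<and> emeasure \<mu> UNIV \<noteq> \<infinity> \<and>
     (\<forall>\<omega>. \<forall>E \<in> sets borel. emeasure \<mu> ((*) \<omega> ` E) = emeasure \<mu> E)"

text \<open>The dual endomorphism; meaningful only for additive \<open>\<alpha>\<close>.\<close>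

definition dual_map :: "('g::ab_group_add \<Rightarrow> 'g) \<Rightarrow> 'g dual \<Rightarrow> 'g dual" where
  "dual_map \<alpha> \<omega> = Abs_dual (\<lambda>\<gamma>. char_eval \<omega> (\<alpha> \<gamma>))"

lemma char_eval_dual_map:
  assumes "Modules.additive \<alpha>"
  shows "char_eval (dual_map \<alpha> \<omega>) \<gamma> = char_eval \<omega> (\<alpha> \<gamma>)"
proof -
  have "(\<lambda>\<gamma>. char_eval \<omega> (\<alpha> \<gamma>)) \<in>
      {\<phi>. (\<forall>a b. \<phi> (a + b) = \<phi> a * \<phi> b) \<and> (\<forall>a. cmod (\<phi> a) = 1)}"
    using char_eval[of \<omega>] by (simp add: Modules.additive.add[OF assms])
  then show ?thesis
    unfolding dual_map_def by (simp add: Abs_dual_inverse)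
qed

section \<open>Infinite matrices\<close>

text \<open>
  Row and column indices range over \<open>{1..}\<close>; entries with an index 0 are junk and never used.
  All the infinite sums below have, for almost every point, only finitely many nonzero terms.
\<close>

type_synonym cmatrix = "nat \<Rightarrow> nat \<Rightarrow> complex"

definition mat_mul :: "cmatrix \<Rightarrow> cmatrix \<Rightarrow> cmatrix" where
  "mat_mul A B = (\<lambda>i j. \<Sum>\<^sub>\<infinity>k\<in>{1..}. A i k * B k j)"

definition mat_adj :: "cmatrix \<Rightarrow> cmatrix" where
  "mat_adj A = (\<lambda>i j. cnj (A j i))"

definition unitary_block :: "nat \<Rightarrow> cmatrix \<Rightarrow> bool" where
  "unitary_block n A \<longleftrightarrow>
     (\<forall>i\<ge>1. \<forall>j\<ge>1. i > n \<or> j > n \<longrightarrow> A i j = 0) \<and>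
     (\<forall>i\<in>{1..n}. \<forall>j\<in>{1..n}.
        (\<Sum>k=1..n. A i k * cnj (A j k)) = of_bool (i = j) \<and>
        (\<Sum>k=1..n. cnj (A k i) * A k j) = of_bool (i = j))"

section \<open>Multiplicity functions and filters\<close>

definition multiplicity_function ::
    "'g::{ab_group_add,countable} dual measure \<Rightarrow> ('g \<Rightarrow> 'g) \<Rightarrow> ('g dual \<Rightarrow> nat) \<Rightarrow> bool" where
  "multiplicity_function \<mu> \<alpha> m \<longleftrightarrow>
     m \<in> measurable borel (count_space UNIV) \<and>
     (AE \<omega> in \<mu>. m \<omega> \<le> (\<Sum>\<zeta> | dual_map \<alpha> \<zeta> = \<omega>. m \<zeta>))"

definition sigma_set :: "('g::{ab_group_add,countable} dual \<Rightarrow> nat) \<Rightarrow> nat \<Rightarrow> 'g dual set" where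
  "sigma_set m i = {\<omega>. m \<omega> \<ge> i}"

definition filter_relative ::
    "'g::{ab_group_add,countable} dual measure \<Rightarrow> ('g \<Rightarrow> 'g) \<Rightarrow> nat \<Rightarrow> ('g dual \<Rightarrow> nat) \<Rightarrow>
     ('g dual \<Rightarrow> cmatrix) \<Rightarrow> bool" where
  "filter_relative \<mu> \<alpha> N m H \<longleftrightarrow>
     (\<forall>i\<ge>1. \<forall>j\<ge>1. (\<lambda>\<omega>. H \<omega> i j) \<in> borel_measurable borel) \<and>
     (AE \<omega> in \<mu>. \<forall>i\<ge>1. \<forall>j\<ge>1. \<omega> \<notin> sigma_set m j \<longrightarrow> H \<omega> i j = 0) \<and>
     (AE \<omega> in \<mu>. \<forall>i\<ge>1. \<forall>i'\<ge>1.
        (\<Sum>\<zeta> | dual_map \<alpha> \<zeta> = \<omega>. \<Sum>\<^sub>\<infinity>j\<in>{1..}. H \<zeta> i j * cnj (H \<zeta> i' j)) =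
        of_nat N * of_bool (i = i') * indicator (sigma_set m i) \<omega>)"

definition equivalent_filters ::
    "'g::{ab_group_add,countable} dual measure \<Rightarrow> ('g \<Rightarrow> 'g) \<Rightarrow> nat \<Rightarrow> ('g dual \<Rightarrow> nat) \<Rightarrow>
     ('g dual \<Rightarrow> cmatrix) \<Rightarrow> ('g dual \<Rightarrow> cmatrix) \<Rightarrow> bool" where
  "equivalent_filters \<mu> \<alpha> N m H H' \<longleftrightarrow>
     filter_relative \<mu> \<alpha> N m H \<and> filter_relative \<mu> \<alpha> N m H' \<and>
     (\<exists>A. (\<forall>i\<ge>1. \<forall>j\<ge>1. (\<lambda>\<omega>. A \<omega> i j) \<in> borel_measurable borel) \<and>
          (AE \<omega> in \<mu>. unitary_block (m \<omega>) (A \<omega>)) \<and>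
          (AE \<omega> in \<mu>. \<forall>i\<ge>1. \<forall>j\<ge>1.
             H' \<omega> i j = mat_mul (mat_mul (A (dual_map \<alpha> \<omega>)) (H \<omega>)) (mat_adj (A \<omega>)) i j))"

definition eigenfilter ::
    "'g::{ab_group_add,countable} dual measure \<Rightarrow> ('g \<Rightarrow> 'g) \<Rightarrow> nat \<Rightarrow> ('g dual \<Rightarrow> nat) \<Rightarrow>
     ('g dual \<Rightarrow> cmatrix) \<Rightarrow> bool" where
  "eigenfilter \<mu> \<alpha> N m H \<longleftrightarrow>
     filter_relative \<mu> \<alpha> N m H \<and>
     (\<exists>c. cmod c = 1 \<and> (AE \<omega> in \<mu>. H \<omega> 1 1 = c \<and> (\<forall>j>1. H \<omega> 1 j = 0)))"

section \<open>Pure isometries\<close>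

text \<open>The operations of a complex Hilbert space whose points need not exhaust a type.\<close>

record 'h hspace =
  hs_carrier :: "'h set"
  hs_zero :: 'h
  hs_add :: "'h \<Rightarrow> 'h \<Rightarrow> 'h"
  hs_scale :: "complex \<Rightarrow> 'h \<Rightarrow> 'h"
  hs_norm :: "'h \<Rightarrow> real"

definition isometry_of :: "'h hspace \<Rightarrow> ('h \<Rightarrow> 'h) \<Rightarrow> bool" where
  "isometry_of K S \<longleftrightarrow>
     (\<forall>x \<in> hs_carrier K. S x \<in> hs_carrier K \<and> hs_norm K (S x) = hs_norm K x \<and>
        (\<forall>c. S (hs_scale K c x) = hs_scale K c (S x)) \<and>
        (\<forall>y \<in> hs_carrier K. S (hs_add K x y) = hs_add K (S x) (S y)))"

definition pure_isometry_of :: "'h hspace \<Rightarrow> ('h \<Rightarrow> 'h) \<Rightarrow> bool" where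
  "pure_isometry_of K S \<longleftrightarrow>
     isometry_of K S \<and> (\<Inter>n. (S ^^ n) ` hs_carrier K) = {hs_zero K}"

section \<open>The direct sum of the spaces of square-integrable functions\<close>

text \<open>
  An element of the sum of the \<open>L\<^sup>2\<close> spaces of the sets \<open>sigma_set m i\<close> (\<open>i \<ge> 1\<close>) is a class,
  modulo almost everywhere equality, of functions \<open>f\<close> whose \<open>i\<close>-th component \<open>\<lambda>\<omega>. f \<omega> i\<close> is
  supported in \<open>sigma_set m i\<close>.
\<close>

type_synonym 'g vfun = "'g dual \<Rightarrow> nat \<Rightarrow> complex"

definition sq_norm :: "'g::{ab_group_add,countable} dual measure \<Rightarrow> 'g vfun \<Rightarrow> ennreal" where
  "sq_norm \<mu> f = (\<Sum>\<^sub>\<infinity>i\<in>{1..}. \<integral>\<^sup>+\<omega>. ennreal ((cmod (f \<omega> i))\<^sup>2) \<partial>\<mu>)"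

definition sq_integrable ::
    "'g::{ab_group_add,countable} dual measure \<Rightarrow> ('g dual \<Rightarrow> nat) \<Rightarrow> 'g vfun set" where
  "sq_integrable \<mu> m =
     {f. (\<forall>i\<ge>1. (\<lambda>\<omega>. f \<omega> i) \<in> borel_measurable borel) \<and>
         (AE \<omega> in \<mu>. \<forall>i\<ge>1. \<omega> \<notin> sigma_set m i \<longrightarrow> f \<omega> i = 0) \<and>
         sq_norm \<mu> f < \<infinity>}"

definition ae_class ::
    "'g::{ab_group_add,countable} dual measure \<Rightarrow> ('g dual \<Rightarrow> nat) \<Rightarrow> 'g vfun \<Rightarrow> 'g vfun set" where
  "ae_class \<mu> m f = {g \<in> sq_integrable \<mu> m. AE \<omega> in \<mu>. \<forall>i\<ge>1. g \<omega> i = f \<omega> i}"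

definition L2_sum ::
    "'g::{ab_group_add,countable} dual measure \<Rightarrow> ('g dual \<Rightarrow> nat) \<Rightarrow> 'g vfun set hspace" where
  "L2_sum \<mu> m =
     \<lparr> hs_carrier = ae_class \<mu> m ` sq_integrable \<mu> m,
       hs_zero = ae_class \<mu> m (\<lambda>\<omega> i. 0),
       hs_add = (\<lambda>x y. \<Union>f\<in>x. \<Union>g\<in>y. ae_class \<mu> m (\<lambda>\<omega> i. f \<omega> i + g \<omega> i)),
       hs_scale = (\<lambda>c x. \<Union>f\<in>x. ae_class \<mu> m (\<lambda>\<omega> i. c * f \<omega> i)),
       hs_norm = (\<lambda>x. the_elem ((\<lambda>f. sqrt (enn2real (sq_norm \<mu> f))) ` x)) \<rparr>"

definition ruelle_fun ::
    "('g::{ab_group_add,countable} \<Rightarrow> 'g) \<Rightarrow> ('g dual \<Rightarrow> cmatrix) \<Rightarrow> 'g vfun \<Rightarrow> 'g vfun" where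
  "ruelle_fun \<alpha> H f = (\<lambda>\<omega> j. \<Sum>\<^sub>\<infinity>i\<in>{1..}. H \<omega> i j * f (dual_map \<alpha> \<omega>) i)"

definition ruelle ::
    "'g::{ab_group_add,countable} dual measure \<Rightarrow> ('g \<Rightarrow> 'g) \<Rightarrow> ('g dual \<Rightarrow> nat) \<Rightarrow>
     ('g dual \<Rightarrow> cmatrix) \<Rightarrow> 'g vfun set \<Rightarrow> 'g vfun set" where
  "ruelle \<mu> \<alpha> m H x = (\<Union>f\<in>x. ae_class \<mu> m (ruelle_fun \<alpha> H f))"

end

theory Submission
  imports Defs "Jordan_Normal_Form.Spectral_Radius"
begin

text \<open>
  Write \<open>T\<close> for the dual endomorphism and \<open>S\<close> for the Ruelle operator of \<open>H\<close>. The filter equation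
  says that, at almost every point \<open>T \<omega>\<close>, the pointwise inner product of \<open>f\<close> and \<open>g\<close> is the
  average of the pointwise inner product of \<open>S f\<close> and \<open>S g\<close> over the \<open>N\<close> points of the fibre of
  \<open>T\<close> through \<open>\<omega>\<close> (\<open>fibre_mean_ip\<close>). As \<open>T\<close> preserves Haar measure, \<open>S\<close> is an isometry, and the
  question is when the unitary part, the intersection of the ranges of all powers of \<open>S\<close>, is not
  trivial.

  The mechanism is equidistribution (\<open>fibre_means_tendsto_mean\<close>). Averaging the character \<open>\<alpha> \<gamma>\<close>
  over fibres yields the character \<open>\<gamma>\<close>, while characters outside \<open>\<alpha>(\<Gamma>)\<close> average to 0. As no
  nonzero element lies in all the subgroups \<open>\<alpha>\<^sup>n(\<Gamma>)\<close>, repeated averaging turns every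
  trigonometric polynomial into its constant term after finitely many steps. Trigonometric
  polynomials are dense in \<open>L\<^sup>1\<close> (\<open>trig_poly_dense_L1\<close>) and averaging is a contraction, so the
  repeated averages of an integrable function converge in \<open>L\<^sup>1\<close> to its mean.

  Suppose now that \<open>f\<close> and \<open>g\<close> are in the unitary part, \<open>f = S\<^sup>n f\<^sub>n\<close> and \<open>g = S\<^sup>n g\<^sub>n\<close>. The
  pointwise inner products of \<open>f\<^sub>n\<close> and \<open>g\<^sub>n\<close> are the \<open>n\<close>-fold averages of those of \<open>f\<close> and \<open>g\<close>,
  hence they tend to a constant. Applied to an orthonormal system of \<open>k\<close> functions, this
  gives \<open>k\<close> almost orthonormal vectors in dimension \<open>m \<omega>\<close> for almost every \<open>\<omega>\<close>, so that \<open>k \<le> m \<omega>\<close>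
  (\<open>orthonormal_le_multiplicity\<close>). The unitary part is thus finite-dimensional, and if it is not
  trivial, it contains an eigenvector \<open>F\<close> of \<open>S\<close>. Up to phases \<open>F\<close> coincides with all its
  pullbacks, so its pointwise length is already constant (\<open>unit_eigenvector\<close>). Completing \<open>F \<omega>\<close>
  to a unitary matrix with first row \<open>F \<omega>\<close>, by an explicit Householder reflection to keep the
  entries measurable, conjugates \<open>H\<close> to an eigenfilter (\<open>eigenfilter_from_eigenvector\<close>).

  Conversely, if conjugation by \<open>A\<close> turns \<open>H\<close> into an eigenfilter, then the first row of \<open>A\<close> is an
  eigenvector of \<open>S\<close> to an eigenvalue of modulus 1 and lies in the unitary part
  (\<open>eigenvector_from_eigenfilter\<close>).
\<close>

section \<open>Characters of a discrete abelian group\<close>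

lemma char_eval_add: "char_eval \<omega> (a + b) = char_eval \<omega> a * char_eval \<omega> b"
  using char_eval[of \<omega>] by simp

lemma norm_char_eval [simp]: "cmod (char_eval \<omega> a) = 1"
  using char_eval[of \<omega>] by simp

lemma char_eval_nonzero [simp]: "char_eval \<omega> a \<noteq> 0"
  using norm_char_eval[of \<omega> a] by force

lemma char_eval_zero [simp]: "char_eval \<omega> 0 = 1"
  using char_eval_add[of \<omega> 0 0] by simp

lemma char_eval_times: "char_eval (\<omega> * \<kappa>) a = char_eval \<omega> a * char_eval \<kappa> a"
  by transfer simp

lemma char_eval_one [simp]: "char_eval 1 a = 1"
  by transfer simp

lemma char_eval_minus: "char_eval \<omega> (- a) = cnj (char_eval \<omega> a)"
proof -
  have "char_eval \<omega> a * char_eval \<omega> (- a) = 1"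
    using char_eval_add[of \<omega> a "- a"] by simp
  also have "1 = char_eval \<omega> a * cnj (char_eval \<omega> a)"
    by (simp add: complex_norm_square[symmetric])
  finally show ?thesis by simp
qed

lemma char_eval_diff: "char_eval \<omega> (a - b) = char_eval \<omega> a / char_eval \<omega> b"
  using char_eval_add[of \<omega> "a - b" b] by (simp add: field_simps)

lemma dual_eqI: "(\<And>a. char_eval \<omega> a = char_eval \<kappa> a) \<Longrightarrow> \<omega> = \<kappa>"
  by (metis char_eval_inject ext)

lift_definition dual_inv :: "'g::ab_group_add dual \<Rightarrow> 'g dual" is "\<lambda>\<phi> a. cnj (\<phi> a)"
  by auto

lemma dual_inv_right [simp]: "\<kappa> * dual_inv \<kappa> = 1"
  by (rule dual_eqI) (simp add: char_eval_times dual_inv.rep_eq complex_norm_square[symmetric])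

lemma dual_times_inv_cancel [simp]: "\<omega> * \<kappa> * dual_inv \<kappa> = \<omega>"
  by (simp add: mult.assoc)

lemma dual_times_inv_cancel' [simp]: "\<omega> * dual_inv \<kappa> * \<kappa> = \<omega>"
  by (simp add: mult.assoc mult.commute[of "dual_inv \<kappa>"])

lemma dual_times_inv_cancel_left [simp]:
  fixes \<omega> :: "'g::ab_group_add dual"
  shows "dual_inv \<kappa> * (\<kappa> * \<omega>) = \<omega>" "\<kappa> * (dual_inv \<kappa> * \<omega>) = \<omega>"
proof -
  have "dual_inv \<kappa> * (\<kappa> * \<omega>) = \<omega> * \<kappa> * dual_inv \<kappa>" by (simp only: mult_ac)
  then show "dual_inv \<kappa> * (\<kappa> * \<omega>) = \<omega>" by simp
  have "\<kappa> * (dual_inv \<kappa> * \<omega>) = \<omega> * \<kappa> * dual_inv \<kappa>" by (simp only: mult_ac)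
  then show "\<kappa> * (dual_inv \<kappa> * \<omega>) = \<omega>" by simp
qed

lemma dual_times_left_inject:
  fixes \<omega> :: "'g::ab_group_add dual"
  shows "\<omega> * \<kappa> = \<omega> * \<kappa>' \<longleftrightarrow> \<kappa> = \<kappa>'"
proof
  assume "\<omega> * \<kappa> = \<omega> * \<kappa>'"
  then have "dual_inv \<omega> * (\<omega> * \<kappa>) = dual_inv \<omega> * (\<omega> * \<kappa>')" by simp
  then show "\<kappa> = \<kappa>'" by (simp only: dual_times_inv_cancel_left)
qed simp

text \<open>
  Characters of subgroups are handled through their graphs: the inclusion order on graphs is
  extension of characters, and a union of a chain of graphs is again a graph, which is
  what Zorn's lemma asks for.
\<close>

definition partial_character :: "('g::ab_group_add \<times> complex) set \<Rightarrow> bool" where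
  "partial_character r \<longleftrightarrow>
     (0, 1) \<in> r \<and> (\<forall>a z. (a, z) \<in> r \<longrightarrow> cmod z = 1) \<and>
     (\<forall>a z b w. (a, z) \<in> r \<longrightarrow> (b, w) \<in> r \<longrightarrow> (a - b, z / w) \<in> r) \<and>
     (\<forall>z. (0, z) \<in> r \<longrightarrow> z = 1)"

definition nat_multiple :: "nat \<Rightarrow> 'g::ab_group_add \<Rightarrow> 'g" where
  "nat_multiple n g = (\<Sum>i<n. g)"

lemma nat_multiple_0 [simp]: "nat_multiple 0 g = 0"
  and nat_multiple_Suc: "nat_multiple (Suc n) g = nat_multiple n g + g"
  by (simp_all add: nat_multiple_def)

lemma nat_multiple_add: "nat_multiple (m + n) g = nat_multiple m g + nat_multiple n g"
  by (induction n) (simp_all add: nat_multiple_Suc add.assoc)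

lemma partial_character_diff:
  "partial_character r \<Longrightarrow> (a, z) \<in> r \<Longrightarrow> (b, w) \<in> r \<Longrightarrow> (a - b, z / w) \<in> r"
  unfolding partial_character_def by blast

lemma partial_character_norm:
  "partial_character r \<Longrightarrow> (a, z) \<in> r \<Longrightarrow> cmod z = 1"
  unfolding partial_character_def by blast

lemma partial_character_at_zero:
  "partial_character r \<Longrightarrow> (0, z) \<in> r \<Longrightarrow> z = 1"
  unfolding partial_character_def by blast

lemma partial_character_add:
  assumes "partial_character r" "(a, z) \<in> r" "(b, w) \<in> r"
  shows "(a + b, z * w) \<in> r"
proof -
  have "(0 - b, 1 / w) \<in> r"
    using assms unfolding partial_character_def by blast
  from partial_character_diff[OF assms(1,2) this] show ?thesis by simp
qed

lemma partial_character_multiple: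
  assumes "partial_character r" "(a, z) \<in> r"
  shows "(nat_multiple n a, z ^ n) \<in> r"
proof (induction n)
  case 0
  then show ?case using assms unfolding partial_character_def by simp
next
  case (Suc n)
  from partial_character_add[OF assms(1) Suc assms(2)] show ?case
    by (simp add: nat_multiple_Suc mult.commute)
qed

lemma nat_multiple_mult: "nat_multiple (q * d) g = nat_multiple q (nat_multiple d g)"
  by (induction q) (simp_all add: nat_multiple_Suc nat_multiple_add add.commute)

lemma complex_root_not_one:
  assumes "cmod z = 1" "d \<ge> 2"
  obtains w where "cmod w = 1" "w ^ d = z" "w \<noteq> 1"
proof -
  define w where "w = cis (Arg z / real d)"
  have w: "w ^ d = z"
    using assms cis_Arg[of z] unfolding w_def Complex.DeMoivre
    by (cases "z = 0") (auto simp: sgn_div_norm)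
  show thesis
  proof (cases "w = 1")
    case False
    then show ?thesis using w that[of w] by (simp add: w_def)
  next
    case True
    define u where "u = cis (2 * pi / real d)"
    have "u ^ d = cis (real d * (2 * pi / real d))"
      by (simp only: u_def Complex.DeMoivre)
    also have "real d * (2 * pi / real d) = 2 * pi"
      using assms by simp
    finally have "u ^ d = z"
      using True w by simp
    moreover have "u \<noteq> 1"
    proof
      assume "u = 1"
      then have "cos (2 * (pi / real d)) = 1"
        by (simp add: u_def complex_eq_iff)
      then have "sin (pi / real d) = 0"
        unfolding cos_double_sin by simp
      moreover have "sin (pi / real d) > 0"
        using assms by (intro sin_gt_zero) (simp_all add: field_simps)
      ultimately show False by simp
    qed
    ultimately show ?thesis using that[of u] by (simp add: u_def)
  qed
qed

text \<open>
  Only the least \<open>d > 0\<close> for which \<open>d \<cdot> g\<close> already has a value constrains the value at \<open>g\<close>: it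
  must be a \<open>d\<close>-th root of that value. As \<open>d \<ge> 2\<close>, there is a root different from 1.
\<close>

lemma partial_character_extend:
  fixes g :: "'g::ab_group_add"
  assumes r: "partial_character r" and g: "g \<notin> Domain r"
  shows "\<exists>r' w. partial_character r' \<and> r \<subseteq> r' \<and> (g, w) \<in> r' \<and> w \<noteq> 1"
proof -
  obtain w where w1: "cmod w = 1" "w \<noteq> 1"
    and w: "\<And>n z. (nat_multiple n g, z) \<in> r \<Longrightarrow> z = w ^ n"
  proof (cases "\<exists>d>0. nat_multiple d g \<in> Domain r")
    case True
    define d where "d = (LEAST d. d > 0 \<and> nat_multiple d g \<in> Domain r)"
    have d: "d > 0" "nat_multiple d g \<in> Domain r"
      using LeastI_ex[OF True] by (auto simp: d_def)
    have least: "s = 0" if "s < d" "nat_multiple s g \<in> Domain r" for s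
      using that not_less_Least[of s "\<lambda>d. d > 0 \<and> nat_multiple d g \<in> Domain r"]
      by (auto simp: d_def)
    have "d \<noteq> 1" using g d(2) by (auto simp: nat_multiple_def)
    with d(1) have "d \<ge> 2" by simp
    obtain z0 where z0: "(nat_multiple d g, z0) \<in> r" using d(2) by blast
    obtain w where w: "cmod w = 1" "w ^ d = z0" "w \<noteq> 1"
      using complex_root_not_one[OF partial_character_norm[OF r z0] \<open>d \<ge> 2\<close>] by metis
    show thesis
    proof (rule that[OF w(1,3)])
      fix n z assume nz: "(nat_multiple n g, z) \<in> r"
      define q s where "q = n div d" and "s = n mod d"
      have n: "n = s + q * d" by (simp add: q_def s_def)
      have "(nat_multiple (q * d) g, z0 ^ q) \<in> r"
        unfolding nat_multiple_mult by (rule partial_character_multiple[OF r z0])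
      from partial_character_diff[OF r nz this]
      have *: "(nat_multiple s g, z / z0 ^ q) \<in> r"
        by (simp add: n nat_multiple_add)
      then have "s = 0"
        using least[of s] d(1) by (auto simp: s_def)
      have "z / z0 ^ q = 1"
        by (rule partial_character_at_zero[OF r]) (use * \<open>s = 0\<close> in simp)
      then have "z = z0 ^ q" using eq_divide_imp[of "z0 ^ q" 1 z] by (cases "z0 ^ q = 0") auto
      then show "z = w ^ n"
        using \<open>s = 0\<close> w(2) by (simp add: n power_mult mult.commute[of q])
    qed
  next
    case False
    \<comment> \<open>No positive multiple of \<open>g\<close> has a value, so every number of modulus 1 other than 1 will do.\<close>
    show thesis
    proof (rule that[of "-1"])
      fix n z assume "(nat_multiple n g, z) \<in> r"
      moreover from this have "n = 0" using False by (auto simp: Domain_iff)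
      ultimately show "z = (-1) ^ n"
        using partial_character_at_zero[OF r] by simp
    qed simp_all
  qed
  have w0: "w \<noteq> 0" using w1 by auto
  \<comment> \<open>An integer multiple of \<open>g\<close> is written as a difference of two natural multiples.\<close>
  define r' where "r' = {(a + nat_multiple n g - nat_multiple k g, z * w ^ n / w ^ k) | a z n k.
    (a, z) \<in> r}"
  have r'I: "(b, y) \<in> r'" if "(a, z) \<in> r" "b = a + nat_multiple n g - nat_multiple k g"
    "y = z * w ^ n / w ^ k" for a z n k b y
    using that unfolding r'_def by blast
  have one: "(0, 1) \<in> r" using r unfolding partial_character_def by blast
  have sub: "r \<subseteq> r'"
  proof
    fix p assume "p \<in> r"
    then show "p \<in> r'" using r'I[of "fst p" "snd p" "fst p" 0 0 "snd p"] by simp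
  qed
  have mem: "(g, w) \<in> r'"
    using r'I[OF one, of g 1 0 w] by (simp add: nat_multiple_def)
  have "partial_character r'"
    unfolding partial_character_def
  proof (intro conjI allI impI)
    show "(0, 1) \<in> r'" using one sub by blast
  next
    fix a z assume "(a, z) \<in> r'"
    then show "cmod z = 1"
      using partial_character_norm[OF r] w1
      by (auto simp: r'_def norm_mult norm_divide norm_power)
  next
    fix a z b y assume "(a, z) \<in> r'" "(b, y) \<in> r'"
    then obtain a1 z1 n1 k1 a2 z2 n2 k2 where
      1: "(a1, z1) \<in> r" "a = a1 + nat_multiple n1 g - nat_multiple k1 g" "z = z1 * w ^ n1 / w ^ k1"
      and 2: "(a2, z2) \<in> r" "b = a2 + nat_multiple n2 g - nat_multiple k2 g"
        "y = z2 * w ^ n2 / w ^ k2"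
      unfolding r'_def by blast
    have "z2 \<noteq> 0" using partial_character_norm[OF r 2(1)] by auto
    show "(a - b, z / y) \<in> r'"
      by (rule r'I[OF partial_character_diff[OF r 1(1) 2(1)], of _ "n1 + k2" "k1 + n2"])
        (use w0 \<open>z2 \<noteq> 0\<close> in \<open>simp_all add: 1 2 nat_multiple_add power_add field_simps\<close>)
  next
    fix y assume "(0, y) \<in> r'"
    then obtain a z n k where
      1: "(a, z) \<in> r" "0 = a + nat_multiple n g - nat_multiple k g" "y = z * w ^ n / w ^ k"
      unfolding r'_def by blast
    show "y = 1"
    proof (cases "n \<le> k")
      case True
      then have k: "k = n + (k - n)" by simp
      have "a = nat_multiple (k - n) g"
        using 1(2) nat_multiple_add[of n "k - n" g] k by (simp add: algebra_simps)
      then have "z = w ^ (k - n)" using w 1(1) by simp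
      then show ?thesis using 1(3) k w0 by (simp add: power_add[symmetric])
    next
      case False
      then have n: "n = k + (n - k)" by simp
      have "a + nat_multiple (n - k) g = 0"
        using 1(2) nat_multiple_add[of k "n - k" g] n by (simp add: algebra_simps)
      then have "0 - a = nat_multiple (n - k) g"
        by (simp add: add_eq_0_iff)
      then have "1 / z = w ^ (n - k)"
        using w[of "n - k" "1 / z"] partial_character_diff[OF r one 1(1)] by simp
      moreover have "w ^ n = w ^ k * w ^ (n - k)"
        using n power_add[of w k "n - k"] by simp
      moreover have "z \<noteq> 0" using partial_character_norm[OF r 1(1)] by auto
      ultimately show ?thesis using 1(3) w0 by (simp add: field_simps)
    qed
  qed
  then show ?thesis using sub mem w1(2) by blast
qed

lemma character_extension:
  fixes r :: "('g::ab_group_add \<times> complex) set"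
  assumes r: "partial_character r"
  shows "\<exists>\<omega>. \<forall>(a, z) \<in> r. char_eval \<omega> a = z"
proof -
  let ?A = "{r'. partial_character r' \<and> r \<subseteq> r'}"
  have "\<exists>M\<in>?A. \<forall>X\<in>?A. M \<subseteq> X \<longrightarrow> X = M"
  proof (rule subset_Zorn_nonempty)
    show "?A \<noteq> {}" using r by blast
  next
    fix C assume C: "C \<noteq> {}" "subset.chain ?A C"
    then have CA: "C \<subseteq> ?A" and lin: "\<And>x y. x \<in> C \<Longrightarrow> y \<in> C \<Longrightarrow> x \<subseteq> y \<or> y \<subseteq> x"
      using C(2) subset.chain_total[OF C(2)] by (simp add: subset.chain_def, blast)
    have "partial_character (\<Union>C)"
      unfolding partial_character_def
    proof (intro conjI allI impI)
      show "(0, 1) \<in> \<Union>C"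
        using C CA unfolding partial_character_def by blast
    next
      fix a z assume "(a, z) \<in> \<Union>C"
      then show "cmod z = 1" using CA unfolding partial_character_def by blast
    next
      fix z assume "(0, z) \<in> \<Union>C"
      then show "z = 1" using CA unfolding partial_character_def by blast
    next
      fix a z b w assume "(a, z) \<in> \<Union>C" "(b, w) \<in> \<Union>C"
      then obtain x y where xy: "x \<in> C" "y \<in> C" "(a, z) \<in> x" "(b, w) \<in> y" by blast
      then obtain u where "u \<in> C" "(a, z) \<in> u" "(b, w) \<in> u"
        using lin[of x y] by blast
      then show "(a - b, z / w) \<in> \<Union>C"
        using CA partial_character_diff[of u a z b w] by blast
    qed
    then show "\<Union>C \<in> ?A" using C CA by blast
  qed
  then obtain M where M: "partial_character M" "r \<subseteq> M"
    and max: "\<And>X. partial_character X \<Longrightarrow> M \<subseteq> X \<Longrightarrow> X = M"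
    by (metis (no_types, lifting) mem_Collect_eq subset_trans)
  have dom: "a \<in> Domain M" for a
    using partial_character_extend[OF M(1), of a] max by blast
  have uniq: "z = w" if "(a, z) \<in> M" "(a, w) \<in> M" for a z w
  proof -
    have "(0, z / w) \<in> M" using partial_character_diff[OF M(1) that] by simp
    then have "z / w = 1" by (rule partial_character_at_zero[OF M(1)])
    then show ?thesis by (auto split: if_splits)
  qed
  define \<phi> where "\<phi> a = (THE z. (a, z) \<in> M)" for a
  have \<phi>: "(a, \<phi> a) \<in> M" for a
    unfolding \<phi>_def by (rule theI') (use dom[of a] uniq in blast)
  have \<phi>_eq: "\<phi> a = z" if "(a, z) \<in> M" for a z
    using uniq that \<phi> by blast
  have "\<phi> \<in> {\<phi>. (\<forall>a b. \<phi> (a + b) = \<phi> a * \<phi> b) \<and> (\<forall>a. cmod (\<phi> a) = 1)}"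
    using partial_character_add[OF M(1) \<phi> \<phi>] partial_character_norm[OF M(1) \<phi>] \<phi>_eq by blast
  then have "char_eval (Abs_dual \<phi>) = \<phi>" by (rule Abs_dual_inverse)
  then show ?thesis using \<phi>_eq M(2) by (intro exI[of _ "Abs_dual \<phi>"]) auto
qed

text \<open>
  Extending the trivial character of the subgroup, with a value other than 1 at the given element,
  shows that the characters separate points from subgroups.
\<close>

lemma characters_separate:
  fixes D :: "'g::ab_group_add set"
  assumes "0 \<in> D" "\<And>a b. a \<in> D \<Longrightarrow> b \<in> D \<Longrightarrow> a - b \<in> D" "g \<notin> D"
  obtains \<omega> where "\<And>a. a \<in> D \<Longrightarrow> char_eval \<omega> a = 1" "char_eval \<omega> g \<noteq> 1"
proof -
  have "partial_character (D \<times> {1})"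
    using assms(1,2) by (auto simp: partial_character_def)
  then obtain r w where "partial_character r" "D \<times> {1} \<subseteq> r" "(g, w) \<in> r" "w \<noteq> 1"
    using partial_character_extend[of "D \<times> {1}" g] assms(3) by auto
  moreover from this obtain \<omega> where "\<forall>(a, z) \<in> r. char_eval \<omega> a = z"
    using character_extension by blast
  ultimately show thesis
    by (intro that[of \<omega>]) auto
qed

section \<open>Density of trigonometric polynomials\<close>

lemma continuous_char_eval: "continuous_on UNIV (\<lambda>\<omega>. char_eval \<omega> \<gamma>)"
  unfolding continuous_on_open_vimage[OF open_UNIV] open_dual_def
proof (intro allI impI)
  fix B :: "complex set" assume "open B"
  moreover have "continuous_on UNIV (\<lambda>\<phi> :: 'a \<Rightarrow> complex. \<phi> \<gamma>)"
    by (rule continuous_on_product_coordinates)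
  ultimately have "open ((\<lambda>\<phi> :: 'a \<Rightarrow> complex. \<phi> \<gamma>) -` B)"
    by (rule open_vimage)
  then show "\<exists>V. open V \<and> (\<lambda>\<omega>. char_eval \<omega> \<gamma>) -` B \<inter> UNIV = char_eval -` V"
    by (intro exI[of _ "(\<lambda>\<phi>. \<phi> \<gamma>) -` B"]) auto
qed

lemma borel_measurable_char_eval [measurable]: "(\<lambda>\<omega>. char_eval \<omega> \<gamma>) \<in> borel_measurable borel"
  by (rule borel_measurable_continuous_onI[OF continuous_char_eval])

lemma measurable_into_dual:
  fixes f :: "'a \<Rightarrow> 'g::{ab_group_add,countable} dual"
  assumes "\<And>\<gamma>. (\<lambda>x. char_eval (f x) \<gamma>) \<in> borel_measurable M"
  shows "f \<in> borel_measurable M"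
proof (rule borel_measurableI)
  fix S :: "'g dual set" assume "open S"
  then obtain V where V: "open V" "S = char_eval -` V"
    unfolding open_dual_def by blast
  have "(\<lambda>x. char_eval (f x)) \<in> borel_measurable M"
    by (rule measurable_coordinatewise_then_product) (rule assms)
  then have "(\<lambda>x. char_eval (f x)) -` V \<inter> space M \<in> sets M"
    by (rule measurable_sets) (use V in simp)
  then show "f -` S \<inter> space M \<in> sets M"
    unfolding V(2) vimage_comp by (simp add: comp_def)
qed

lemma measurable_dual_times [measurable]:
  "(\<lambda>\<omega>. \<omega> * \<kappa>) \<in> borel_measurable (borel :: 'g::{ab_group_add,countable} dual measure)"
  by (rule measurable_into_dual) (simp add: char_eval_times)

inductive trig_poly :: "('g::ab_group_add dual \<Rightarrow> complex) \<Rightarrow> bool" where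
  monomial: "trig_poly (\<lambda>\<omega>. c * char_eval \<omega> \<gamma>)"
| add: "trig_poly p \<Longrightarrow> trig_poly q \<Longrightarrow> trig_poly (\<lambda>\<omega>. p \<omega> + q \<omega>)"

lemma trig_poly_const: "trig_poly (\<lambda>_. c)"
  using trig_poly.monomial[of c 0] by simp

lemma trig_poly_mult:
  assumes "trig_poly p" "trig_poly q"
  shows "trig_poly (\<lambda>\<omega>. p \<omega> * q \<omega>)"
  using assms(1)
proof induction
  case (monomial c \<gamma>)
  show ?case using assms(2)
  proof induction
    case (monomial d \<delta>)
    have "trig_poly (\<lambda>\<omega>. (c * d) * char_eval \<omega> (\<gamma> + \<delta>))" by (rule trig_poly.monomial)
    then show ?case by (simp add: char_eval_add mult_ac)
  next
    case (add p q)
    from trig_poly.add[OF add.IH] show ?case by (simp add: distrib_left)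
  qed
next
  case (add p1 p2)
  from trig_poly.add[OF add.IH] show ?case by (simp add: distrib_right)
qed

lemma trig_poly_scale: "trig_poly p \<Longrightarrow> trig_poly (\<lambda>\<omega>. c * p \<omega>)"
  by (rule trig_poly_mult[OF trig_poly_const])

lemma trig_poly_measurable: "trig_poly p \<Longrightarrow> p \<in> borel_measurable borel"
  by (induction rule: trig_poly.induct) auto

lemma trig_poly_bounded: "trig_poly p \<Longrightarrow> \<exists>B. \<forall>\<omega>. cmod (p \<omega>) \<le> B"
proof (induction rule: trig_poly.induct)
  case (monomial c \<gamma>)
  then show ?case by (intro exI[of _ "cmod c"]) (simp add: norm_mult)
next
  case (add p q)
  then obtain B C where "\<forall>\<omega>. cmod (p \<omega>) \<le> B" "\<forall>\<omega>. cmod (q \<omega>) \<le> C" by blast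
  then show ?case
    by (intro exI[of _ "B + C"]) (metis add_mono norm_triangle_ineq order_trans)
qed

lemma trig_poly_Re_char: "trig_poly (\<lambda>\<omega>. complex_of_real (Re (char_eval \<omega> \<gamma>)))"
proof -
  have "complex_of_real (Re z) = 1 / 2 * z + 1 / 2 * cnj z" for z
    by (simp add: complex_eq_iff)
  then show ?thesis
    using trig_poly.add[OF trig_poly.monomial[of "1/2" \<gamma>] trig_poly.monomial[of "1/2" "- \<gamma>"]]
    by (simp add: char_eval_minus)
qed

lemma trig_poly_Im_char: "trig_poly (\<lambda>\<omega>. complex_of_real (Im (char_eval \<omega> \<gamma>)))"
proof -
  have "complex_of_real (Im z) = - (\<i> / 2) * z + \<i> / 2 * cnj z" for z
    by (simp add: complex_eq_iff)
  then show ?thesis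
    using trig_poly.add[OF trig_poly.monomial[of "-(\<i>/2)" \<gamma>] trig_poly.monomial[of "\<i>/2" "- \<gamma>"]]
    by (simp add: char_eval_minus)
qed

lemma trig_poly_real_polynomial:
  assumes "real_polynomial_function g" and u: "trig_poly (\<lambda>\<omega>. complex_of_real (u \<omega>))"
  shows "trig_poly (\<lambda>\<omega>. complex_of_real (g (u \<omega> :: real)))"
  using assms(1)
proof induction
  case (linear f)
  then obtain c where "f = (\<lambda>x. x * c)" using real_bounded_linear by auto
  then show ?case using trig_poly_scale[OF u, of "of_real c"] by (simp add: mult.commute)
next
  case (const c)
  then show ?case by (rule trig_poly_const)
next
  case (add f1 f2)
  from trig_poly.add[OF add.IH] show ?case by simp
next
  case (mult f1 f2)
  from trig_poly_mult[OF mult.IH] show ?case by simp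
qed

abbreviation L1_dist :: "'a measure \<Rightarrow> ('a \<Rightarrow> complex) \<Rightarrow> ('a \<Rightarrow> complex) \<Rightarrow> real" where
  "L1_dist M f g \<equiv> \<integral>x. cmod (f x - g x) \<partial>M"

lemma L1_dist_add:
  fixes f g p q :: "'a \<Rightarrow> complex"
  assumes "integrable M f" "integrable M g" "integrable M p" "integrable M q"
  shows "(\<integral>x. cmod (f x + g x - (p x + q x)) \<partial>M) \<le> L1_dist M f p + L1_dist M g q"
proof -
  have "(\<integral>x. cmod (f x + g x - (p x + q x)) \<partial>M) \<le> (\<integral>x. cmod (f x - p x) + cmod (g x - q x) \<partial>M)"
  proof (intro integral_mono)
    show "cmod (f x + g x - (p x + q x)) \<le> cmod (f x - p x) + cmod (g x - q x)" for x
      using norm_triangle_ineq[of "f x - p x" "g x - q x"] by (simp add: algebra_simps)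
  qed (use assms in auto)
  also have "\<dots> = L1_dist M f p + L1_dist M g q"
    using assms by (intro Bochner_Integration.integral_add) auto
  finally show ?thesis .
qed

lemma L1_dist_triangle:
  fixes f g p :: "'a \<Rightarrow> complex"
  assumes "integrable M f" "integrable M g" "integrable M p"
  shows "L1_dist M f p \<le> L1_dist M f g + L1_dist M g p"
  using L1_dist_add[of M "\<lambda>x. f x - g x" g "\<lambda>x. 0" p] assms by simp

text \<open>
  Functions are approximated in several \<open>L\<^sup>1\<close> norms at once, so that two measures with the same
  Fourier coefficients can be compared on every Borel set.
\<close>

locale finite_borel_measures =
  fixes MM :: "'g::{ab_group_add,countable} dual measure set"
  assumes finite_MM: "finite MM"
    and finite_measure_MM: "M \<in> MM \<Longrightarrow> finite_measure M"
    and sets_MM: "M \<in> MM \<Longrightarrow> sets M = sets borel"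
begin

definition bounded_borel :: "('g dual \<Rightarrow> complex) \<Rightarrow> bool" where
  "bounded_borel f \<longleftrightarrow> f \<in> borel_measurable borel \<and> (\<exists>B. \<forall>\<omega>. cmod (f \<omega>) \<le> B)"

definition approximable :: "('g dual \<Rightarrow> complex) \<Rightarrow> bool" where
  "approximable f \<longleftrightarrow> bounded_borel f \<and>
     (\<forall>e>0. \<exists>p. trig_poly p \<and> (\<forall>M\<in>MM. L1_dist M f p < e))"

lemma trig_poly_bounded_borel: "trig_poly p \<Longrightarrow> bounded_borel p"
  by (simp add: bounded_borel_def trig_poly_measurable trig_poly_bounded)

lemma bounded_borel_add:
  assumes "bounded_borel f" "bounded_borel g"
  shows "bounded_borel (\<lambda>\<omega>. f \<omega> + g \<omega>)"
proof -
  obtain B C where "\<forall>\<omega>. cmod (f \<omega>) \<le> B" "\<forall>\<omega>. cmod (g \<omega>) \<le> C"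
    using assms unfolding bounded_borel_def by blast
  then have "\<forall>\<omega>. cmod (f \<omega> + g \<omega>) \<le> B + C" by (metis add_mono norm_triangle_ineq order_trans)
  then show ?thesis using assms unfolding bounded_borel_def by auto
qed

lemma bounded_borel_mult:
  assumes "bounded_borel f" "bounded_borel g"
  shows "bounded_borel (\<lambda>\<omega>. f \<omega> * g \<omega>)"
proof -
  obtain B C where "\<forall>\<omega>. cmod (f \<omega>) \<le> B" "\<forall>\<omega>. cmod (g \<omega>) \<le> C"
    using assms unfolding bounded_borel_def by blast
  then have "\<forall>\<omega>. cmod (f \<omega> * g \<omega>) \<le> B * C"
    unfolding norm_mult by (meson mult_mono norm_ge_zero order_trans)
  then show ?thesis using assms unfolding bounded_borel_def by auto
qed

lemma bounded_borel_const: "bounded_borel (\<lambda>_. c)"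
  unfolding bounded_borel_def by auto

lemma bounded_borel_diff:
  assumes "bounded_borel f" "bounded_borel g"
  shows "bounded_borel (\<lambda>\<omega>. f \<omega> - g \<omega>)"
  using bounded_borel_add[OF assms(1) bounded_borel_mult[OF bounded_borel_const[of "-1"] assms(2)]]
  by simp

lemma bounded_borel_integrable:
  assumes "bounded_borel f" "M \<in> MM"
  shows "integrable M f"
proof -
  interpret finite_measure M using assms(2) by (rule finite_measure_MM)
  obtain B where "\<forall>\<omega>. cmod (f \<omega>) \<le> B" using assms(1) unfolding bounded_borel_def by blast
  moreover have "f \<in> borel_measurable M"
    using assms measurable_cong_sets[OF sets_MM[OF assms(2)] refl]
    unfolding bounded_borel_def by blast
  ultimately show ?thesis by (intro integrable_const_bound[of _ B]) auto
qed

lemma approximable_trig_poly: "trig_poly p \<Longrightarrow> approximable p"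
  unfolding approximable_def using trig_poly_bounded_borel by force

lemma approximable_add:
  assumes "approximable f" "approximable g"
  shows "approximable (\<lambda>\<omega>. f \<omega> + g \<omega>)"
  unfolding approximable_def
proof (intro conjI allI impI)
  have bb: "bounded_borel f" "bounded_borel g" using assms unfolding approximable_def by auto
  then show "bounded_borel (\<lambda>\<omega>. f \<omega> + g \<omega>)" by (rule bounded_borel_add)
  fix e :: real assume "e > 0"
  then have e2: "e / 2 > 0" by simp
  obtain p where p: "trig_poly p" "\<forall>M\<in>MM. L1_dist M f p < e / 2"
    using assms(1) e2 unfolding approximable_def by blast
  obtain q where q: "trig_poly q" "\<forall>M\<in>MM. L1_dist M g q < e / 2"
    using assms(2) e2 unfolding approximable_def by blast
  show "\<exists>p. trig_poly p \<and> (\<forall>M\<in>MM. (\<integral>\<omega>. cmod (f \<omega> + g \<omega> - p \<omega>) \<partial>M) < e)"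
  proof (intro exI[of _ "\<lambda>\<omega>. p \<omega> + q \<omega>"] conjI ballI)
    show "trig_poly (\<lambda>\<omega>. p \<omega> + q \<omega>)" using p q by (intro trig_poly.add)
    fix M assume M: "M \<in> MM"
    have "(\<integral>\<omega>. cmod (f \<omega> + g \<omega> - (p \<omega> + q \<omega>)) \<partial>M)
        \<le> L1_dist M f p + L1_dist M g q"
      by (intro L1_dist_add bounded_borel_integrable[OF _ M] bb
          trig_poly_bounded_borel[OF p(1)] trig_poly_bounded_borel[OF q(1)])
    also have "\<dots> < e" using bspec[OF p(2) M] bspec[OF q(2) M] by simp
    finally show "(\<integral>\<omega>. cmod (f \<omega> + g \<omega> - (p \<omega> + q \<omega>)) \<partial>M) < e" .
  qed
qed

text \<open>
  As bounded factors stay under control in \<open>L\<^sup>1\<close>, products can be approximated; the factor \<open>g\<close> is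
  approximated first because the bound of its approximant enters into the accuracy needed for \<open>f\<close>.
\<close>

lemma approximable_mult:
  assumes "approximable f" "approximable g"
  shows "approximable (\<lambda>\<omega>. f \<omega> * g \<omega>)"
  unfolding approximable_def
proof (intro conjI allI impI)
  have bb: "bounded_borel f" "bounded_borel g" using assms unfolding approximable_def by auto
  then show "bounded_borel (\<lambda>\<omega>. f \<omega> * g \<omega>)" by (rule bounded_borel_mult)
  fix e :: real assume "e > 0"
  obtain B where B: "\<And>\<omega>. cmod (f \<omega>) \<le> B" using bb(1) unfolding bounded_borel_def by blast
  have B0: "B \<ge> 0" using B norm_ge_zero order_trans by blast
  have "e / (2 * (B + 1)) > 0" using \<open>e > 0\<close> B0 by simp
  then obtain q where q: "trig_poly q" "\<forall>M\<in>MM. L1_dist M g q < e / (2 * (B + 1))"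
    using assms(2) unfolding approximable_def by blast
  obtain C where C: "\<And>\<omega>. cmod (q \<omega>) \<le> C" using trig_poly_bounded[OF q(1)] by blast
  have C0: "C \<ge> 0" using C norm_ge_zero order_trans by blast
  have "e / (2 * (C + 1)) > 0" using \<open>e > 0\<close> C0 by simp
  then obtain p where p: "trig_poly p" "\<forall>M\<in>MM. L1_dist M f p < e / (2 * (C + 1))"
    using assms(1) unfolding approximable_def by blast
  show "\<exists>p. trig_poly p \<and> (\<forall>M\<in>MM. (\<integral>\<omega>. cmod (f \<omega> * g \<omega> - p \<omega>) \<partial>M) < e)"
  proof (intro exI[of _ "\<lambda>\<omega>. p \<omega> * q \<omega>"] conjI ballI)
    show "trig_poly (\<lambda>\<omega>. p \<omega> * q \<omega>)" using p q by (intro trig_poly_mult)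
    fix M assume M: "M \<in> MM"
    have int: "integrable M (\<lambda>\<omega>. cmod (f \<omega> - p \<omega>))" "integrable M (\<lambda>\<omega>. cmod (g \<omega> - q \<omega>))"
      "integrable M (\<lambda>\<omega>. f \<omega> * g \<omega> - p \<omega> * q \<omega>)"
      by - (intro integrable_norm bounded_borel_integrable[OF _ M] bounded_borel_diff
          bounded_borel_mult bb trig_poly_bounded_borel[OF p(1)] trig_poly_bounded_borel[OF q(1)] )+
    have "(\<integral>\<omega>. cmod (f \<omega> * g \<omega> - p \<omega> * q \<omega>) \<partial>M)
        \<le> (\<integral>\<omega>. (B + 1) * cmod (g \<omega> - q \<omega>) + (C + 1) * cmod (f \<omega> - p \<omega>) \<partial>M)"
    proof (intro integral_mono)
      fix \<omega>
      have "f \<omega> * g \<omega> - p \<omega> * q \<omega> = f \<omega> * (g \<omega> - q \<omega>) + q \<omega> * (f \<omega> - p \<omega>)"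
        by (simp add: algebra_simps)
      then have "cmod (f \<omega> * g \<omega> - p \<omega> * q \<omega>)
          \<le> cmod (f \<omega>) * cmod (g \<omega> - q \<omega>) + cmod (q \<omega>) * cmod (f \<omega> - p \<omega>)"
        by (metis norm_mult norm_triangle_ineq)
      also have "\<dots> \<le> (B + 1) * cmod (g \<omega> - q \<omega>) + (C + 1) * cmod (f \<omega> - p \<omega>)"
        using B[of \<omega>] C[of \<omega>] by (intro add_mono mult_right_mono) auto
      finally show "cmod (f \<omega> * g \<omega> - p \<omega> * q \<omega>)
          \<le> (B + 1) * cmod (g \<omega> - q \<omega>) + (C + 1) * cmod (f \<omega> - p \<omega>)" .
    qed (use int in auto)
    also have "\<dots> = (B + 1) * L1_dist M g q + (C + 1) * L1_dist M f p"
      using int by simp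
    also have "\<dots> < (B + 1) * (e / (2 * (B + 1))) + (C + 1) * (e / (2 * (C + 1)))"
      using p q M B0 C0 by (intro add_strict_mono mult_strict_left_mono) auto
    also have "\<dots> = e"
    proof -
      have "x * (e / (2 * x)) = e / 2" if "x > 0" for x
        using that by (simp add: field_simps)
      then show ?thesis using B0 C0 by (simp only: add_nonneg_pos zero_less_one field_sum_of_halves)
    qed
    finally show "(\<integral>\<omega>. cmod (f \<omega> * g \<omega> - p \<omega> * q \<omega>) \<partial>M) < e" .
  qed
qed

lemma approximable_const: "approximable (\<lambda>_. c)"
  by (rule approximable_trig_poly[OF trig_poly_const])

lemma approximable_diff:
  assumes "approximable f" "approximable g"
  shows "approximable (\<lambda>\<omega>. f \<omega> - g \<omega>)"
  using approximable_add[OF assms(1) approximable_mult[OF approximable_const[of "-1"] assms(2)]]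
  by simp

text \<open>
  Closure under bounded pointwise limits, by dominated convergence, leads from continuous functions
  to indicators of Borel sets.
\<close>

lemma approximable_limit:
  assumes f: "\<And>n. approximable (f n)" and B: "\<And>n \<omega>. cmod (f n \<omega>) \<le> B"
    and lim: "\<And>\<omega>. (\<lambda>n. f n \<omega>) \<longlonglongrightarrow> g \<omega>"
  shows "approximable g"
  unfolding approximable_def
proof (intro conjI allI impI)
  have bb: "\<And>n. bounded_borel (f n)" using f unfolding approximable_def by auto
  have [measurable]: "\<And>n. f n \<in> borel_measurable borel"
    using bb unfolding bounded_borel_def by auto
  have [measurable]: "g \<in> borel_measurable borel"
    using lim by (rule borel_measurable_LIMSEQ_metric[rotated]) simp
  have gB: "cmod (g \<omega>) \<le> B" for \<omega>
    by (rule Lim_bounded[OF tendsto_norm[OF lim]]) (use B in auto)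
  then show bg: "bounded_borel g" unfolding bounded_borel_def by auto
  fix e :: real assume "e > 0"
  have "\<forall>\<^sub>F n in sequentially. \<forall>M\<in>MM. L1_dist M g (f n) < e / 2"
  proof (rule eventually_ball_finite[OF finite_MM], rule ballI)
    fix M assume M: "M \<in> MM"
    interpret finite_measure M using M by (rule finite_measure_MM)
    have [measurable]: "g \<in> borel_measurable M" "f n \<in> borel_measurable M" for n
      using bounded_borel_integrable[OF bg M] bounded_borel_integrable[OF bb M] by auto
    have "(\<lambda>n. \<integral>\<omega>. cmod (g \<omega> - f n \<omega>) \<partial>M) \<longlonglongrightarrow> (\<integral>\<omega>. 0 \<partial>M)"
    proof (rule integral_dominated_convergence[where w = "\<lambda>_. 2 * B"])
      show "AE \<omega> in M. (\<lambda>n. cmod (g \<omega> - f n \<omega>)) \<longlonglongrightarrow> 0"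
      proof (rule AE_I2)
        fix \<omega>
        show "(\<lambda>n. cmod (g \<omega> - f n \<omega>)) \<longlonglongrightarrow> 0"
          using tendsto_norm[OF tendsto_diff[OF tendsto_const[of "g \<omega>"] lim[of \<omega>]]] by simp
      qed
      show "AE \<omega> in M. norm (cmod (g \<omega> - f n \<omega>)) \<le> 2 * B" for n
      proof (rule AE_I2)
        fix \<omega>
        show "norm (cmod (g \<omega> - f n \<omega>)) \<le> 2 * B"
          using norm_triangle_ineq4[of "g \<omega>" "f n \<omega>"] gB[of \<omega>] B[of n \<omega>] by simp
      qed
    qed auto
    then show "\<forall>\<^sub>F n in sequentially. L1_dist M g (f n) < e / 2"
      using \<open>e > 0\<close> by (intro order_tendstoD(2)[where y = 0]) auto
  qed
  from eventually_happens'[OF sequentially_bot this]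
  obtain n where n: "\<forall>M\<in>MM. L1_dist M g (f n) < e / 2"
    by blast
  have "e / 2 > 0" using \<open>e > 0\<close> by simp
  then obtain p where p: "trig_poly p" "\<forall>M\<in>MM. L1_dist M (f n) p < e / 2"
    using f[of n] unfolding approximable_def by blast
  show "\<exists>p. trig_poly p \<and> (\<forall>M\<in>MM. L1_dist M g p < e)"
  proof (intro exI[of _ p] conjI ballI)
    show "trig_poly p" by (rule p)
    fix M assume M: "M \<in> MM"
    have "L1_dist M g p
        \<le> L1_dist M g (f n) + L1_dist M (f n) p"
      by (intro L1_dist_triangle bounded_borel_integrable[OF _ M] bb bg
          trig_poly_bounded_borel[OF p(1)])
    also have "\<dots> < e" using bspec[OF p(2) M] bspec[OF n M] by simp
    finally show "L1_dist M g p < e" .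
  qed
qed

lemma approximable_continuous:
  assumes u: "trig_poly (\<lambda>\<omega>. complex_of_real (u \<omega>))" and u1: "\<And>\<omega>. \<bar>u \<omega>\<bar> \<le> 1"
    and h: "continuous_on {-1..1} h"
  shows "approximable (\<lambda>\<omega>. complex_of_real (h (u \<omega>)))"
proof -
  have "\<exists>g. real_polynomial_function g \<and> (\<forall>x\<in>{-1..1::real}. \<bar>h x - g x\<bar> < 1 / real (Suc n))" for n
  proof -
    have "0 < 1 / real (Suc n)" by simp
    then show ?thesis
      by (rule Stone_Weierstrass_real_polynomial_function[OF compact_Icc h]) blast
  qed
  then obtain g where g: "\<And>n. real_polynomial_function (g n)"
    "\<And>n x. x \<in> {-1..1} \<Longrightarrow> \<bar>h x - g n x\<bar> < 1 / real (Suc n)"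
    by metis
  have "bounded (h ` {-1..1})"
    by (rule compact_imp_bounded[OF compact_continuous_image[OF h compact_Icc]])
  then obtain B where "\<forall>y \<in> h ` {-1..1}. \<bar>y\<bar> \<le> B"
    unfolding bounded_iff by auto
  then have B: "\<bar>h x\<bar> \<le> B" if "x \<in> {-1..1}" for x
    using that by blast
  have mem: "u \<omega> \<in> {-1..1}" for \<omega> using u1[of \<omega>] by (auto simp: abs_le_iff)
  show ?thesis
  proof (rule approximable_limit[where f = "\<lambda>n \<omega>. complex_of_real (g n (u \<omega>))" and B = "B + 1"])
    show "approximable (\<lambda>\<omega>. complex_of_real (g n (u \<omega>)))" for n
      by (rule approximable_trig_poly[OF trig_poly_real_polynomial[OF g(1) u]])
    show "cmod (complex_of_real (g n (u \<omega>))) \<le> B + 1" for n \<omega>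
    proof -
      have "1 / real (Suc n) \<le> 1" by simp
      then show ?thesis
        using g(2)[OF mem[of \<omega>], of n] B[OF mem[of \<omega>]] by (simp only: norm_of_real)
    qed
    show "(\<lambda>n. complex_of_real (g n (u \<omega>))) \<longlonglongrightarrow> complex_of_real (h (u \<omega>))" for \<omega>
    proof (rule tendsto_of_real, rule LIM_zero_cancel,
        rule tendsto_rabs_zero_cancel, rule real_tendsto_sandwich[OF _ _ tendsto_const])
      show "\<forall>\<^sub>F n in sequentially. \<bar>g n (u \<omega>) - h (u \<omega>)\<bar> \<le> 1 / real (Suc n)"
        using less_imp_le[OF g(2)[OF mem]] by (intro always_eventually allI) (simp add: abs_minus_commute)
      show "(\<lambda>n. 1 / real (Suc n)) \<longlonglongrightarrow> 0"
        using LIMSEQ_inverse_real_of_nat by (simp add: inverse_eq_divide)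
    qed simp
  qed
qed

lemma approximable_sublevel:
  assumes u: "trig_poly (\<lambda>\<omega>. complex_of_real (u \<omega>))" and u1: "\<And>\<omega>. \<bar>u \<omega>\<bar> \<le> 1"
  shows "approximable (\<lambda>\<omega>. indicator {\<omega>. u \<omega> \<le> c} \<omega>)"
proof -
  \<comment> \<open>Ramps that fall from 1 to 0 ever more steeply to the right of \<open>c\<close>.\<close>
  let ?h = "\<lambda>n x. max 0 (min 1 (1 - real n * (x - c)))"
  show ?thesis
  proof (rule approximable_limit[where f = "\<lambda>n \<omega>. complex_of_real (?h n (u \<omega>))" and B = 1])
    show "approximable (\<lambda>\<omega>. complex_of_real (?h n (u \<omega>)))" for n
      by (rule approximable_continuous[OF u u1]) (intro continuous_intros)
    show "(\<lambda>n. complex_of_real (?h n (u \<omega>))) \<longlonglongrightarrow> indicator {\<omega>. u \<omega> \<le> c} \<omega>" for \<omega>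
    proof (cases "u \<omega> \<le> c")
      case True
      then have "real n * (u \<omega> - c) \<le> 0" for n by (simp add: mult_nonneg_nonpos)
      then have "?h n (u \<omega>) = 1" for n by (simp add: max_def min_def)
      then show ?thesis using True by simp
    next
      case False
      then obtain n0 where n0: "real n0 * (u \<omega> - c) > 1"
        using reals_Archimedean3[of "u \<omega> - c"] by auto
      have "?h n (u \<omega>) = 0" if "n \<ge> n0" for n
      proof -
        have "real n * (u \<omega> - c) \<ge> real n0 * (u \<omega> - c)"
          using False that by (intro mult_right_mono) auto
        then show ?thesis using n0 by simp
      qed
      then show ?thesis using False
        by (intro tendsto_eventually) (auto simp: eventually_sequentially)
    qed
  qed auto
qed

text \<open>
  The sets with approximable indicator form a \<open>\<sigma>\<close>-algebra that makes the real and imaginary parts of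
  all evaluations measurable, hence they include all Borel sets.
\<close>

lemma approximable_indicator:
  assumes "E \<in> sets borel"
  shows "approximable (indicator E)"
proof -
  let ?S = "{E. approximable (indicator E)}"
  have Un: "approximable (indicator (A \<union> B))"
    if "approximable (indicator A)" "approximable (indicator B)" for A B
  proof -
    have "indicator (A \<union> B) = (\<lambda>\<omega>. indicator A \<omega> + indicator B \<omega> -
        indicator A \<omega> * indicator B \<omega> :: complex)"
      by (auto simp: indicator_def)
    then show ?thesis
      using approximable_diff[OF approximable_add[OF that] approximable_mult[OF that]] by simp
  qed
  have "sigma_algebra UNIV ?S"
    unfolding sigma_algebra_iff2
  proof (intro conjI ballI allI impI)
    have "(indicator {} :: 'g dual \<Rightarrow> complex) = (\<lambda>_. 0)" by (auto simp: indicator_def)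
    then show "{} \<in> ?S" using approximable_const[of 0] by simp
  next
    fix A assume "A \<in> ?S"
    then have "approximable (\<lambda>\<omega>. 1 - indicator A \<omega>)"
      using approximable_diff[OF approximable_const[of 1]] by simp
    moreover have "(\<lambda>\<omega>. 1 - indicator A \<omega>) = (indicator (UNIV - A) :: _ \<Rightarrow> complex)"
      by (auto simp: indicator_def)
    ultimately show "UNIV - A \<in> ?S" by simp
  next
    fix A :: "nat \<Rightarrow> 'g dual set" assume A: "range A \<subseteq> ?S"
    have fin: "approximable (indicator (\<Union>i<n. A i))" for n
    proof (induction n)
      case 0
      have "(indicator {} :: 'g dual \<Rightarrow> complex) = (\<lambda>_. 0)" by (auto simp: indicator_def)
      then show ?case using approximable_const[of 0] by simp
    next
      case (Suc n)
      have "(\<Union>i<Suc n. A i) = (\<Union>i<n. A i) \<union> A n" by (auto simp: less_Suc_eq)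
      moreover have "approximable (indicator (A n))" using A by blast
      ultimately show ?case using Un[OF Suc] by metis
    qed
    have "approximable (indicator (\<Union>i. A i))"
    proof (rule approximable_limit[where B = 1, OF fin])
      show "cmod (indicator (\<Union>i<n. A i) \<omega>) \<le> 1" for n :: nat and \<omega>
        by (simp add: indicator_def)
    qed (rule LIMSEQ_indicator_UN)
    then show "(\<Union>i. A i) \<in> ?S" by simp
  qed auto
  then have sets: "sets (sigma UNIV ?S) = ?S"
    by (rule sigma_algebra.sets_measure_of_eq)
  have level: "{\<omega> \<in> space (sigma UNIV ?S). u \<omega> \<le> c} \<in> sets (sigma UNIV ?S)"
    if "trig_poly (\<lambda>\<omega>. complex_of_real (u \<omega>))" "\<And>\<omega>. \<bar>u \<omega>\<bar> \<le> 1" for u c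
    unfolding sets using approximable_sublevel[OF that, of c] by (simp add: space_measure_of_conv)
  have "(\<lambda>\<omega>. char_eval \<omega> \<gamma>) \<in> borel_measurable (sigma UNIV ?S)" for \<gamma>
  proof -
    have "\<bar>Re (char_eval \<omega> \<gamma>)\<bar> \<le> 1" "\<bar>Im (char_eval \<omega> \<gamma>)\<bar> \<le> 1" for \<omega>
      using abs_Re_le_cmod[of "char_eval \<omega> \<gamma>"] abs_Im_le_cmod[of "char_eval \<omega> \<gamma>"] by auto
    then show ?thesis
      unfolding borel_measurable_complex_iff borel_measurable_iff_le
      by (intro conjI allI level trig_poly_Re_char trig_poly_Im_char)
  qed
  then have "(\<lambda>\<omega>. \<omega>) \<in> borel_measurable (sigma UNIV ?S)"
    by (rule measurable_into_dual)
  from measurable_sets[OF this assms] show ?thesis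
    by (simp add: sets space_measure_of_conv)
qed

end

text \<open>
  The indicator of a Borel set is approximated by one and the same trigonometric polynomial in the
  \<open>L\<^sup>1\<close> norms of both measures, and both measures give this polynomial the same integral.
\<close>

lemma finite_measure_eqI_Fourier:
  fixes M M' :: "'g::{ab_group_add,countable} dual measure"
  assumes M: "finite_measure M" "sets M = sets borel"
    and M': "finite_measure M'" "sets M' = sets borel"
    and eq: "\<And>\<gamma>. (\<integral>\<omega>. char_eval \<omega> \<gamma> \<partial>M) = (\<integral>\<omega>. char_eval \<omega> \<gamma> \<partial>M')"
  shows "M = M'"
proof (rule measure_eqI)
  interpret finite_borel_measures "{M, M'}"
    by (rule finite_borel_measures.intro) (auto simp only: insert_iff empty_iff finite.intros M M')
  have trig: "(\<integral>\<omega>. p \<omega> \<partial>M) = (\<integral>\<omega>. p \<omega> \<partial>M')" if "trig_poly p" for p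
    using that
  proof induction
    case (monomial c \<gamma>)
    then show ?case using eq by simp
  next
    case (add p q)
    then show ?case
      using bounded_borel_integrable[OF trig_poly_bounded_borel] by simp
  qed
  fix E assume "E \<in> sets M"
  then have E: "E \<in> sets borel" "E \<in> sets M" "E \<in> sets M'" using M M' by auto
  have "dist (complex_of_real (measure M E)) (complex_of_real (measure M' E)) \<le> e" if "e > 0" for e
  proof -
    have "e / 2 > 0" using that by simp
    then obtain p where p: "trig_poly p"
      "L1_dist M (indicator E) p < e / 2" "L1_dist M' (indicator E) p < e / 2"
      using approximable_indicator[OF E(1)] unfolding approximable_def by blast
    have *: "dist (complex_of_real (measure L E)) (\<integral>\<omega>. p \<omega> \<partial>L) < e / 2" if L: "L \<in> {M, M'}" for L
    proof -
      have "integrable L (indicator E :: _ \<Rightarrow> complex)" "integrable L p"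
        using L approximable_indicator[OF E(1)] p(1)
        by - (rule bounded_borel_integrable; simp add: approximable_def trig_poly_bounded_borel)+
      moreover have "complex_of_real (measure L E) = (\<integral>\<omega>. indicator E \<omega> \<partial>L)"
      proof -
        have "(indicator E :: _ \<Rightarrow> complex) = (\<lambda>\<omega>. complex_of_real (indicator E \<omega>))"
          by (auto simp: indicator_def)
        moreover have "E \<subseteq> space L" using L E sets.sets_into_space by blast
        ultimately show ?thesis by (simp add: Int_absorb2)
      qed
      ultimately have "dist (complex_of_real (measure L E)) (\<integral>\<omega>. p \<omega> \<partial>L)
          = cmod (\<integral>\<omega>. indicator E \<omega> - p \<omega> \<partial>L)"
        by (simp add: dist_norm)
      also have "\<dots> \<le> L1_dist L (indicator E) p" by (rule integral_norm_bound)
      also have "\<dots> < e / 2" using L p by auto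
      finally show ?thesis .
    qed
    have "dist (complex_of_real (measure M E)) (\<integral>\<omega>. p \<omega> \<partial>M) < e / 2"
      "dist (complex_of_real (measure M' E)) (\<integral>\<omega>. p \<omega> \<partial>M) < e / 2"
      using *[of M] *[of M'] trig[OF p(1)] by auto
    then show ?thesis by (metis dist_commute dist_triangle_half_l less_imp_le)
  qed
  then have "measure M E = measure M' E"
    by (metis dist_le_zero_iff field_le_epsilon add_0 of_real_eq_iff)
  then show "emeasure M E = emeasure M' E"
    by (simp add: finite_measure.emeasure_eq_measure M M')
qed (use M M' in simp)

lemma trig_poly_dense_L1:
  fixes M :: "'g::{ab_group_add,countable} dual measure" and f :: "'g dual \<Rightarrow> complex"
  assumes M: "finite_measure M" "sets M = sets borel"
    and "integrable M f" "e > 0"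
  shows "\<exists>p. trig_poly p \<and> L1_dist M f p < e"
  using assms(3,4)
proof (induction arbitrary: e rule: integrable_induct)
  interpret finite_borel_measures "{M}"
    by (rule finite_borel_measures.intro) (auto simp only: insert_iff empty_iff finite.intros M)
  note trig_int = bounded_borel_integrable[OF trig_poly_bounded_borel, of _ M, simplified]
  {
    case (base A c)
    have "approximable (\<lambda>\<omega>. c * indicator A \<omega>)"
      using base M by (intro approximable_mult approximable_const approximable_indicator) auto
    moreover have "(\<lambda>\<omega>. c * indicator A \<omega>) = (\<lambda>\<omega>. indicator A \<omega> *\<^sub>R c)"
      by (auto simp: indicator_def)
    ultimately have "approximable (\<lambda>\<omega>. indicator A \<omega> *\<^sub>R c)" by simp
    then show ?case using base unfolding approximable_def by simp
  next
    case (add f g)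
    have e2: "e / 2 > 0" using add by simp
    obtain p where p: "trig_poly p" "L1_dist M f p < e / 2"
      using add.IH(1)[OF e2] by blast
    obtain q where q: "trig_poly q" "L1_dist M g q < e / 2"
      using add.IH(2)[OF e2] by blast
    have "(\<integral>\<omega>. cmod (f \<omega> + g \<omega> - (p \<omega> + q \<omega>)) \<partial>M)
        \<le> L1_dist M f p + L1_dist M g q"
      by (intro L1_dist_add add.hyps trig_int p q)
    also have "\<dots> < e" using p q by simp
    finally show ?case using trig_poly.add[OF p(1) q(1)] by blast
  next
    case (lim f s)
    have [measurable]: "f \<in> borel_measurable M" "s n \<in> borel_measurable M" for n
      using lim by auto
    have "(\<lambda>n. \<integral>\<omega>. cmod (f \<omega> - s n \<omega>) \<partial>M) \<longlonglongrightarrow> (\<integral>\<omega>. 0 \<partial>M)"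
    proof (rule integral_dominated_convergence[where w = "\<lambda>\<omega>. 3 * cmod (f \<omega>)"])
      show "AE \<omega> in M. (\<lambda>n. cmod (f \<omega> - s n \<omega>)) \<longlonglongrightarrow> 0"
      proof (rule AE_I2)
        fix \<omega> assume "\<omega> \<in> space M"
        from tendsto_norm[OF tendsto_diff[OF tendsto_const[of "f \<omega>"] lim(2)[OF this]]]
        show "(\<lambda>n. cmod (f \<omega> - s n \<omega>)) \<longlonglongrightarrow> 0" by simp
      qed
      show "AE \<omega> in M. norm (cmod (f \<omega> - s n \<omega>)) \<le> 3 * cmod (f \<omega>)" for n
      proof (rule AE_I2)
        fix \<omega> assume "\<omega> \<in> space M"
        from lim(3)[OF this, of n] norm_triangle_ineq4[of "f \<omega>" "s n \<omega>"]
        show "norm (cmod (f \<omega> - s n \<omega>)) \<le> 3 * cmod (f \<omega>)" by simp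
      qed
      show "integrable M (\<lambda>\<omega>. 3 * cmod (f \<omega>))" using lim by auto
    qed auto
    then have "\<forall>\<^sub>F n in sequentially. L1_dist M f (s n) < e / 2"
      using lim by (intro order_tendstoD(2)[where y = 0]) auto
    from eventually_happens'[OF sequentially_bot this]
  obtain n where n: "L1_dist M f (s n) < e / 2"
      by blast
    have "e / 2 > 0" using lim by simp
    then obtain p where p: "trig_poly p" "L1_dist M (s n) p < e / 2"
      using lim.IH by blast
    have "L1_dist M f p
        \<le> L1_dist M f (s n) + L1_dist M (s n) p"
      by (intro L1_dist_triangle lim.hyps trig_int p)
    also have "\<dots> < e" using p n by simp
    finally show ?case using p(1) by blast
  }
qed

section \<open>The dual endomorphism and its kernel\<close>

locale dual_endomorphism =
  fixes \<alpha> :: "'g::{ab_group_add,countable} \<Rightarrow> 'g" and N :: nat and \<mu> :: "'g dual measure"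
  assumes additive_\<alpha>: "Modules.additive \<alpha>"
    and inj_\<alpha>: "inj \<alpha>"
    and index_\<alpha>: "card (range (\<lambda>g. (+) g ` range \<alpha>)) = N"
    and N_gt_1: "N > 1"
    and Inter_range: "(\<Inter>n. range (\<alpha> ^^ n)) = {0}"
    and haar: "haar_measure \<mu>"
begin

abbreviation T :: "'g dual \<Rightarrow> 'g dual" where
  "T \<equiv> dual_map \<alpha>"

definition K :: "'g dual set" where
  "K = {\<kappa>. T \<kappa> = 1}"

lemma char_eval_T [simp]: "char_eval (T \<omega>) \<gamma> = char_eval \<omega> (\<alpha> \<gamma>)"
  by (rule char_eval_dual_map[OF additive_\<alpha>])

lemma \<alpha>_diff: "\<alpha> (a - b) = \<alpha> a - \<alpha> b"
  by (rule Modules.additive.diff[OF additive_\<alpha>])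

lemma \<alpha>_zero [simp]: "\<alpha> 0 = 0"
  by (rule Modules.additive.zero[OF additive_\<alpha>])

lemma range_\<alpha>_diff: "a \<in> range \<alpha> \<Longrightarrow> b \<in> range \<alpha> \<Longrightarrow> a - b \<in> range \<alpha>"
  by (auto simp: \<alpha>_diff[symmetric])

lemma zero_in_range_\<alpha>: "0 \<in> range \<alpha>"
  using rangeI[of \<alpha> 0] by simp

lemma T_times: "T (\<omega> * \<kappa>) = T \<omega> * T \<kappa>"
  by (rule dual_eqI) (simp add: char_eval_times)

lemma T_one [simp]: "T 1 = 1"
  by (rule dual_eqI) simp

lemma K_iff: "\<kappa> \<in> K \<longleftrightarrow> (\<forall>a\<in>range \<alpha>. char_eval \<kappa> a = 1)"
proof
  assume "\<kappa> \<in> K"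
  then have "char_eval (T \<kappa>) \<gamma> = 1" for \<gamma> unfolding K_def by simp
  then show "\<forall>a\<in>range \<alpha>. char_eval \<kappa> a = 1" by simp
next
  assume "\<forall>a\<in>range \<alpha>. char_eval \<kappa> a = 1"
  then show "\<kappa> \<in> K" unfolding K_def by (simp add: dual_eqI)
qed

lemma one_in_K: "1 \<in> K"
  unfolding K_def by simp

lemma K_times: "\<kappa> \<in> K \<Longrightarrow> \<kappa>' \<in> K \<Longrightarrow> \<kappa> * \<kappa>' \<in> K"
  unfolding K_def by (simp add: T_times)

lemma K_inv: "\<kappa> \<in> K \<Longrightarrow> dual_inv \<kappa> \<in> K"
  unfolding K_iff by (simp add: dual_inv.rep_eq)

lemma T_times_K: "\<kappa> \<in> K \<Longrightarrow> T (\<omega> * \<kappa>) = T \<omega>"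
  unfolding K_def by (simp add: T_times)

lemma same_fibre:
  assumes "T \<zeta> = T \<omega>"
  obtains \<kappa> where "\<kappa> \<in> K" "\<zeta> = \<omega> * \<kappa>"
proof
  have "T (\<zeta> * dual_inv \<omega>) = T (\<omega> * dual_inv \<omega>)"
    using assms by (simp only: T_times)
  then show "\<zeta> * dual_inv \<omega> \<in> K" unfolding K_def by simp
  show "\<zeta> = \<omega> * (\<zeta> * dual_inv \<omega>)"
    by (simp add: mult.commute[of \<zeta>])
qed

lemma sum_fibre: "(\<Sum>\<zeta> | T \<zeta> = T \<omega>. f \<zeta>) = (\<Sum>\<kappa>\<in>K. f (\<omega> * \<kappa>))"
proof -
  have "{\<zeta>. T \<zeta> = T \<omega>} = (*) \<omega> ` K"
    using same_fibre T_times_K by (auto simp: image_iff) metis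
  moreover have "inj_on ((*) \<omega>) K"
    by (rule inj_onI) (simp add: dual_times_left_inject)
  ultimately show ?thesis by (simp add: sum.reindex)
qed

lemma char_eval_nat_multiple: "char_eval \<omega> (nat_multiple n g) = char_eval \<omega> g ^ n"
  by (induction n) (simp_all add: nat_multiple_Suc char_eval_add)

lemma coset_eq_iff: "(+) g ` range \<alpha> = (+) h ` range \<alpha> \<longleftrightarrow> g - h \<in> range \<alpha>"
proof
  assume eq: "(+) g ` range \<alpha> = (+) h ` range \<alpha>"
  have "g + 0 \<in> (+) g ` range \<alpha>" using zero_in_range_\<alpha> by blast
  then obtain a where "a \<in> range \<alpha>" "g = h + a" unfolding eq by force
  then show "g - h \<in> range \<alpha>" by simp
next
  have *: "(+) x ` range \<alpha> \<subseteq> (+) y ` range \<alpha>" if "y - x \<in> range \<alpha>" for x y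
  proof
    fix b assume "b \<in> (+) x ` range \<alpha>"
    then obtain a where a: "a \<in> range \<alpha>" "b = x + a" by blast
    have "b = y + (a - (y - x))" using a by simp
    then show "b \<in> (+) y ` range \<alpha>" using range_\<alpha>_diff[OF a(1) that] by blast
  qed
  assume "g - h \<in> range \<alpha>"
  moreover from range_\<alpha>_diff[OF zero_in_range_\<alpha> this] have "h - g \<in> range \<alpha>" by simp
  ultimately show "(+) g ` range \<alpha> = (+) h ` range \<alpha>" using * by blast
qed

lemma finite_cosets: "finite (range (\<lambda>g. (+) g ` range \<alpha>))"
  using index_\<alpha> N_gt_1 by (metis card.infinite not_less_zero)

lemma coset_representatives:
  obtains G rep where "finite G" "card G = N" "\<And>\<gamma>. rep \<gamma> \<in> G" "\<And>\<gamma>. \<gamma> - rep \<gamma> \<in> range \<alpha>"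
    "\<And>g h. g \<in> G \<Longrightarrow> h \<in> G \<Longrightarrow> g - h \<in> range \<alpha> \<Longrightarrow> g = h"
proof -
  let ?c = "\<lambda>g. (+) g ` range \<alpha>"
  define rep where "rep = (\<lambda>\<gamma>. inv_into UNIV ?c (?c \<gamma>))"
  have c_rep: "?c (rep \<gamma>) = ?c \<gamma>" for \<gamma>
    unfolding rep_def by (rule f_inv_into_f) simp
  have "range rep = inv_into UNIV ?c ` range ?c" by (auto simp: rep_def)
  then have fin: "finite (range rep)" using finite_cosets by simp
  have "card (range rep) = card (range ?c)"
    unfolding \<open>range rep = inv_into UNIV ?c ` range ?c\<close> by (rule card_image[OF inj_on_inv_into]) simp
  then have card: "card (range rep) = N" using index_\<alpha> by simp
  show thesis
  proof (rule that[OF fin card])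
    show "\<gamma> - rep \<gamma> \<in> range \<alpha>" for \<gamma> using c_rep[of \<gamma>] coset_eq_iff by metis
    show "g = h" if gh: "g \<in> range rep" "h \<in> range rep" "g - h \<in> range \<alpha>" for g h
    proof -
      obtain x y where "g = rep x" "h = rep y" using gh by blast
      then have "?c x = ?c y" using gh(3) c_rep coset_eq_iff by metis
      then show ?thesis using \<open>g = rep x\<close> \<open>h = rep y\<close> unfolding rep_def by simp
    qed
  qed simp
qed

text \<open>
  A multiple of every element lies in \<open>\<alpha>(\<Gamma>)\<close>, so at each of the finitely many coset
  representatives a character in the kernel can only take values among finitely many roots of unity.
\<close>

lemma finite_K: "finite K"
proof -
  obtain G rep where G: "finite G" "\<And>\<gamma>. rep \<gamma> \<in> G" "\<And>\<gamma>. \<gamma> - rep \<gamma> \<in> range \<alpha>"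
    by (rule coset_representatives) blast
  have "\<exists>d>0. nat_multiple d g \<in> range \<alpha>" for g
  proof -
    have "finite (range (\<lambda>n. rep (nat_multiple n g)))"
      using G(1,2) by (meson finite_subset image_subsetI)
    then have "\<not> inj (\<lambda>n. rep (nat_multiple n g))"
      using finite_imageD infinite_UNIV_nat by blast
    then obtain m n where mn: "m < n" "rep (nat_multiple m g) = rep (nat_multiple n g)"
      unfolding inj_def by (metis nat_neq_iff)
    have "nat_multiple (m + (n - m)) g - nat_multiple m g \<in> range \<alpha>"
      using range_\<alpha>_diff[OF G(3)[of "nat_multiple n g"] G(3)[of "nat_multiple m g"]] mn by simp
    then have "nat_multiple (n - m) g \<in> range \<alpha>" by (simp only: nat_multiple_add add_diff_cancel_left')
    then show ?thesis using mn(1) by (intro exI[of _ "n - m"]) simp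
  qed
  then obtain d where d: "\<And>g. d g > 0" "\<And>g. nat_multiple (d g) g \<in> range \<alpha>" by metis
  let ?r = "\<lambda>\<kappa>. restrict (char_eval \<kappa>) G"
  have "?r ` K \<subseteq> (\<Pi>\<^sub>E g\<in>G. {z. z ^ d g = 1})"
  proof (intro image_subsetI PiE_I)
    fix \<kappa> g assume "\<kappa> \<in> K"
    then have "char_eval \<kappa> (nat_multiple (d g) g) = 1" using d(2) unfolding K_iff by blast
    moreover assume "g \<in> G"
    ultimately show "?r \<kappa> g \<in> {z. z ^ d g = 1}" by (simp add: char_eval_nat_multiple)
  qed simp
  moreover have "finite (\<Pi>\<^sub>E g\<in>G. {z :: complex. z ^ d g = 1})"
  proof (rule finite_PiE[OF G(1)])
    fix g
    have "1 \<le> d g" using d(1)[of g] by simp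
    then show "finite {z :: complex. z ^ d g = 1}" by (rule finite_roots_unity)
  qed
  ultimately have "finite (?r ` K)" by (rule finite_subset)
  moreover have "inj_on ?r K"
  proof (rule inj_onI, rule dual_eqI)
    fix \<kappa> \<kappa>' \<gamma> assume K: "\<kappa> \<in> K" "\<kappa>' \<in> K" and eq: "?r \<kappa> = ?r \<kappa>'"
    have *: "char_eval \<kappa>1 \<gamma> = ?r \<kappa>1 (rep \<gamma>)" if "\<kappa>1 \<in> K" for \<kappa>1
    proof -
      have "char_eval \<kappa>1 (\<gamma> - rep \<gamma>) = 1" using that G(3) unfolding K_iff by blast
      then show ?thesis using G(2) by (simp add: char_eval_diff)
    qed
    show "char_eval \<kappa> \<gamma> = char_eval \<kappa>' \<gamma>"
      unfolding *[OF K(1)] *[OF K(2)] eq ..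
  qed
  ultimately show ?thesis by (rule finite_imageD)
qed

text \<open>
  Multiplication by a kernel element that is nontrivial at \<open>\<gamma>\<close> permutes the kernel, so the sum
  equals a multiple of itself with a factor other than 1.
\<close>

lemma sum_K_eq_0:
  assumes "\<gamma> \<notin> range \<alpha>"
  shows "(\<Sum>\<kappa>\<in>K. char_eval \<kappa> \<gamma>) = 0"
proof -
  obtain \<kappa>0 where \<kappa>0: "\<And>a. a \<in> range \<alpha> \<Longrightarrow> char_eval \<kappa>0 a = 1" "char_eval \<kappa>0 \<gamma> \<noteq> 1"
    using characters_separate[OF zero_in_range_\<alpha> range_\<alpha>_diff assms] by metis
  have mem: "\<kappa>0 \<in> K" using \<kappa>0(1) unfolding K_iff by blast
  have "bij_betw ((*) \<kappa>0) K K"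
  proof (rule bij_betw_byWitness[where f' = "(*) (dual_inv \<kappa>0)"])
    show "\<forall>a\<in>K. dual_inv \<kappa>0 * (\<kappa>0 * a) = a" "\<forall>a\<in>K. \<kappa>0 * (dual_inv \<kappa>0 * a) = a"
      by simp_all
  qed (use mem K_inv K_times in auto)
  then have "(\<Sum>\<kappa>\<in>K. char_eval \<kappa> \<gamma>) = (\<Sum>\<kappa>\<in>K. char_eval (\<kappa>0 * \<kappa>) \<gamma>)"
    by (rule sum.reindex_bij_betw[symmetric])
  also have "\<dots> = char_eval \<kappa>0 \<gamma> * (\<Sum>\<kappa>\<in>K. char_eval \<kappa> \<gamma>)"
    by (simp add: char_eval_times sum_distrib_left)
  finally show ?thesis using \<kappa>0(2) by simp
qed

text \<open>
  The sum of all values \<open>\<kappa> g\<close> of the characters of the finite group \<open>\<Gamma>/\<alpha>(\<Gamma>)\<close>, evaluated by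
  rows and by columns: only the trivial character and only the trivial coset contribute.
\<close>

lemma card_K: "card K = N"
proof -
  obtain G rep where G: "finite G" "card G = N" "\<And>\<gamma>. rep \<gamma> \<in> G" "\<And>\<gamma>. \<gamma> - rep \<gamma> \<in> range \<alpha>"
    and uniq: "\<And>g h. g \<in> G \<Longrightarrow> h \<in> G \<Longrightarrow> g - h \<in> range \<alpha> \<Longrightarrow> g = h"
    by (rule coset_representatives) blast
  have row: "(\<Sum>g\<in>G. char_eval \<kappa> g) = (if \<kappa> = 1 then of_nat N else 0)" if \<kappa>: "\<kappa> \<in> K" for \<kappa>
  proof (cases "\<kappa> = 1")
    case False
    then obtain \<delta> where \<delta>: "char_eval \<kappa> \<delta> \<noteq> 1" using dual_eqI[of \<kappa> 1] by auto
    have "inj_on (\<lambda>g. rep (g + \<delta>)) G"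
    proof (rule inj_onI)
      fix g h assume gh: "g \<in> G" "h \<in> G" "rep (g + \<delta>) = rep (h + \<delta>)"
      have "(g + \<delta> - rep (g + \<delta>)) - (h + \<delta> - rep (h + \<delta>)) \<in> range \<alpha>"
        by (intro range_\<alpha>_diff G(4))
      then show "g = h" using gh by (intro uniq) simp_all
    qed
    then have "bij_betw (\<lambda>g. rep (g + \<delta>)) G G"
      using G(1,3) by (simp add: bij_betw_def endo_inj_surj image_subsetI)
    then have "(\<Sum>g\<in>G. char_eval \<kappa> g) = (\<Sum>g\<in>G. char_eval \<kappa> (rep (g + \<delta>)))"
      by (rule sum.reindex_bij_betw[symmetric])
    also have "\<dots> = (\<Sum>g\<in>G. char_eval \<kappa> \<delta> * char_eval \<kappa> g)"
    proof (rule sum.cong[OF refl])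
      fix g
      have "char_eval \<kappa> (g + \<delta> - rep (g + \<delta>)) = 1" using \<kappa> G(4) unfolding K_iff by blast
      then show "char_eval \<kappa> (rep (g + \<delta>)) = char_eval \<kappa> \<delta> * char_eval \<kappa> g"
        by (simp add: char_eval_diff char_eval_add mult.commute)
    qed
    finally show ?thesis using \<delta> False by (simp add: sum_distrib_left[symmetric])
  qed (simp add: G)
  have column: "(\<Sum>\<kappa>\<in>K. char_eval \<kappa> g) = (if g = rep 0 then of_nat (card K) else 0)" if "g \<in> G" for g
  proof (cases "g \<in> range \<alpha>")
    case True
    have "g - (0 - (0 - rep 0)) \<in> range \<alpha>"
      by (intro range_\<alpha>_diff True zero_in_range_\<alpha> G(4))
    then have "g = rep 0" using uniq[OF that G(3)] by simp
    moreover have "(\<Sum>\<kappa>\<in>K. char_eval \<kappa> g) = (\<Sum>\<kappa>\<in>K. 1)"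
      by (rule sum.cong[OF refl]) (use True K_iff in blast)
    ultimately show ?thesis by simp
  next
    case False
    have "rep 0 \<in> range \<alpha>"
      using range_\<alpha>_diff[OF zero_in_range_\<alpha> G(4)[of 0]] by simp
    then show ?thesis using False sum_K_eq_0 by auto
  qed
  have "(of_nat N :: complex) = (\<Sum>\<kappa>\<in>K. \<Sum>g\<in>G. char_eval \<kappa> g)"
    using row one_in_K finite_K by simp
  also have "\<dots> = (\<Sum>g\<in>G. \<Sum>\<kappa>\<in>K. char_eval \<kappa> g)" by (rule sum.swap)
  also have "\<dots> = of_nat (card K)" using column G(1,3) by simp
  finally show ?thesis by (simp only: of_nat_eq_iff)
qed

section \<open>Invariance of Haar measure\<close>

lemma sets_\<mu> [simp, measurable_cong]: "sets \<mu> = sets borel"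
  using haar unfolding haar_measure_def by blast

lemma space_\<mu> [simp]: "space \<mu> = UNIV"
  using sets_eq_imp_space_eq[OF sets_\<mu>] by simp

sublocale finite_measure \<mu>
  using haar unfolding haar_measure_def by (intro finite_measureI) simp

lemma \<mu>_UNIV_pos: "measure \<mu> UNIV > 0"
  using haar emeasure_eq_measure[of UNIV] unfolding haar_measure_def
  by (metis ennreal_0 measure_nonneg order_le_less)

lemma not_AE_False: "\<not> (AE \<omega> in \<mu>. False)"
  using \<mu>_UNIV_pos by (simp add: AE_iff_measurable[OF _ refl] emeasure_eq_measure)

lemma distr_times: "distr \<mu> borel (\<lambda>\<omega>. \<omega> * \<kappa>) = \<mu>"
proof (rule measure_eqI)
  fix E assume "E \<in> sets (distr \<mu> borel (\<lambda>\<omega>. \<omega> * \<kappa>))"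
  then have E: "E \<in> sets borel" by simp
  have "emeasure (distr \<mu> borel (\<lambda>\<omega>. \<omega> * \<kappa>)) E = emeasure \<mu> ((\<lambda>\<omega>. \<omega> * \<kappa>) -` E)"
    using E by (simp add: emeasure_distr)
  also have "(\<lambda>\<omega>. \<omega> * \<kappa>) -` E = (*) (dual_inv \<kappa>) ` E"
  proof (intro equalityI subsetI)
    fix \<omega> assume "\<omega> \<in> (\<lambda>\<omega>. \<omega> * \<kappa>) -` E"
    moreover have "\<omega> = dual_inv \<kappa> * (\<omega> * \<kappa>)" by (simp add: mult.commute[of \<omega>])
    ultimately show "\<omega> \<in> (*) (dual_inv \<kappa>) ` E" by blast
  qed (auto simp: mult.commute[of "dual_inv \<kappa>"])
  also have "emeasure \<mu> \<dots> = emeasure \<mu> E"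
    using haar E unfolding haar_measure_def by blast
  finally show "emeasure (distr \<mu> borel (\<lambda>\<omega>. \<omega> * \<kappa>)) E = emeasure \<mu> E" .
qed simp

lemma integral_char_eq_0:
  assumes "\<gamma> \<noteq> 0"
  shows "(\<integral>\<omega>. char_eval \<omega> \<gamma> \<partial>\<mu>) = 0"
proof -
  obtain \<kappa> where \<kappa>: "char_eval \<kappa> \<gamma> \<noteq> 1"
    using characters_separate[of "{0}" \<gamma>] assms by auto
  have "(\<integral>\<omega>. char_eval \<omega> \<gamma> \<partial>\<mu>) = (\<integral>\<omega>. char_eval \<omega> \<gamma> \<partial>(distr \<mu> borel (\<lambda>\<omega>. \<omega> * \<kappa>)))"
    by (simp only: distr_times)
  also have "\<dots> = (\<integral>\<omega>. char_eval \<omega> \<gamma> \<partial>\<mu>) * char_eval \<kappa> \<gamma>"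
    by (subst integral_distr) (auto simp: char_eval_times)
  finally show ?thesis using \<kappa> by simp
qed

lemma measurable_T [measurable]: "T \<in> borel_measurable borel"
  by (rule measurable_into_dual) simp

text \<open>
  Both measures have the same Fourier coefficients: they vanish at every \<open>\<gamma> \<noteq> 0\<close>, since \<open>\<alpha>\<close> is
  injective and so \<open>\<alpha> \<gamma> \<noteq> 0\<close>.
\<close>

lemma distr_T: "distr \<mu> borel T = \<mu>"
proof (rule finite_measure_eqI_Fourier)
  show "finite_measure (distr \<mu> borel T)"
    by (rule finite_measure_distr) simp
  show "finite_measure \<mu>" by unfold_locales
  fix \<gamma>
  have *: "(\<integral>\<omega>. char_eval \<omega> \<gamma> \<partial>distr \<mu> borel T) = (\<integral>\<omega>. char_eval \<omega> (\<alpha> \<gamma>) \<partial>\<mu>)"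
    by (subst integral_distr) auto
  show "(\<integral>\<omega>. char_eval \<omega> \<gamma> \<partial>distr \<mu> borel T) = (\<integral>\<omega>. char_eval \<omega> \<gamma> \<partial>\<mu>)"
  proof (cases "\<gamma> = 0")
    case False
    then have "\<alpha> \<gamma> \<noteq> 0" using inj_\<alpha> \<alpha>_zero by (metis injD)
    then show ?thesis unfolding * using False by (simp add: integral_char_eq_0)
  qed (simp add: * measure_distr)
qed simp_all

lemma AE_T:
  assumes "AE \<omega> in \<mu>. P \<omega>"
  shows "AE \<omega> in \<mu>. P (T \<omega>)"
proof (rule AE_distrD[where f = T and M' = borel])
  show "AE \<omega> in distr \<mu> borel T. P \<omega>" unfolding distr_T by (rule assms)
qed simp

lemma AE_times:
  assumes "AE \<omega> in \<mu>. P \<omega>"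
  shows "AE \<omega> in \<mu>. P (\<omega> * \<kappa>)"
proof (rule AE_distrD[where f = "\<lambda>\<omega>. \<omega> * \<kappa>" and M' = borel])
  show "AE \<omega> in distr \<mu> borel (\<lambda>\<omega>. \<omega> * \<kappa>). P \<omega>" unfolding distr_times by (rule assms)
qed simp

lemma AE_K: "AE \<omega> in \<mu>. P \<omega> \<Longrightarrow> AE \<omega> in \<mu>. \<forall>\<kappa>\<in>K. P (\<omega> * \<kappa>)"
  by (subst AE_finite_all[OF finite_K]) (simp add: AE_times)

lemma nn_integral_T:
  assumes [measurable]: "f \<in> borel_measurable borel"
  shows "(\<integral>\<^sup>+\<omega>. f (T \<omega>) \<partial>\<mu>) = (\<integral>\<^sup>+\<omega>. f \<omega> \<partial>\<mu>)"
  by (subst (2) distr_T[symmetric]) (simp add: nn_integral_distr)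

lemma nn_integral_times:
  assumes [measurable]: "f \<in> borel_measurable borel"
  shows "(\<integral>\<^sup>+\<omega>. f (\<omega> * \<kappa>) \<partial>\<mu>) = (\<integral>\<^sup>+\<omega>. f \<omega> \<partial>\<mu>)"
  by (subst (2) distr_times[of \<kappa>, symmetric]) (simp add: nn_integral_distr)

lemma integrable_T:
  fixes f :: "'g dual \<Rightarrow> 'b::{banach, second_countable_topology}"
  assumes "integrable \<mu> f"
  shows "integrable \<mu> (\<lambda>\<omega>. f (T \<omega>))" "(\<integral>\<omega>. f (T \<omega>) \<partial>\<mu>) = (\<integral>\<omega>. f \<omega> \<partial>\<mu>)"
proof -
  have [measurable]: "f \<in> borel_measurable borel" using assms by auto
  show "integrable \<mu> (\<lambda>\<omega>. f (T \<omega>))"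
    by (rule integrable_distr[of T \<mu> borel f]) (use assms in \<open>simp_all add: distr_T\<close>)
  show "(\<integral>\<omega>. f (T \<omega>) \<partial>\<mu>) = (\<integral>\<omega>. f \<omega> \<partial>\<mu>)"
    by (subst (2) distr_T[symmetric]) (simp add: integral_distr)
qed

lemma integrable_times:
  fixes f :: "'g dual \<Rightarrow> 'b::{banach, second_countable_topology}"
  assumes "integrable \<mu> f"
  shows "integrable \<mu> (\<lambda>\<omega>. f (\<omega> * \<kappa>))" "(\<integral>\<omega>. f (\<omega> * \<kappa>) \<partial>\<mu>) = (\<integral>\<omega>. f \<omega> \<partial>\<mu>)"
proof -
  have [measurable]: "f \<in> borel_measurable borel" using assms by auto
  show "integrable \<mu> (\<lambda>\<omega>. f (\<omega> * \<kappa>))"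
    by (rule integrable_distr[of "\<lambda>\<omega>. \<omega> * \<kappa>" \<mu> borel f]) (use assms in \<open>simp_all add: distr_times\<close>)
  show "(\<integral>\<omega>. f (\<omega> * \<kappa>) \<partial>\<mu>) = (\<integral>\<omega>. f \<omega> \<partial>\<mu>)"
    by (subst (2) distr_times[of \<kappa>, symmetric]) (simp add: integral_distr)
qed

text \<open>
  \<open>fibre_mean \<phi> \<psi>\<close> says that \<open>\<psi> (T \<omega>)\<close> is the average of \<open>\<phi>\<close> over the fibre of \<open>T\<close> through \<open>\<omega>\<close>.
  Stating this as a relation on the source of \<open>T\<close> avoids the question whether
  fibre averages are Borel functions on the target.
\<close>

definition fibre_mean :: "('g dual \<Rightarrow> 'b::semiring_1) \<Rightarrow> ('g dual \<Rightarrow> 'b) \<Rightarrow> bool" where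
  "fibre_mean \<phi> \<psi> \<longleftrightarrow> (AE \<omega> in \<mu>. (\<Sum>\<kappa>\<in>K. \<phi> (\<omega> * \<kappa>)) = of_nat N * \<psi> (T \<omega>))"

lemma fibre_mean_nn_integral:
  fixes \<phi> \<psi> :: "'g dual \<Rightarrow> ennreal"
  assumes "fibre_mean \<phi> \<psi>" and [measurable]: "\<phi> \<in> borel_measurable borel" "\<psi> \<in> borel_measurable borel"
  shows "(\<integral>\<^sup>+\<omega>. \<phi> \<omega> \<partial>\<mu>) = (\<integral>\<^sup>+\<omega>. \<psi> \<omega> \<partial>\<mu>)"
proof -
  have "of_nat N * (\<integral>\<^sup>+\<omega>. \<phi> \<omega> \<partial>\<mu>) = (\<Sum>\<kappa>\<in>K. \<integral>\<^sup>+\<omega>. \<phi> (\<omega> * \<kappa>) \<partial>\<mu>)"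
    by (simp add: nn_integral_times card_K)
  also have "\<dots> = (\<integral>\<^sup>+\<omega>. (\<Sum>\<kappa>\<in>K. \<phi> (\<omega> * \<kappa>)) \<partial>\<mu>)"
    by (rule nn_integral_sum[symmetric]) simp
  also have "\<dots> = (\<integral>\<^sup>+\<omega>. of_nat N * \<psi> (T \<omega>) \<partial>\<mu>)"
    by (rule nn_integral_cong_AE) (use assms(1) in \<open>simp add: fibre_mean_def\<close>)
  also have "\<dots> = of_nat N * (\<integral>\<^sup>+\<omega>. \<psi> \<omega> \<partial>\<mu>)"
    by (simp add: nn_integral_cmult nn_integral_T)
  finally show ?thesis
    using N_gt_1 by (simp add: ennreal_mult_cancel_left ennreal_of_nat_eq_real_of_nat)
qed

lemma fibre_mean_integral:
  fixes \<phi> \<psi> :: "'g dual \<Rightarrow> complex"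
  assumes "fibre_mean \<phi> \<psi>" and int: "integrable \<mu> \<phi>" "integrable \<mu> \<psi>"
  shows "(\<integral>\<omega>. \<psi> \<omega> \<partial>\<mu>) = (\<integral>\<omega>. \<phi> \<omega> \<partial>\<mu>)"
    and "(\<integral>\<omega>. cmod (\<psi> \<omega>) \<partial>\<mu>) \<le> (\<integral>\<omega>. cmod (\<phi> \<omega>) \<partial>\<mu>)"
proof -
  have [measurable]: "\<phi> \<in> borel_measurable borel" "\<psi> \<in> borel_measurable borel" using int by auto
  have AE: "AE \<omega> in \<mu>. (\<Sum>\<kappa>\<in>K. \<phi> (\<omega> * \<kappa>)) = of_nat N * \<psi> (T \<omega>)"
    using assms(1) unfolding fibre_mean_def .
  have "of_nat N * (\<integral>\<omega>. \<psi> \<omega> \<partial>\<mu>) = (\<integral>\<omega>. of_nat N * \<psi> (T \<omega>) \<partial>\<mu>)"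
    using integrable_T[OF int(2)] by simp
  also have "\<dots> = (\<integral>\<omega>. (\<Sum>\<kappa>\<in>K. \<phi> (\<omega> * \<kappa>)) \<partial>\<mu>)"
    using AE by (intro integral_cong_AE) auto
  also have "\<dots> = of_nat N * (\<integral>\<omega>. \<phi> \<omega> \<partial>\<mu>)"
    using integrable_times[OF int(1)] by (simp add: Bochner_Integration.integral_sum card_K)
  finally show "(\<integral>\<omega>. \<psi> \<omega> \<partial>\<mu>) = (\<integral>\<omega>. \<phi> \<omega> \<partial>\<mu>)" using N_gt_1 by simp
  note nint = integrable_times[OF integrable_norm[OF int(1)]] integrable_T[OF integrable_norm[OF int(2)]]
  have "real N * (\<integral>\<omega>. cmod (\<psi> \<omega>) \<partial>\<mu>) = (\<integral>\<omega>. real N * cmod (\<psi> (T \<omega>)) \<partial>\<mu>)"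
    using nint by simp
  also have "\<dots> \<le> (\<integral>\<omega>. (\<Sum>\<kappa>\<in>K. cmod (\<phi> (\<omega> * \<kappa>))) \<partial>\<mu>)"
  proof (rule integral_mono_AE)
    show "AE \<omega> in \<mu>. real N * cmod (\<psi> (T \<omega>)) \<le> (\<Sum>\<kappa>\<in>K. cmod (\<phi> (\<omega> * \<kappa>)))"
      using AE
    proof eventually_elim
      case (elim \<omega>)
      have "real N * cmod (\<psi> (T \<omega>)) = cmod (\<Sum>\<kappa>\<in>K. \<phi> (\<omega> * \<kappa>))"
        unfolding elim by (simp add: norm_mult)
      then show ?case using norm_sum[of "\<lambda>\<kappa>. \<phi> (\<omega> * \<kappa>)" K] by simp
    qed
  qed (use nint in auto)
  also have "\<dots> = real N * (\<integral>\<omega>. cmod (\<phi> \<omega>) \<partial>\<mu>)"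
    using nint by (simp add: Bochner_Integration.integral_sum card_K)
  finally show "(\<integral>\<omega>. cmod (\<psi> \<omega>) \<partial>\<mu>) \<le> (\<integral>\<omega>. cmod (\<phi> \<omega>) \<partial>\<mu>)" using N_gt_1 by simp
qed

end

section \<open>Equidistribution of iterated fibre means\<close>

context dual_endomorphism
begin

lemma nonzero_leaves_range:
  assumes "\<gamma> \<noteq> 0"
  obtains j \<gamma>' where "\<gamma> = (\<alpha> ^^ j) \<gamma>'" "\<gamma>' \<notin> range \<alpha>"
proof -
  let ?P = "\<lambda>n. \<gamma> \<notin> range (\<alpha> ^^ n)"
  have "\<exists>n. ?P n" using Inter_range assms by auto
  then have P: "?P (LEAST n. ?P n)" by (rule LeastI_ex)
  have "(LEAST n. ?P n) \<noteq> 0"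
  proof
    assume "(LEAST n. ?P n) = 0"
    with P show False by simp
  qed
  then obtain j where j: "(LEAST n. ?P n) = Suc j" using not0_implies_Suc by blast
  then have "\<not> ?P j" using not_less_Least[of j ?P] by simp
  then obtain \<gamma>' where \<gamma>': "\<gamma> = (\<alpha> ^^ j) \<gamma>'" by blast
  have "\<gamma>' \<notin> range \<alpha>"
  proof
    assume "\<gamma>' \<in> range \<alpha>"
    then obtain \<delta> where "\<gamma>' = \<alpha> \<delta>" by blast
    then have "\<gamma> = (\<alpha> ^^ Suc j) \<delta>" by (simp add: \<gamma>' funpow_swap1)
    then show False using P unfolding j by blast
  qed
  then show thesis using \<gamma>' that by blast
qed

lemma sum_K_char:
  "(\<Sum>\<kappa>\<in>K. char_eval (\<omega> * \<kappa>) \<gamma>) = (if \<gamma> \<in> range \<alpha> then of_nat N * char_eval \<omega> \<gamma> else 0)"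
proof (cases "\<gamma> \<in> range \<alpha>")
  case True
  then have "char_eval (\<omega> * \<kappa>) \<gamma> = char_eval \<omega> \<gamma>" if "\<kappa> \<in> K" for \<kappa>
    using that True by (auto simp: K_iff char_eval_times)
  then show ?thesis using True by (simp add: card_K)
next
  case False
  then show ?thesis
    using sum_K_eq_0[OF False] by (simp add: char_eval_times sum_distrib_left[symmetric])
qed

text \<open>
  Taking fibre means divides the frequency by \<open>\<alpha>\<close> and kills the frequencies outside
  \<open>\<alpha>(\<Gamma>)\<close>. A nonzero frequency is divisible by \<open>\<alpha>\<close> only finitely often, so after finitely many
  steps only the constant term of a trigonometric polynomial is left.
\<close>

lemma trig_poly_fibre_means:
  assumes "trig_poly p"
  shows "\<exists>q c n0. q 0 = p \<and> (\<forall>n. trig_poly (q n)) \<and>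
    (\<forall>n \<omega>. (\<Sum>\<kappa>\<in>K. q n (\<omega> * \<kappa>)) = of_nat N * q (Suc n) (T \<omega>)) \<and> (\<forall>n\<ge>n0. q n = (\<lambda>_. c))"
  using assms
proof induction
  case (monomial c \<gamma>)
  show ?case
  proof (cases "\<gamma> = 0")
    case True
    then show ?thesis
      by (intro exI[of _ "\<lambda>_ _. c"] exI[of _ c] exI[of _ 0]) (simp add: trig_poly_const card_K)
  next
    case False
    then obtain j \<gamma>' where \<gamma>': "\<gamma> = (\<alpha> ^^ j) \<gamma>'" "\<gamma>' \<notin> range \<alpha>" by (rule nonzero_leaves_range)
    define q where "q n \<omega> = (if n \<le> j then c * char_eval \<omega> ((\<alpha> ^^ (j - n)) \<gamma>') else 0)" for n \<omega>
    have "(\<Sum>\<kappa>\<in>K. q n (\<omega> * \<kappa>)) = of_nat N * q (Suc n) (T \<omega>)" for n \<omega>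
    proof (cases "n < j")
      case True
      then have "j - n = Suc (j - Suc n)" by simp
      then have "(\<alpha> ^^ (j - n)) \<gamma>' = \<alpha> ((\<alpha> ^^ (j - Suc n)) \<gamma>')" by simp
      then show ?thesis
        using True by (simp add: q_def sum_distrib_left[symmetric] sum_K_char)
    next
      case False
      then show ?thesis
        using \<gamma>'(2) by (cases "n = j") (auto simp: q_def sum_distrib_left[symmetric] sum_K_char)
    qed
    moreover have "trig_poly (q n)" for n
      unfolding q_def by (cases "n \<le> j") (auto intro: trig_poly.monomial trig_poly_const)
    moreover have "q 0 = (\<lambda>\<omega>. c * char_eval \<omega> \<gamma>)" "\<forall>n\<ge>Suc j. q n = (\<lambda>_. 0)"
      by (auto simp: q_def \<gamma>')
    ultimately show ?thesis by blast
  qed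
next
  case (add p1 p2)
  obtain q1 c1 n1 where q1: "q1 0 = p1" "\<forall>n. trig_poly (q1 n)"
    "\<forall>n \<omega>. (\<Sum>\<kappa>\<in>K. q1 n (\<omega> * \<kappa>)) = of_nat N * q1 (Suc n) (T \<omega>)" "\<forall>n\<ge>n1. q1 n = (\<lambda>_. c1)"
    using add.IH(1) by blast
  obtain q2 c2 n2 where q2: "q2 0 = p2" "\<forall>n. trig_poly (q2 n)"
    "\<forall>n \<omega>. (\<Sum>\<kappa>\<in>K. q2 n (\<omega> * \<kappa>)) = of_nat N * q2 (Suc n) (T \<omega>)" "\<forall>n\<ge>n2. q2 n = (\<lambda>_. c2)"
    using add.IH(2) by blast
  show ?case
    by (rule exI[of _ "\<lambda>n \<omega>. q1 n \<omega> + q2 n \<omega>"], rule exI[of _ "c1 + c2"], rule exI[of _ "max n1 n2"])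
      (use q1 q2 in \<open>auto simp: sum.distrib distrib_left intro: trig_poly.add\<close>)
qed

text \<open>
  By density it suffices to treat trigonometric polynomials, because passing to fibre means does
  not increase the \<open>L\<^sup>1\<close> norm.
\<close>

theorem fibre_means_tendsto_mean:
  fixes \<phi> :: "nat \<Rightarrow> 'g dual \<Rightarrow> complex"
  assumes int: "\<And>n. integrable \<mu> (\<phi> n)" and mean: "\<And>n. fibre_mean (\<phi> n) (\<phi> (Suc n))"
    and c: "(\<integral>\<omega>. \<phi> 0 \<omega> \<partial>\<mu>) = of_real (measure \<mu> UNIV) * c"
  shows "(\<lambda>n. \<integral>\<omega>. cmod (\<phi> n \<omega> - c) \<partial>\<mu>) \<longlonglongrightarrow> 0"
proof (rule LIMSEQ_I)
  interpret finite_borel_measures "{\<mu>}"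
    by (rule finite_borel_measures.intro) (auto simp only: insert_iff empty_iff finite.intros sets_\<mu> finite_measure_axioms)
  note trig_int = bounded_borel_integrable[OF trig_poly_bounded_borel, of _ \<mu>, simplified]
  fix e :: real assume "e > 0"
  then have e2: "e / 2 > 0" by simp
  obtain p where p: "trig_poly p" "L1_dist \<mu> (\<phi> 0) p < e / 2"
    using trig_poly_dense_L1[OF finite_measure_axioms sets_\<mu> int e2] by blast
  obtain q c' n0 where q: "q 0 = p" "\<And>n. trig_poly (q n)"
    "\<And>n \<omega>. (\<Sum>\<kappa>\<in>K. q n (\<omega> * \<kappa>)) = of_nat N * q (Suc n) (T \<omega>)" "\<And>n. n \<ge> n0 \<Longrightarrow> q n = (\<lambda>_. c')"
    using trig_poly_fibre_means[OF p(1)] by blast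
  have close: "L1_dist \<mu> (\<phi> n) (q n) < e / 2" for n
  proof (induction n)
    case 0
    then show ?case using p q(1) by simp
  next
    case (Suc n)
    have "fibre_mean (\<lambda>\<omega>. \<phi> n \<omega> - q n \<omega>) (\<lambda>\<omega>. \<phi> (Suc n) \<omega> - q (Suc n) \<omega>)"
      using mean[of n] unfolding fibre_mean_def
      by eventually_elim (simp add: sum_subtractf q(3) right_diff_distrib)
    from fibre_mean_integral(2)[OF this] Suc show ?case
      using int trig_int[OF q(2)] by simp
  qed
  have integral_\<phi>: "(\<integral>\<omega>. \<phi> n \<omega> \<partial>\<mu>) = (\<integral>\<omega>. \<phi> 0 \<omega> \<partial>\<mu>)" for n
    by (induction n) (simp_all add: fibre_mean_integral(1)[OF mean int int])
  have "norm ((\<integral>\<omega>. cmod (\<phi> n \<omega> - c) \<partial>\<mu>) - 0) < e" if "n \<ge> n0" for n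
  proof -
    have cl: "(\<integral>\<omega>. cmod (\<phi> n \<omega> - c') \<partial>\<mu>) < e / 2" using close[of n] q(4)[OF that] by simp
    have "(\<integral>\<omega>. \<phi> n \<omega> - c' \<partial>\<mu>) = of_real (measure \<mu> UNIV) * (c - c')"
      using int[of n] integral_\<phi>[of n] c by (simp add: scaleR_conv_of_real algebra_simps)
    then have "measure \<mu> UNIV * cmod (c' - c) = cmod (\<integral>\<omega>. \<phi> n \<omega> - c' \<partial>\<mu>)"
      by (simp add: norm_mult norm_minus_commute)
    also have "\<dots> \<le> (\<integral>\<omega>. cmod (\<phi> n \<omega> - c') \<partial>\<mu>)" by (rule integral_norm_bound)
    finally have cc: "measure \<mu> UNIV * cmod (c' - c) < e / 2" using cl by simp
    have "(\<integral>\<omega>. cmod (\<phi> n \<omega> - c) \<partial>\<mu>) \<le> (\<integral>\<omega>. cmod (\<phi> n \<omega> - c') \<partial>\<mu>) + (\<integral>\<omega>. cmod (c' - c) \<partial>\<mu>)"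
      by (intro L1_dist_triangle int integrable_const)
    also have "\<dots> = (\<integral>\<omega>. cmod (\<phi> n \<omega> - c') \<partial>\<mu>) + measure \<mu> UNIV * cmod (c' - c)" by simp
    also have "\<dots> < e" using cl cc by simp
    finally show ?thesis by simp
  qed
  then show "\<exists>n0. \<forall>n\<ge>n0. norm ((\<integral>\<omega>. cmod (\<phi> n \<omega> - c) \<partial>\<mu>) - 0) < e" by blast
qed

end

section \<open>Null sets and fibres\<close>

text \<open>
  The dual group is a closed subset of the Polish space of all complex functions on \<open>\<Gamma>\<close>, where
  finite Borel measures are inner regular with respect to compact sets. The next two lemmas
  translate between the two spaces.
\<close>

lemma borel_dual_vimage:
  fixes S :: "'g::{ab_group_add,countable} dual set"
  assumes "S \<in> sets borel"
  obtains V where "V \<in> sets borel" "S = char_eval -` V"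
proof -
  have "S \<in> sigma_sets UNIV {S. open S}" using assms by (simp add: borel_def)
  then have "\<exists>V\<in>sets borel. S = char_eval -` V"
  proof induction
    case (Basic S)
    then show ?case unfolding open_dual_def by (auto intro: borel_open)
  next
    case Empty
    then show ?case by (intro bexI[of _ "{}"]) auto
  next
    case (Compl S)
    then obtain V where "V \<in> sets borel" "S = char_eval -` V" by blast
    then show ?case by (intro bexI[of _ "- V"]) (auto intro: borel_comp)
  next
    case (Union S)
    then obtain V where "\<And>i::nat. V i \<in> sets borel \<and> S i = char_eval -` V i" by metis
    then show ?case by (intro bexI[of _ "\<Union>i. V i"]) auto
  qed
  then show thesis using that by blast
qed

lemma closed_range_char_eval: "closed (range (char_eval :: 'g::ab_group_add dual \<Rightarrow> _))"
proof -
  have "range (char_eval :: 'g dual \<Rightarrow> _) =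
      {\<phi>. (\<forall>a b. \<phi> (a + b) = \<phi> a * \<phi> b) \<and> (\<forall>a. cmod (\<phi> a) = 1)}"
    by (rule type_definition.Rep_range[OF type_definition_dual])
  moreover have "closed {\<phi> :: 'g \<Rightarrow> complex. (\<forall>a b. \<phi> (a + b) = \<phi> a * \<phi> b) \<and> (\<forall>a. cmod (\<phi> a) = 1)}"
    by (intro closed_Collect_conj closed_Collect_all closed_Collect_eq continuous_intros
        continuous_on_product_coordinates)
  ultimately show ?thesis by simp
qed

context dual_endomorphism
begin

text \<open>
  A null set is contained in a fibrewise saturated Borel null set. Its complement contains compact
  sets of almost full measure; \<open>T\<close> maps them to compact, hence Borel, sets of at
  least the same measure, which miss the image of the null set. So \<open>T\<close> maps null sets to null sets,
  and a property of almost all points holds on the entire fibre of almost every point.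
\<close>

lemma AE_fibre:
  assumes "AE \<omega> in \<mu>. P \<omega>"
  shows "AE \<omega> in \<mu>. \<forall>\<zeta>. T \<zeta> = \<omega> \<longrightarrow> P \<zeta>"
proof -
  have "AE \<omega> in \<mu>. \<forall>\<kappa>\<in>K. P (\<omega> * \<kappa>)" by (rule AE_K[OF assms])
  then obtain E where E: "{\<omega> \<in> space \<mu>. \<not> (\<forall>\<kappa>\<in>K. P (\<omega> * \<kappa>))} \<subseteq> E" "E \<in> null_sets \<mu>"
    unfolding eventually_ae_filter by blast
  define F where "F = - E"
  have F: "F \<in> sets borel" using E(2) unfolding F_def by (intro borel_comp) (simp add: null_sets_def)
  have PF: "P (\<omega> * \<kappa>)" if "\<omega> \<in> F" "\<kappa> \<in> K" for \<omega> \<kappa>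
    using that E(1) unfolding F_def by auto
  have mF: "emeasure \<mu> F = emeasure \<mu> UNIV"
    using emeasure_Diff_null_set[OF E(2), of UNIV] F_def by (simp add: Compl_eq_Diff_UNIV)
  obtain V where V: "V \<in> sets borel" "F = char_eval -` V" using borel_dual_vimage[OF F] by blast
  have [measurable]: "(char_eval :: 'g dual \<Rightarrow> _) \<in> borel_measurable borel"
    by (rule measurable_coordinatewise_then_product) simp
  define X where "X = range (char_eval :: 'g dual \<Rightarrow> _)"
  have X: "X \<in> sets borel" unfolding X_def by (rule borel_closed[OF closed_range_char_eval])
  define \<nu> where "\<nu> = distr \<mu> borel char_eval"
  have \<nu>: "emeasure \<nu> A = emeasure \<mu> (char_eval -` A)" if "A \<in> sets borel" for A
    unfolding \<nu>_def using that by (simp add: emeasure_distr)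
  have "char_eval -` (V \<inter> X) = F" by (auto simp: V X_def)
  then have \<nu>V: "emeasure \<nu> (V \<inter> X) = emeasure \<mu> UNIV" using \<nu>[of "V \<inter> X"] V X mF by simp
  have SUP: "(SUP C \<in> {C. C \<subseteq> V \<inter> X \<and> compact C}. emeasure \<nu> C) = emeasure \<mu> UNIV"
    unfolding \<nu>V[symmetric]
  proof (rule inner_regular[symmetric])
    show "emeasure \<nu> (space \<nu>) \<noteq> \<infinity>" using \<nu>[of UNIV] by (simp add: \<nu>_def)
  qed (use V X in \<open>auto simp: \<nu>_def\<close>)
  define pull where "pull = (\<lambda>(\<phi> :: 'g \<Rightarrow> complex) \<gamma>. \<phi> (\<alpha> \<gamma>))"
  have cont: "continuous_on A pull" for A
    unfolding pull_def
    by (rule continuous_on_coordinatewise_then_product)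
      (rule continuous_on_subset[OF continuous_on_product_coordinates subset_UNIV])
  have pull_char: "pull (char_eval \<zeta>) = char_eval (T \<zeta>)" for \<zeta>
    by (rule ext) (simp add: pull_def)
  define good where "good n B \<longleftrightarrow> B \<in> sets borel \<and> B \<subseteq> {\<omega>. \<forall>\<zeta>. T \<zeta> = \<omega> \<longrightarrow> P \<zeta>} \<and>
      emeasure \<mu> UNIV < emeasure \<mu> B + ennreal (1 / real (Suc n))" for n B
  have "\<exists>B. good n B" for n
  proof -
    have "\<exists>C\<in>{C. C \<subseteq> V \<inter> X \<and> compact C}. emeasure \<mu> UNIV < emeasure \<nu> C + ennreal (1 / real (Suc n))"
    proof (rule SUP_approx_ennreal[OF _ _ SUP[symmetric]])
      show "{C. C \<subseteq> V \<inter> X \<and> compact C} \<noteq> {}" using compact_empty by blast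
    qed simp_all
    then obtain C where C: "C \<subseteq> V \<inter> X" "compact C"
      "emeasure \<mu> UNIV < emeasure \<nu> C + ennreal (1 / real (Suc n))"
      by blast
    define B where "B = (char_eval -` (pull ` C) :: 'g dual set)"
    have "pull ` C \<in> sets borel"
      by (intro borel_closed compact_imp_closed compact_continuous_image cont C)
    then have B: "B \<in> sets borel"
      using measurable_sets[of char_eval "borel :: 'g dual measure" borel "pull ` C"] by (simp add: B_def)
    have "P \<zeta>" if "T \<zeta> \<in> B" for \<zeta>
    proof -
      obtain \<phi> where \<phi>: "\<phi> \<in> C" "char_eval (T \<zeta>) = pull \<phi>" using \<open>T \<zeta> \<in> B\<close> unfolding B_def by blast
      then obtain \<eta> where \<eta>: "\<phi> = char_eval \<eta>" "\<eta> \<in> F" using C(1) by (auto simp: X_def V)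
      then have "T \<zeta> = T \<eta>" using \<phi>(2) pull_char char_eval_inject by metis
      then obtain \<kappa> where "\<kappa> \<in> K" "\<zeta> = \<eta> * \<kappa>" by (rule same_fibre)
      then show ?thesis using PF \<eta>(2) by simp
    qed
    then have sub: "B \<subseteq> {\<omega>. \<forall>\<zeta>. T \<zeta> = \<omega> \<longrightarrow> P \<zeta>}" by blast
    have "char_eval -` C \<subseteq> T -` B" by (auto simp: B_def pull_char[symmetric])
    then have "emeasure \<mu> (char_eval -` C) \<le> emeasure \<mu> (T -` B)"
      using measurable_sets[OF measurable_T B] by (intro emeasure_mono) simp_all
    also have "\<dots> = emeasure (distr \<mu> borel T) B"
      using B by (simp add: emeasure_distr del: char_eval_T)
    finally have "emeasure \<nu> C \<le> emeasure \<mu> B"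
      using \<nu>[of C] C(2) by (simp add: distr_T borel_compact)
    then have "emeasure \<nu> C + ennreal (1 / real (Suc n)) \<le> emeasure \<mu> B + ennreal (1 / real (Suc n))"
      by (rule add_right_mono)
    with C(3) have "emeasure \<mu> UNIV < emeasure \<mu> B + ennreal (1 / real (Suc n))"
      by (rule less_le_trans)
    with B sub have "good n B" unfolding good_def by blast
    then show ?thesis ..
  qed
  then obtain B where "\<And>n. good n (B n)" by metis
  then have B: "B n \<in> sets borel" "B n \<subseteq> {\<omega>. \<forall>\<zeta>. T \<zeta> = \<omega> \<longrightarrow> P \<zeta>}"
    "emeasure \<mu> UNIV < emeasure \<mu> (B n) + ennreal (1 / real (Suc n))" for n
    unfolding good_def by simp_all
  define D where "D = (\<Inter>n. - B n)"
  have D: "D \<in> sets borel" unfolding D_def using B(1) by auto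
  have "measure \<mu> D \<le> 1 / real (Suc n)" for n
  proof -
    have "measure \<mu> UNIV < measure \<mu> (B n) + 1 / real (Suc n)"
      using B(3)[of n] by (simp add: emeasure_eq_measure ennreal_plus[symmetric] ennreal_less_iff del: ennreal_plus)
    moreover have "measure \<mu> D \<le> measure \<mu> (UNIV - B n)"
      using B(1) D by (intro finite_measure_mono) (auto simp: D_def)
    moreover have "measure \<mu> (UNIV - B n) = measure \<mu> UNIV - measure \<mu> (B n)"
      using B(1) finite_measure_compl[of "B n"] by simp
    ultimately show ?thesis by simp
  qed
  then have "measure \<mu> D \<le> 0"
    using LIMSEQ_le_const[OF LIMSEQ_inverse_real_of_nat] by (simp add: inverse_eq_divide)
  then have "D \<in> null_sets \<mu>"
    using D by (simp add: null_sets_def emeasure_eq_measure measure_le_0_iff)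
  moreover have "{\<omega> \<in> space \<mu>. \<not> (\<forall>\<zeta>. T \<zeta> = \<omega> \<longrightarrow> P \<zeta>)} \<subseteq> D"
    using B(2) unfolding D_def by blast
  ultimately show ?thesis unfolding eventually_ae_filter by blast
qed

end

section \<open>The Ruelle operator on square-integrable functions\<close>

lemma infsum_block:
  assumes "\<And>i. i > n \<Longrightarrow> F i = 0"
  shows "infsum F {1::nat..} = (\<Sum>i=1..n. F i)"
proof -
  have "infsum F {1..} = infsum F {1..n}"
    by (rule infsum_cong_neutral) (use assms in auto)
  then show ?thesis by simp
qed

lemma measurable_block_sum:
  fixes k :: "'a \<Rightarrow> nat"
  assumes [measurable]: "k \<in> measurable M (count_space UNIV)"
    and "\<And>i. i \<ge> 1 \<Longrightarrow> (\<lambda>\<omega>. F \<omega> i) \<in> borel_measurable M"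
  shows "(\<lambda>\<omega>. \<Sum>i=1..k \<omega>. F \<omega> i :: 'b::{second_countable_topology, topological_comm_monoid_add})
    \<in> borel_measurable M"
proof (rule measurable_compose_countable[where f = "\<lambda>n \<omega>. \<Sum>i=1..n. F \<omega> i" and g = k])
  show "(\<lambda>\<omega>. \<Sum>i=1..n. F \<omega> i) \<in> borel_measurable M" for n
    by (rule borel_measurable_sum) (use assms(2) in auto)
qed measurable

lemma borel_measurable_cnj [measurable (raw)]:
  "f \<in> borel_measurable M \<Longrightarrow> (\<lambda>x. cnj (f x)) \<in> borel_measurable M"
  by (rule measurable_compose[OF _ borel_measurable_continuous_onI]) (auto intro: continuous_intros)

locale ruelle_operator = dual_endomorphism \<alpha> N \<mu>
  for \<alpha> :: "'g::{ab_group_add,countable} \<Rightarrow> 'g" and N :: nat and \<mu> :: "'g dual measure" +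
  fixes m :: "'g dual \<Rightarrow> nat" and H :: "'g dual \<Rightarrow> cmatrix"
  assumes m_measurable [measurable]: "m \<in> measurable borel (count_space UNIV)"
    and filter_H: "filter_relative \<mu> \<alpha> N m H"
begin

definition ae_eq :: "'g vfun \<Rightarrow> 'g vfun \<Rightarrow> bool" (infix "\<doteq>" 50) where
  "f \<doteq> g \<longleftrightarrow> (AE \<omega> in \<mu>. \<forall>i\<ge>1. f \<omega> i = g \<omega> i)"

definition components_measurable :: "'g vfun \<Rightarrow> bool" where
  "components_measurable f \<longleftrightarrow> (\<forall>i\<ge>1. (\<lambda>\<omega>. f \<omega> i) \<in> borel_measurable borel)"

definition supported :: "'g vfun \<Rightarrow> bool" where
  "supported f \<longleftrightarrow> (AE \<omega> in \<mu>. \<forall>i>m \<omega>. f \<omega> i = 0)"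

definition ip :: "'g vfun \<Rightarrow> 'g vfun \<Rightarrow> 'g dual \<Rightarrow> complex" where
  "ip f g \<omega> = (\<Sum>i=1..m \<omega>. f \<omega> i * cnj (g \<omega> i))"

definition sqabs :: "'g vfun \<Rightarrow> 'g dual \<Rightarrow> real" where
  "sqabs f \<omega> = (\<Sum>i=1..m \<omega>. (cmod (f \<omega> i))\<^sup>2)"

text \<open>
  On functions supported in the sets \<open>\<sigma>\<^sub>i\<close> this agrees almost everywhere with the infinite sum
  that defines the Ruelle operator; being a finite sum it needs no summability argument.
\<close>

definition R :: "'g vfun \<Rightarrow> 'g vfun" where
  "R f = (\<lambda>\<omega> j. \<Sum>i=1..m (T \<omega>). H \<omega> i j * f (T \<omega>) i)"

abbreviation L2 :: "'g vfun set" where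
  "L2 \<equiv> sq_integrable \<mu> m"

lemma ae_eq_refl [simp]: "f \<doteq> f"
  unfolding ae_eq_def by simp

lemma ae_eq_sym: "f \<doteq> g \<Longrightarrow> g \<doteq> f"
  unfolding ae_eq_def by (simp add: eq_commute)

lemma ae_eq_trans:
  assumes "f \<doteq> g" "g \<doteq> h"
  shows "f \<doteq> h"
  using assms unfolding ae_eq_def by eventually_elim simp

lemma not_in_sigma_set: "(\<forall>i\<ge>1. \<omega> \<notin> sigma_set m i \<longrightarrow> P i) \<longleftrightarrow> (\<forall>i>m \<omega>. P i)"
  unfolding sigma_set_def by (auto simp: not_le)

lemma H_measurable: "i \<ge> 1 \<Longrightarrow> j \<ge> 1 \<Longrightarrow> (\<lambda>\<omega>. H \<omega> i j) \<in> borel_measurable borel"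
  using filter_H unfolding filter_relative_def by blast

lemma H_supported: "AE \<omega> in \<mu>. \<forall>i\<ge>1. \<forall>j>m \<omega>. H \<omega> i j = 0"
proof -
  have "AE \<omega> in \<mu>. \<forall>i\<ge>1. \<forall>j\<ge>1. \<omega> \<notin> sigma_set m j \<longrightarrow> H \<omega> i j = 0"
    using filter_H unfolding filter_relative_def by blast
  then show ?thesis unfolding not_in_sigma_set .
qed

lemma H_orthogonal:
  "AE \<omega> in \<mu>. \<forall>i\<in>{1..m (T \<omega>)}. \<forall>i'\<in>{1..m (T \<omega>)}.
     (\<Sum>\<kappa>\<in>K. \<Sum>j=1..m (\<omega> * \<kappa>). H (\<omega> * \<kappa>) i j * cnj (H (\<omega> * \<kappa>) i' j)) = of_nat N * of_bool (i = i')"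
proof -
  have "AE \<omega> in \<mu>. \<forall>i\<ge>1. \<forall>i'\<ge>1.
      (\<Sum>\<zeta> | T \<zeta> = \<omega>. \<Sum>\<^sub>\<infinity>j\<in>{1..}. H \<zeta> i j * cnj (H \<zeta> i' j)) =
      of_nat N * of_bool (i = i') * indicator (sigma_set m i) \<omega>"
    using filter_H unfolding filter_relative_def by blast
  from AE_T[OF this] AE_K[OF H_supported] show ?thesis
  proof eventually_elim
    case (elim \<omega>)
    show ?case
    proof (intro ballI)
      fix i i' assume i: "i \<in> {1..m (T \<omega>)}" "i' \<in> {1..m (T \<omega>)}"
      have "(\<Sum>\<kappa>\<in>K. \<Sum>j=1..m (\<omega> * \<kappa>). H (\<omega> * \<kappa>) i j * cnj (H (\<omega> * \<kappa>) i' j))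
          = (\<Sum>\<kappa>\<in>K. \<Sum>\<^sub>\<infinity>j\<in>{1..}. H (\<omega> * \<kappa>) i j * cnj (H (\<omega> * \<kappa>) i' j))"
      proof (rule sum.cong[OF refl])
        fix \<kappa> assume "\<kappa> \<in> K"
        then have "H (\<omega> * \<kappa>) i j = 0" if "j > m (\<omega> * \<kappa>)" for j
          using elim(2) i(1) that by simp
        then show "(\<Sum>j=1..m (\<omega> * \<kappa>). H (\<omega> * \<kappa>) i j * cnj (H (\<omega> * \<kappa>) i' j))
            = (\<Sum>\<^sub>\<infinity>j\<in>{1..}. H (\<omega> * \<kappa>) i j * cnj (H (\<omega> * \<kappa>) i' j))"
          by (intro infsum_block[symmetric]) simp
      qed
      also have "\<dots> = of_nat N * of_bool (i = i') * indicator (sigma_set m i) (T \<omega>)"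
        using elim(1) i unfolding sum_fibre by simp
      also have "\<dots> = of_nat N * of_bool (i = i')"
        using i by (simp add: sigma_set_def)
      finally show "(\<Sum>\<kappa>\<in>K. \<Sum>j=1..m (\<omega> * \<kappa>). H (\<omega> * \<kappa>) i j * cnj (H (\<omega> * \<kappa>) i' j))
          = of_nat N * of_bool (i = i')" .
    qed
  qed
qed

lemma of_real_sqabs: "complex_of_real (sqabs f \<omega>) = ip f f \<omega>"
  unfolding sqabs_def ip_def by (simp only: of_real_sum complex_norm_square)

lemma sqabs_nonneg: "sqabs f \<omega> \<ge> 0"
  unfolding sqabs_def by (simp add: sum_nonneg)

lemma ip_add_left: "ip (\<lambda>\<omega> i. f \<omega> i + g \<omega> i) h \<omega> = ip f h \<omega> + ip g h \<omega>"
  unfolding ip_def by (simp add: distrib_right sum.distrib)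

lemma ip_scale_left: "ip (\<lambda>\<omega> i. c * f \<omega> i) h \<omega> = c * ip f h \<omega>"
  unfolding ip_def by (simp add: sum_distrib_left mult_ac)

lemma ip_commute: "ip f g \<omega> = cnj (ip g f \<omega>)"
  unfolding ip_def by (simp add: mult.commute)

lemma ip_cong: "f \<doteq> f' \<Longrightarrow> g \<doteq> g' \<Longrightarrow> AE \<omega> in \<mu>. ip f g \<omega> = ip f' g' \<omega>"
  unfolding ae_eq_def by (elim AE_mp, rule AE_I2) (auto simp: ip_def intro!: sum.cong)

lemma ip_measurable:
  assumes "components_measurable f" "components_measurable g"
  shows "ip f g \<in> borel_measurable borel"
proof -
  have "(\<lambda>\<omega>. \<Sum>i=1..m \<omega>. f \<omega> i * cnj (g \<omega> i)) \<in> borel_measurable borel"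
  proof (rule measurable_block_sum[OF m_measurable])
    fix i :: nat assume i: "i \<ge> 1"
    then have [measurable]: "(\<lambda>\<omega>. f \<omega> i) \<in> borel_measurable borel" "(\<lambda>\<omega>. g \<omega> i) \<in> borel_measurable borel"
      using assms unfolding components_measurable_def by auto
    show "(\<lambda>\<omega>. f \<omega> i * cnj (g \<omega> i)) \<in> borel_measurable borel" by measurable
  qed
  then show ?thesis by (simp add: ip_def[abs_def])
qed

lemma sqabs_measurable:
  assumes "components_measurable f"
  shows "sqabs f \<in> borel_measurable borel"
proof -
  have "sqabs f = (\<lambda>\<omega>. Re (ip f f \<omega>))"
    by (rule ext) (metis Re_complex_of_real of_real_sqabs)
  then show ?thesis using ip_measurable[OF assms assms] by simp
qed

text \<open>
  The filter equation says that the rows of \<open>H\<close>, spread over a fibre of \<open>T\<close>, are orthogonal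
  vectors of squared length \<open>N\<close>; hence the Ruelle operator is pointwise isometric in fibre mean.
\<close>

lemma fibre_mean_ip: "fibre_mean (ip (R f) (R g)) (ip f g)"
  unfolding fibre_mean_def using H_orthogonal
proof eventually_elim
  case (elim \<omega>)
  let ?I = "{1..m (T \<omega>)}" and ?f = "f (T \<omega>)" and ?g = "g (T \<omega>)"
  let ?h = "\<lambda>\<kappa> i i' j. H (\<omega> * \<kappa>) i j * cnj (H (\<omega> * \<kappa>) i' j)"
  have "(\<Sum>\<kappa>\<in>K. ip (R f) (R g) (\<omega> * \<kappa>)) =
      (\<Sum>\<kappa>\<in>K. \<Sum>j=1..m (\<omega> * \<kappa>). \<Sum>i\<in>?I. \<Sum>i'\<in>?I. ?f i * cnj (?g i') * ?h \<kappa> i i' j)"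
  proof (intro sum.cong refl)
    fix \<kappa> assume "\<kappa> \<in> K"
    then show "ip (R f) (R g) (\<omega> * \<kappa>) =
        (\<Sum>j=1..m (\<omega> * \<kappa>). \<Sum>i\<in>?I. \<Sum>i'\<in>?I. ?f i * cnj (?g i') * ?h \<kappa> i i' j)"
      unfolding ip_def R_def by (simp only: T_times_K cnj_sum sum_product) (simp add: mult_ac)
  qed
  also have "\<dots> = (\<Sum>\<kappa>\<in>K. \<Sum>i\<in>?I. \<Sum>i'\<in>?I. \<Sum>j=1..m (\<omega> * \<kappa>). ?f i * cnj (?g i') * ?h \<kappa> i i' j)"
    by (subst sum.swap, subst (2) sum.swap) (rule refl)
  also have "\<dots> = (\<Sum>i\<in>?I. \<Sum>i'\<in>?I. \<Sum>\<kappa>\<in>K. \<Sum>j=1..m (\<omega> * \<kappa>). ?f i * cnj (?g i') * ?h \<kappa> i i' j)"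
    by (subst sum.swap, subst (2) sum.swap) (rule refl)
  also have "\<dots> = (\<Sum>i\<in>?I. \<Sum>i'\<in>?I. ?f i * cnj (?g i') * (of_nat N * of_bool (i = i')))"
  proof (intro sum.cong refl)
    fix i i' assume "i \<in> ?I" "i' \<in> ?I"
    then show "(\<Sum>\<kappa>\<in>K. \<Sum>j=1..m (\<omega> * \<kappa>). ?f i * cnj (?g i') * ?h \<kappa> i i' j)
        = ?f i * cnj (?g i') * (of_nat N * of_bool (i = i'))"
      using elim by (simp add: sum_distrib_left[symmetric])
  qed
  also have "\<dots> = (\<Sum>i\<in>?I. of_nat N * (?f i * cnj (?g i)))"
  proof (intro sum.cong refl)
    fix i assume i: "i \<in> ?I"
    have "(\<Sum>i'\<in>?I. ?f i * cnj (?g i') * (of_nat N * of_bool (i = i')))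
        = (\<Sum>i'\<in>?I. if i' = i then of_nat N * (?f i * cnj (?g i)) else 0)"
      by (intro sum.cong) auto
    then show "(\<Sum>i'\<in>?I. ?f i * cnj (?g i') * (of_nat N * of_bool (i = i')))
        = of_nat N * (?f i * cnj (?g i))" using i by simp
  qed
  also have "\<dots> = of_nat N * ip f g (T \<omega>)" unfolding ip_def by (simp add: sum_distrib_left)
  finally show ?case .
qed

lemma nn_integral_sqabs_R:
  assumes "components_measurable f" "components_measurable (R f)"
  shows "(\<integral>\<^sup>+\<omega>. ennreal (sqabs (R f) \<omega>) \<partial>\<mu>) = (\<integral>\<^sup>+\<omega>. ennreal (sqabs f \<omega>) \<partial>\<mu>)"
proof (rule fibre_mean_nn_integral)
  show "fibre_mean (\<lambda>\<omega>. ennreal (sqabs (R f) \<omega>)) (\<lambda>\<omega>. ennreal (sqabs f \<omega>))"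
    using fibre_mean_ip[of f f] unfolding fibre_mean_def
  proof eventually_elim
    case (elim \<omega>)
    then have "complex_of_real (\<Sum>\<kappa>\<in>K. sqabs (R f) (\<omega> * \<kappa>)) = complex_of_real (real N * sqabs f (T \<omega>))"
      by (simp add: of_real_sqabs)
    then have "(\<Sum>\<kappa>\<in>K. sqabs (R f) (\<omega> * \<kappa>)) = real N * sqabs f (T \<omega>)"
      by (simp only: of_real_eq_iff)
    then have "(\<Sum>\<kappa>\<in>K. ennreal (sqabs (R f) (\<omega> * \<kappa>))) = ennreal (real N * sqabs f (T \<omega>))"
      by (simp add: sqabs_nonneg)
    then show ?case by (simp add: ennreal_mult sqabs_nonneg ennreal_of_nat_eq_real_of_nat)
  qed
qed (use sqabs_measurable assms in \<open>auto intro: measurable_compose[OF _ measurable_ennreal]\<close>)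

lemma R_measurable: "components_measurable f \<Longrightarrow> components_measurable (R f)"
  unfolding components_measurable_def R_def
proof (intro allI impI)
  fix j :: nat assume f: "\<forall>i\<ge>1. (\<lambda>\<omega>. f \<omega> i) \<in> borel_measurable borel" and j: "j \<ge> 1"
  show "(\<lambda>\<omega>. \<Sum>i=1..m (T \<omega>). H \<omega> i j * f (T \<omega>) i) \<in> borel_measurable borel"
  proof (rule measurable_block_sum)
    fix i :: nat assume i: "i \<ge> 1"
    have [measurable]: "(\<lambda>\<omega>. f \<omega> i) \<in> borel_measurable borel" "(\<lambda>\<omega>. H \<omega> i j) \<in> borel_measurable borel"
      using f H_measurable i j by auto
    show "(\<lambda>\<omega>. H \<omega> i j * f (T \<omega>) i) \<in> borel_measurable borel" by measurable
  qed measurable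
qed

lemma R_supported: "supported (R f)"
  unfolding supported_def using H_supported by eventually_elim (simp add: R_def)

lemma R_cong: "f \<doteq> g \<Longrightarrow> R f \<doteq> R g"
  unfolding ae_eq_def
  by (drule AE_T, erule AE_mp, rule AE_I2) (auto simp: R_def intro!: sum.cong)

lemma R_add: "R (\<lambda>\<omega> i. f \<omega> i + g \<omega> i) = (\<lambda>\<omega> i. R f \<omega> i + R g \<omega> i)"
  unfolding R_def by (simp add: distrib_left sum.distrib)

lemma R_scale: "R (\<lambda>\<omega> i. c * f \<omega> i) = (\<lambda>\<omega> i. c * R f \<omega> i)"
  unfolding R_def by (simp add: sum_distrib_left mult_ac)

lemma ruelle_fun_ae_eq:
  assumes "supported f"
  shows "ruelle_fun \<alpha> H f \<doteq> R f"
  unfolding ae_eq_def using AE_T[OF assms[unfolded supported_def]]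
proof eventually_elim
  case (elim \<omega>)
  show ?case unfolding ruelle_fun_def R_def
    by (intro allI impI infsum_block) (simp add: elim)
qed

lemma infsum_ennreal_Suc: "infsum F {1::nat..} = (\<Sum>n. F (Suc n) :: ennreal)"
proof -
  have "{1::nat..} = range Suc" by (auto simp: image_iff) (metis Suc_le_D)
  then have "infsum F {1..} = infsum (F \<circ> Suc) UNIV" by (simp add: infsum_reindex)
  moreover have "(F \<circ> Suc) sums infsum (F \<circ> Suc) UNIV"
    by (intro has_sum_imp_sums has_sum_infsum nonneg_summable_on_complete) simp
  ultimately show ?thesis by (simp add: sums_iff comp_def)
qed

lemma sq_norm_eq:
  assumes "components_measurable f" "supported f"
  shows "sq_norm \<mu> f = (\<integral>\<^sup>+\<omega>. ennreal (sqabs f \<omega>) \<partial>\<mu>)"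
proof -
  have [measurable]: "(\<lambda>\<omega>. f \<omega> (Suc n)) \<in> borel_measurable borel" for n
    using assms(1) unfolding components_measurable_def by simp
  have "sq_norm \<mu> f = (\<integral>\<^sup>+\<omega>. (\<Sum>n. ennreal ((cmod (f \<omega> (Suc n)))\<^sup>2)) \<partial>\<mu>)"
    unfolding sq_norm_def infsum_ennreal_Suc by (rule nn_integral_suminf[symmetric]) measurable
  also have "\<dots> = (\<integral>\<^sup>+\<omega>. ennreal (sqabs f \<omega>) \<partial>\<mu>)"
  proof (rule nn_integral_cong_AE)
    show "AE \<omega> in \<mu>. (\<Sum>n. ennreal ((cmod (f \<omega> (Suc n)))\<^sup>2)) = ennreal (sqabs f \<omega>)"
      using assms(2) unfolding supported_def
    proof eventually_elim
      case (elim \<omega>)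
      then have "(\<Sum>n. ennreal ((cmod (f \<omega> (Suc n)))\<^sup>2)) = (\<Sum>n<m \<omega>. ennreal ((cmod (f \<omega> (Suc n)))\<^sup>2))"
        by (intro suminf_finite) auto
      also have "\<dots> = (\<Sum>i=1..m \<omega>. ennreal ((cmod (f \<omega> i))\<^sup>2))"
        by (rule sum.reindex_bij_witness[where i = "\<lambda>i. i - 1" and j = Suc]) auto
      finally show ?case by (simp add: sqabs_def)
    qed
  qed
  finally show ?thesis .
qed

lemma L2_iff:
  "f \<in> L2 \<longleftrightarrow> components_measurable f \<and> supported f \<and> (\<integral>\<^sup>+\<omega>. ennreal (sqabs f \<omega>) \<partial>\<mu>) < \<infinity>"
  unfolding sq_integrable_def not_in_sigma_set components_measurable_def[symmetric]
    supported_def[symmetric]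
  using sq_norm_eq by auto

lemma sqabs_integrable: "f \<in> L2 \<Longrightarrow> integrable \<mu> (sqabs f)"
  using sqabs_measurable sqabs_nonneg by (intro integrableI_nonneg) (auto simp: L2_iff)

lemma L2_I:
  assumes "components_measurable f" "supported f" "integrable \<mu> g" "\<And>\<omega>. sqabs f \<omega> \<le> g \<omega>"
  shows "f \<in> L2"
proof -
  have "integrable \<mu> (sqabs f)"
    by (rule Bochner_Integration.integrable_bound[OF assms(3)])
      (use assms sqabs_measurable sqabs_nonneg in \<open>auto intro!: AE_I2 order_trans[OF assms(4)]\<close>)
  then show ?thesis
    using assms sqabs_nonneg unfolding L2_iff by (auto simp: integrable_iff_bounded)
qed

lemma L2_scale: "f \<in> L2 \<Longrightarrow> (\<lambda>\<omega> i. c * f \<omega> i) \<in> L2"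
proof (rule L2_I)
  assume f: "f \<in> L2"
  then show "components_measurable (\<lambda>\<omega> i. c * f \<omega> i)" "supported (\<lambda>\<omega> i. c * f \<omega> i)"
    by (auto simp: L2_iff components_measurable_def supported_def)
  show "integrable \<mu> (\<lambda>\<omega>. (cmod c)\<^sup>2 * sqabs f \<omega>)" using sqabs_integrable[OF f] by simp
  show "sqabs (\<lambda>\<omega> i. c * f \<omega> i) \<omega> \<le> (cmod c)\<^sup>2 * sqabs f \<omega>" for \<omega>
    by (simp add: sqabs_def norm_mult power_mult_distrib sum_distrib_left)
qed

lemma L2_add:
  assumes f: "f \<in> L2" and g: "g \<in> L2"
  shows "(\<lambda>\<omega> i. f \<omega> i + g \<omega> i) \<in> L2"
proof (rule L2_I)
  show "components_measurable (\<lambda>\<omega> i. f \<omega> i + g \<omega> i)"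
    using f g by (auto simp: L2_iff components_measurable_def intro: borel_measurable_add)
  show "supported (\<lambda>\<omega> i. f \<omega> i + g \<omega> i)"
    using f[unfolded L2_iff supported_def, THEN conjunct2, THEN conjunct1]
      g[unfolded L2_iff supported_def, THEN conjunct2, THEN conjunct1]
    unfolding supported_def by eventually_elim simp
  show "integrable \<mu> (\<lambda>\<omega>. 2 * sqabs f \<omega> + 2 * sqabs g \<omega>)"
    using sqabs_integrable[OF f] sqabs_integrable[OF g] by simp
  have sq: "(cmod (x + y))\<^sup>2 \<le> 2 * (cmod x)\<^sup>2 + 2 * (cmod y)\<^sup>2" for x y
  proof -
    have "(cmod (x + y))\<^sup>2 \<le> (cmod x + cmod y)\<^sup>2" by (intro power_mono norm_triangle_ineq) simp
    also have "\<dots> \<le> 2 * (cmod x)\<^sup>2 + 2 * (cmod y)\<^sup>2"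
      using sum_squares_bound[of "cmod x" "cmod y"] by (simp add: power2_sum)
    finally show ?thesis .
  qed
  show "sqabs (\<lambda>\<omega> i. f \<omega> i + g \<omega> i) \<omega> \<le> 2 * sqabs f \<omega> + 2 * sqabs g \<omega>" for \<omega>
  proof -
    have "sqabs (\<lambda>\<omega> i. f \<omega> i + g \<omega> i) \<omega>
        \<le> (\<Sum>i=1..m \<omega>. 2 * (cmod (f \<omega> i))\<^sup>2 + 2 * (cmod (g \<omega> i))\<^sup>2)"
      unfolding sqabs_def by (intro sum_mono sq)
    then show ?thesis unfolding sqabs_def by (simp only: sum.distrib sum_distrib_left)
  qed
qed

lemma L2_zero: "(\<lambda>\<omega> i. 0) \<in> L2"
  by (simp add: L2_iff components_measurable_def supported_def sqabs_def)

lemma L2_sum: "(\<And>a. a \<in> A \<Longrightarrow> f a \<in> L2) \<Longrightarrow> (\<lambda>\<omega> i. \<Sum>a\<in>A. c a * f a \<omega> i) \<in> L2"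
proof (induction A rule: infinite_finite_induct)
  case (insert a A)
  then show ?case using L2_add[OF L2_scale[of "f a" "c a"]] by simp
qed (simp_all add: L2_zero)

lemma R_L2: "f \<in> L2 \<Longrightarrow> R f \<in> L2"
  using nn_integral_sqabs_R R_measurable R_supported by (simp add: L2_iff)

lemma R_pow_L2: "f \<in> L2 \<Longrightarrow> (R ^^ n) f \<in> L2"
  by (induction n) (simp_all add: R_L2)

lemma sq_norm_cong:
  assumes "f \<doteq> g"
  shows "sq_norm \<mu> f = sq_norm \<mu> g"
  unfolding sq_norm_def
proof (intro infsum_cong nn_integral_cong_AE)
  fix i :: nat assume "i \<in> {1..}"
  then show "AE \<omega> in \<mu>. ennreal ((cmod (f \<omega> i))\<^sup>2) = ennreal ((cmod (g \<omega> i))\<^sup>2)"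
    using assms unfolding ae_eq_def by (auto elim: eventually_mono)
qed

lemma sq_norm_R: "f \<in> L2 \<Longrightarrow> sq_norm \<mu> (R f) = sq_norm \<mu> f"
  using nn_integral_sqabs_R R_measurable R_supported by (simp add: L2_iff sq_norm_eq)

section \<open>Purity in terms of representatives\<close>

abbreviation cls :: "'g vfun \<Rightarrow> 'g vfun set" where
  "cls \<equiv> ae_class \<mu> m"

lemma mem_cls: "g \<in> cls f \<longleftrightarrow> g \<in> L2 \<and> g \<doteq> f"
  unfolding ae_class_def ae_eq_def by simp

lemma cls_cong:
  assumes "f \<doteq> g"
  shows "cls f = cls g"
proof (rule Set.set_eqI)
  fix h
  have "h \<doteq> f \<longleftrightarrow> h \<doteq> g"
    using ae_eq_trans[OF _ assms] ae_eq_trans[OF _ ae_eq_sym[OF assms]] by blast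
  then show "h \<in> cls f \<longleftrightarrow> h \<in> cls g" by (simp add: mem_cls)
qed

lemma cls_self: "f \<in> L2 \<Longrightarrow> f \<in> cls f"
  by (simp add: mem_cls)

lemma cls_eq_iff: "f \<in> L2 \<Longrightarrow> cls f = cls g \<longleftrightarrow> f \<doteq> g"
  using cls_self[of f] cls_cong[of f g] by (auto simp: mem_cls)

lemma UN_cls:
  assumes "f \<in> L2" "\<And>g. g \<in> L2 \<Longrightarrow> g \<doteq> f \<Longrightarrow> F g = X"
  shows "(\<Union>g\<in>cls f. F g) = X"
proof -
  have "(\<Union>g\<in>cls f. F g) = (\<Union>g\<in>cls f. X)" by (rule SUP_cong) (use assms(2) mem_cls in auto)
  also have "\<dots> = X" using cls_self[OF assms(1)] by auto
  finally show ?thesis .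
qed

lemma ruelle_cls: "f \<in> L2 \<Longrightarrow> ruelle \<mu> \<alpha> m H (cls f) = cls (R f)"
  unfolding ruelle_def
proof (erule UN_cls)
  fix g assume "g \<in> L2" "g \<doteq> f"
  then have "ruelle_fun \<alpha> H g \<doteq> R g" "R g \<doteq> R f"
    by (simp_all add: ruelle_fun_ae_eq L2_iff R_cong)
  then show "cls (ruelle_fun \<alpha> H g) = cls (R f)" by (intro cls_cong) (rule ae_eq_trans)
qed

lemma ruelle_pow_cls: "f \<in> L2 \<Longrightarrow> (ruelle \<mu> \<alpha> m H ^^ n) (cls f) = cls ((R ^^ n) f)"
  by (induction n) (simp_all add: ruelle_cls R_pow_L2)

lemma hs_scale_cls: "f \<in> L2 \<Longrightarrow> hs_scale (L2_sum \<mu> m) c (cls f) = cls (\<lambda>\<omega> i. c * f \<omega> i)"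
  unfolding L2_sum_def hspace.simps
  by (erule UN_cls, rule cls_cong, unfold ae_eq_def, erule eventually_mono) simp

lemma hs_add_cls:
  assumes "f \<in> L2" "g \<in> L2"
  shows "hs_add (L2_sum \<mu> m) (cls f) (cls g) = cls (\<lambda>\<omega> i. f \<omega> i + g \<omega> i)"
  unfolding L2_sum_def hspace.simps
proof (intro UN_cls assms)
  fix f' g' assume "f' \<doteq> f" "g' \<doteq> g"
  then have "(\<lambda>\<omega> i. f' \<omega> i + g' \<omega> i) \<doteq> (\<lambda>\<omega> i. f \<omega> i + g \<omega> i)"
    unfolding ae_eq_def by eventually_elim simp
  then show "cls (\<lambda>\<omega> i. f' \<omega> i + g' \<omega> i) = cls (\<lambda>\<omega> i. f \<omega> i + g \<omega> i)"
    by (rule cls_cong)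
qed

lemma hs_norm_cls:
  assumes "f \<in> L2"
  shows "hs_norm (L2_sum \<mu> m) (cls f) = sqrt (enn2real (sq_norm \<mu> f))"
proof -
  have "(\<lambda>g. sqrt (enn2real (sq_norm \<mu> g))) ` cls f = {sqrt (enn2real (sq_norm \<mu> f))}"
    using cls_self[OF assms] sq_norm_cong by (auto simp: mem_cls)
  then show ?thesis unfolding L2_sum_def by simp
qed

lemma carrier_L2_sum: "hs_carrier (L2_sum \<mu> m) = cls ` L2"
  unfolding L2_sum_def by simp

lemma isometry_ruelle: "isometry_of (L2_sum \<mu> m) (ruelle \<mu> \<alpha> m H)"
  unfolding isometry_of_def carrier_L2_sum
  by (auto simp: ruelle_cls hs_scale_cls hs_add_cls hs_norm_cls L2_scale L2_add R_L2 sq_norm_R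
      R_add R_scale)

text \<open>The largest subspace on which the Ruelle operator is unitary.\<close>

definition unitary_part :: "'g vfun set" where
  "unitary_part = {f \<in> L2. \<forall>n. \<exists>g\<in>L2. f \<doteq> (R ^^ n) g}"

lemma unitary_part_zero: "(\<lambda>\<omega> i. 0) \<in> unitary_part"
proof -
  have "(R ^^ n) (\<lambda>\<omega> i. 0) = (\<lambda>\<omega> i. 0)" for n by (induction n) (simp_all add: R_def)
  then show ?thesis using L2_zero by (auto simp: unitary_part_def intro!: bexI[of _ "\<lambda>\<omega> i. 0"])
qed

lemma not_pure_iff:
  "\<not> pure_isometry_of (L2_sum \<mu> m) (ruelle \<mu> \<alpha> m H) \<longleftrightarrow> (\<exists>f\<in>unitary_part. \<not> f \<doteq> (\<lambda>\<omega> i. 0))"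
proof -
  let ?S = "ruelle \<mu> \<alpha> m H"
  have img: "(?S ^^ n) ` cls ` L2 = (\<lambda>g. cls ((R ^^ n) g)) ` L2" for n
    by (auto simp: image_image ruelle_pow_cls)
  have inter: "(\<Inter>n. (?S ^^ n) ` cls ` L2) = cls ` unitary_part"
  proof (intro equalityI subsetI)
    fix x assume x: "x \<in> (\<Inter>n. (?S ^^ n) ` cls ` L2)"
    then have "x \<in> (?S ^^ 0) ` cls ` L2" by blast
    then obtain f where f: "f \<in> L2" "x = cls f" by auto
    have "\<exists>g\<in>L2. f \<doteq> (R ^^ n) g" for n
    proof -
      have "x \<in> (\<lambda>g. cls ((R ^^ n) g)) ` L2" using x unfolding img by blast
      then show ?thesis using f cls_eq_iff by auto
    qed
    then show "x \<in> cls ` unitary_part" using f by (auto simp: unitary_part_def)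
  next
    fix x assume "x \<in> cls ` unitary_part"
    then show "x \<in> (\<Inter>n. (?S ^^ n) ` cls ` L2)"
      unfolding img by (auto simp: unitary_part_def) (metis cls_cong image_eqI)
  qed
  have "cls ` unitary_part = {cls (\<lambda>\<omega> i. 0)} \<longleftrightarrow> (\<forall>f\<in>unitary_part. cls f = cls (\<lambda>\<omega> i. 0))"
    using unitary_part_zero by blast
  also have "\<dots> \<longleftrightarrow> (\<forall>f\<in>unitary_part. f \<doteq> (\<lambda>\<omega> i. 0))"
    using cls_eq_iff by (auto simp: unitary_part_def)
  finally have "cls ` unitary_part = {cls (\<lambda>\<omega> i. 0)} \<longleftrightarrow> (\<forall>f\<in>unitary_part. f \<doteq> (\<lambda>\<omega> i. 0))" .
  moreover have "hs_zero (L2_sum \<mu> m) = cls (\<lambda>\<omega> i. 0)" by (simp add: L2_sum_def)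
  ultimately show ?thesis
    unfolding pure_isometry_of_def carrier_L2_sum inter using isometry_ruelle by simp
qed

end

section \<open>Eigenvectors in the unitary part\<close>

lemma complex_matrix_eigenvector:
  fixes u :: "nat \<Rightarrow> nat \<Rightarrow> complex"
  assumes "k > 0"
  obtains c v where "\<exists>a<k. v a \<noteq> 0" "\<And>b. b < k \<Longrightarrow> (\<Sum>a<k. v a * u a b) = c * v b"
proof -
  define A where "A = Matrix.mat k k (\<lambda>(b, a). u a b)"
  have A: "A \<in> carrier_mat k k" by (simp add: A_def)
  obtain c where "c \<in> spectrum A" using spectrum_non_empty[OF A assms] by blast
  then obtain w where w: "w \<in> carrier_vec k" "w \<noteq> 0\<^sub>v k" "A *\<^sub>v w = c \<cdot>\<^sub>v w"
    using A unfolding spectrum_def eigenvalue_def eigenvector_def by auto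
  show thesis
  proof (rule that[of "\<lambda>a. vec_index w a" c])
    show "\<exists>a<k. vec_index w a \<noteq> 0"
    proof (rule ccontr)
      assume "\<not> ?thesis"
      then have "w = 0\<^sub>v k" using w(1) by (intro eq_vecI) auto
      then show False using w(2) by simp
    qed
    fix b assume b: "b < k"
    have "vec_index (A *\<^sub>v w) b = (\<Sum>a<k. u a b * vec_index w a)"
      using b w(1) A by (simp add: A_def scalar_prod_def atLeast0LessThan)
    then show "(\<Sum>a<k. vec_index w a * u a b) = c * vec_index w b"
      using w b by (simp add: mult.commute)
  qed
qed

text \<open>
  With \<open>V\<close> the matrix with rows \<open>v a\<close>, the right-hand sum is the squared Frobenius norm of the Gram
  matrix \<open>V V\<^sup>*\<close>, which equals that of \<open>V\<^sup>* V\<close>. The latter has size \<open>n\<close>, and the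
  Cauchy--Schwarz inequality for its diagonal bounds its trace.
\<close>

lemma gram_trace_bound:
  fixes v :: "nat \<Rightarrow> nat \<Rightarrow> complex"
  shows "(\<Sum>a<k. \<Sum>i=1..n. (cmod (v a i))\<^sup>2)\<^sup>2
    \<le> real n * (\<Sum>a<k. \<Sum>b<k. (cmod (\<Sum>i=1..n. v a i * cnj (v b i)))\<^sup>2)"
proof -
  let ?I = "{1..n}"
  let ?w = "\<lambda>i j. \<Sum>a<k. v a i * cnj (v a j)"
  have "complex_of_real (\<Sum>a<k. \<Sum>b<k. (cmod (\<Sum>i\<in>?I. v a i * cnj (v b i)))\<^sup>2)
      = (\<Sum>a<k. \<Sum>b<k. \<Sum>i\<in>?I. \<Sum>j\<in>?I. v a i * cnj (v b i) * (cnj (v a j) * v b j))"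
    by (simp only: of_real_sum complex_norm_square cnj_sum sum_product complex_cnj_mult complex_cnj_cnj)
  also have "\<dots> = (\<Sum>i\<in>?I. \<Sum>j\<in>?I. \<Sum>a<k. \<Sum>b<k. v a i * cnj (v b i) * (cnj (v a j) * v b j))"
    by (subst (2) sum.swap, subst sum.swap, subst (3) sum.swap, subst (2) sum.swap) (rule refl)
  also have "\<dots> = (\<Sum>i\<in>?I. \<Sum>j\<in>?I. ?w i j * cnj (?w i j))"
    by (simp only: cnj_sum sum_product complex_cnj_mult complex_cnj_cnj)
      (intro sum.cong refl, simp add: mult_ac)
  also have "\<dots> = complex_of_real (\<Sum>i\<in>?I. \<Sum>j\<in>?I. (cmod (?w i j))\<^sup>2)"
    by (simp only: of_real_sum complex_norm_square)
  finally have gram: "(\<Sum>a<k. \<Sum>b<k. (cmod (\<Sum>i\<in>?I. v a i * cnj (v b i)))\<^sup>2)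
      = (\<Sum>i\<in>?I. \<Sum>j\<in>?I. (cmod (?w i j))\<^sup>2)"
    by (simp only: of_real_eq_iff)
  have diag: "(\<Sum>a<k. (cmod (v a i))\<^sup>2)\<^sup>2 \<le> (\<Sum>j\<in>?I. (cmod (?w i j))\<^sup>2)" if "i \<in> ?I" for i
  proof -
    have "?w i i = complex_of_real (\<Sum>a<k. (cmod (v a i))\<^sup>2)"
      by (simp only: of_real_sum complex_norm_square)
    then have "(\<Sum>a<k. (cmod (v a i))\<^sup>2)\<^sup>2 = (cmod (?w i i))\<^sup>2"
      by (simp only: norm_of_real power2_abs)
    also have "\<dots> \<le> (\<Sum>j\<in>?I. (cmod (?w i j))\<^sup>2)"
      by (rule member_le_sum[OF that]) auto
    finally show ?thesis .
  qed
  have "(\<Sum>a<k. \<Sum>i\<in>?I. (cmod (v a i))\<^sup>2)\<^sup>2 = (\<Sum>i\<in>?I. \<Sum>a<k. (cmod (v a i))\<^sup>2)\<^sup>2"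
    by (subst sum.swap) (rule refl)
  also have "\<dots> \<le> (\<Sum>i\<in>?I. (\<Sum>a<k. (cmod (v a i))\<^sup>2)\<^sup>2) * real (card ?I)"
    by (rule sum_squared_le_sum_of_squares)
  also have "\<dots> \<le> (\<Sum>i\<in>?I. \<Sum>j\<in>?I. (cmod (?w i j))\<^sup>2) * real (card ?I)"
    by (intro mult_right_mono sum_mono diag) simp_all
  finally show ?thesis unfolding gram by (simp add: mult.commute)
qed

context ruelle_operator
begin

text \<open>
  Dividing by the total mass gives functions of constant pointwise length 1 the norm 1, and it makes
  the inner product of two functions the limit value in \<open>pullback_ip_tendsto\<close> below.
\<close>

definition inner_mean :: "'g vfun \<Rightarrow> 'g vfun \<Rightarrow> complex" where
  "inner_mean f g = (\<integral>\<omega>. ip f g \<omega> \<partial>\<mu>) / of_real (measure \<mu> UNIV)"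

lemma ip_integrable:
  assumes "f \<in> L2" "g \<in> L2"
  shows "integrable \<mu> (ip f g)"
proof (rule Bochner_Integration.integrable_bound)
  show "integrable \<mu> (\<lambda>\<omega>. sqabs f \<omega> + sqabs g \<omega>)"
    using assms sqabs_integrable by simp
  show "ip f g \<in> borel_measurable \<mu>" using assms ip_measurable by (simp add: L2_iff)
  have "cmod (x * cnj y) \<le> (cmod x)\<^sup>2 + (cmod y)\<^sup>2" for x y
  proof -
    have "0 \<le> cmod x * cmod y" by simp
    then show ?thesis
      using sum_squares_bound[of "cmod x" "cmod y"] unfolding norm_mult complex_mod_cnj mult.assoc by linarith
  qed
  then have "cmod (ip f g \<omega>) \<le> sqabs f \<omega> + sqabs g \<omega>" for \<omega>
    unfolding ip_def sqabs_def sum.distrib[symmetric] by (intro sum_norm_le)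
  then show "AE \<omega> in \<mu>. norm (ip f g \<omega>) \<le> norm (sqabs f \<omega> + sqabs g \<omega>)"
    using sqabs_nonneg by (intro AE_I2) (simp add: abs_of_nonneg)
qed

lemma integral_ip: "(\<integral>\<omega>. ip f g \<omega> \<partial>\<mu>) = of_real (measure \<mu> UNIV) * inner_mean f g"
  using \<mu>_UNIV_pos by (simp add: inner_mean_def)

lemma inner_mean_cong: "f \<doteq> f' \<Longrightarrow> g \<doteq> g' \<Longrightarrow> f \<in> L2 \<Longrightarrow> g \<in> L2 \<Longrightarrow> f' \<in> L2 \<Longrightarrow> g' \<in> L2 \<Longrightarrow>
    inner_mean f g = inner_mean f' g'"
  unfolding inner_mean_def
  using integral_cong_AE[of "ip f g" \<mu> "ip f' g'"] ip_cong[of f f' g g']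
    borel_measurable_integrable[OF ip_integrable[of f g]] borel_measurable_integrable[OF ip_integrable[of f' g']]
  by simp

lemma inner_mean_add_left:
  "f \<in> L2 \<Longrightarrow> g \<in> L2 \<Longrightarrow> h \<in> L2 \<Longrightarrow>
    inner_mean (\<lambda>\<omega> i. f \<omega> i + g \<omega> i) h = inner_mean f h + inner_mean g h"
  unfolding inner_mean_def ip_add_left by (simp add: ip_integrable add_divide_distrib)

lemma inner_mean_scale_left:
  "inner_mean (\<lambda>\<omega> i. c * f \<omega> i) h = c * inner_mean f h"
  unfolding inner_mean_def ip_scale_left by simp

lemma inner_mean_commute: "inner_mean f g = cnj (inner_mean g f)"
  unfolding inner_mean_def ip_commute[of f g] integral_cnj by simp

lemma inner_mean_scale_self:
  "inner_mean (\<lambda>\<omega> i. c * f \<omega> i) (\<lambda>\<omega> i. c * f \<omega> i) = of_real ((cmod c)\<^sup>2) * inner_mean f f"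
proof -
  have "inner_mean f (\<lambda>\<omega> i. c * f \<omega> i) = cnj (c * inner_mean f f)"
    by (subst inner_mean_commute) (simp only: inner_mean_scale_left)
  also have "\<dots> = cnj c * inner_mean f f"
    using inner_mean_commute[of f f] by simp
  finally show ?thesis
    unfolding inner_mean_scale_left by (simp only: complex_norm_square mult.assoc)
qed

lemma inner_mean_sum_left:
  "(\<And>a. a \<in> A \<Longrightarrow> f a \<in> L2) \<Longrightarrow> h \<in> L2 \<Longrightarrow>
    inner_mean (\<lambda>\<omega> i. \<Sum>a\<in>A. c a * f a \<omega> i) h = (\<Sum>a\<in>A. c a * inner_mean (f a) h)"
proof (induction A rule: infinite_finite_induct)
  case (insert a A)
  have "inner_mean (\<lambda>\<omega> i. \<Sum>a\<in>insert a A. c a * f a \<omega> i) h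
      = inner_mean (\<lambda>\<omega> i. c a * f a \<omega> i + (\<Sum>a\<in>A. c a * f a \<omega> i)) h"
    using insert.hyps by simp
  also have "\<dots> = inner_mean (\<lambda>\<omega> i. c a * f a \<omega> i) h + inner_mean (\<lambda>\<omega> i. \<Sum>a\<in>A. c a * f a \<omega> i) h"
    using insert.prems by (intro inner_mean_add_left L2_scale L2_sum) auto
  finally show ?case using insert by (simp add: inner_mean_scale_left)
qed (simp_all add: inner_mean_def ip_def)

lemma inner_mean_self:
  assumes "f \<in> L2"
  shows "inner_mean f f = of_real (Re (inner_mean f f))" "Re (inner_mean f f) \<ge> 0"
    "inner_mean f f = 0 \<Longrightarrow> f \<doteq> (\<lambda>\<omega> i. 0)"
proof -
  have "(\<integral>\<omega>. ip f f \<omega> \<partial>\<mu>) = of_real (\<integral>\<omega>. sqabs f \<omega> \<partial>\<mu>)"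
    by (simp add: of_real_sqabs[symmetric])
  then have eq: "inner_mean f f = of_real ((\<integral>\<omega>. sqabs f \<omega> \<partial>\<mu>) / measure \<mu> UNIV)"
    by (simp add: inner_mean_def)
  show "inner_mean f f = of_real (Re (inner_mean f f))" unfolding eq by simp
  show "Re (inner_mean f f) \<ge> 0" unfolding eq by (simp add: sqabs_nonneg)
  assume "inner_mean f f = 0"
  then have "(\<integral>\<omega>. sqabs f \<omega> \<partial>\<mu>) = 0" using \<mu>_UNIV_pos by (simp add: eq)
  then have "AE \<omega> in \<mu>. sqabs f \<omega> = 0"
    using integral_nonneg_eq_0_iff_AE[OF sqabs_integrable[OF assms]] sqabs_nonneg by simp
  moreover have "AE \<omega> in \<mu>. \<forall>i>m \<omega>. f \<omega> i = 0" using assms by (simp add: L2_iff supported_def)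
  ultimately show "f \<doteq> (\<lambda>\<omega> i. 0)"
    unfolding ae_eq_def
  proof eventually_elim
    case (elim \<omega>)
    then have "\<forall>i\<in>{1..m \<omega>}. (cmod (f \<omega> i))\<^sup>2 = 0"
      unfolding sqabs_def by (subst (asm) sum_nonneg_eq_0_iff) auto
    then show ?case using elim(2) by (metis atLeastAtMost_iff not_le norm_eq_zero zero_eq_power2)
  qed
qed

lemma inner_mean_R:
  assumes "f \<in> L2" "g \<in> L2"
  shows "inner_mean (R f) (R g) = inner_mean f g"
  unfolding inner_mean_def
  using fibre_mean_integral(1)[OF fibre_mean_ip ip_integrable ip_integrable, of f g] assms R_L2 by simp

lemma L2_diff: "f \<in> L2 \<Longrightarrow> g \<in> L2 \<Longrightarrow> (\<lambda>\<omega> i. f \<omega> i - g \<omega> i) \<in> L2"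
  using L2_add[of f "\<lambda>\<omega> i. -1 * g \<omega> i"] L2_scale[of g "-1"] by simp

lemma R_diff: "R (\<lambda>\<omega> i. f \<omega> i - g \<omega> i) = (\<lambda>\<omega> i. R f \<omega> i - R g \<omega> i)"
  using R_add[of f "\<lambda>\<omega> i. -1 * g \<omega> i"] R_scale[of "-1" g] by simp

lemma R_injective:
  assumes "f \<in> L2" "g \<in> L2" "R f \<doteq> R g"
  shows "f \<doteq> g"
proof -
  let ?h = "\<lambda>\<omega> i. f \<omega> i - g \<omega> i"
  have h: "?h \<in> L2" using assms L2_diff by blast
  have "R ?h \<doteq> (\<lambda>\<omega> i. 0)" using assms(3) unfolding R_diff ae_eq_def by simp
  then have "inner_mean (R ?h) (R ?h) = inner_mean (\<lambda>\<omega> i. 0) (\<lambda>\<omega> i. 0)"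
    using R_L2[OF h] L2_zero by (intro inner_mean_cong)
  moreover have "inner_mean (\<lambda>\<omega> i. 0) (\<lambda>\<omega> i. 0) = 0" by (simp add: inner_mean_def ip_def)
  ultimately have "inner_mean ?h ?h = 0" unfolding inner_mean_R[OF h h] by (rule trans)
  from inner_mean_self(3)[OF h this] show ?thesis unfolding ae_eq_def by simp
qed

lemma R_pow_add: "(R ^^ n) (\<lambda>\<omega> i. f \<omega> i + g \<omega> i) = (\<lambda>\<omega> i. (R ^^ n) f \<omega> i + (R ^^ n) g \<omega> i)"
  by (induction n) (simp_all add: R_add)

lemma R_pow_scale: "(R ^^ n) (\<lambda>\<omega> i. c * f \<omega> i) = (\<lambda>\<omega> i. c * (R ^^ n) f \<omega> i)"
  by (induction n) (simp_all add: R_scale)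

lemma unitary_part_L2: "f \<in> unitary_part \<Longrightarrow> f \<in> L2"
  unfolding unitary_part_def by simp

lemma unitary_part_add:
  assumes f: "f \<in> unitary_part" and g: "g \<in> unitary_part"
  shows "(\<lambda>\<omega> i. f \<omega> i + g \<omega> i) \<in> unitary_part"
  unfolding unitary_part_def
proof (intro CollectI conjI allI)
  show "(\<lambda>\<omega> i. f \<omega> i + g \<omega> i) \<in> L2" using f g by (intro L2_add unitary_part_L2)
  fix n
  obtain f' g' where f': "f' \<in> L2" "f \<doteq> (R ^^ n) f'" and g': "g' \<in> L2" "g \<doteq> (R ^^ n) g'"
    using f g unfolding unitary_part_def by blast
  have "(\<lambda>\<omega> i. f \<omega> i + g \<omega> i) \<doteq> (R ^^ n) (\<lambda>\<omega> i. f' \<omega> i + g' \<omega> i)"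
    unfolding R_pow_add using f'(2) g'(2) unfolding ae_eq_def by eventually_elim simp
  then show "\<exists>h\<in>L2. (\<lambda>\<omega> i. f \<omega> i + g \<omega> i) \<doteq> (R ^^ n) h"
    using L2_add[OF f'(1) g'(1)] by blast
qed

lemma unitary_part_scale:
  assumes f: "f \<in> unitary_part"
  shows "(\<lambda>\<omega> i. c * f \<omega> i) \<in> unitary_part"
  unfolding unitary_part_def
proof (intro CollectI conjI allI)
  show "(\<lambda>\<omega> i. c * f \<omega> i) \<in> L2" using f by (intro L2_scale unitary_part_L2)
  fix n
  obtain f' where f': "f' \<in> L2" "f \<doteq> (R ^^ n) f'"
    using f unfolding unitary_part_def by blast
  have "(\<lambda>\<omega> i. c * f \<omega> i) \<doteq> (R ^^ n) (\<lambda>\<omega> i. c * f' \<omega> i)"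
    unfolding R_pow_scale using f'(2) unfolding ae_eq_def by eventually_elim simp
  then show "\<exists>h\<in>L2. (\<lambda>\<omega> i. c * f \<omega> i) \<doteq> (R ^^ n) h"
    using L2_scale[OF f'(1)] by blast
qed

lemma unitary_part_sum:
  "(\<And>a. a \<in> A \<Longrightarrow> f a \<in> unitary_part) \<Longrightarrow> (\<lambda>\<omega> i. \<Sum>a\<in>A. c a * f a \<omega> i) \<in> unitary_part"
proof (induction A rule: infinite_finite_induct)
  case (insert a A)
  then show ?case using unitary_part_add[OF unitary_part_scale[of "f a" "c a"]] by simp
qed (simp_all add: unitary_part_zero)

lemma unitary_part_R:
  assumes "f \<in> unitary_part"
  shows "R f \<in> unitary_part"
  unfolding unitary_part_def
proof (intro CollectI conjI allI)
  show "R f \<in> L2" by (rule R_L2[OF unitary_part_L2[OF assms]])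
  fix n
  obtain g where g: "g \<in> L2" "f \<doteq> (R ^^ n) g" using assms unfolding unitary_part_def by blast
  have "R f \<doteq> (R ^^ n) (R g)" using R_cong[OF g(2)] by (simp add: funpow_swap1)
  then show "\<exists>h\<in>L2. R f \<doteq> (R ^^ n) h" using R_L2[OF g(1)] by blast
qed

lemma unitary_part_preimage:
  assumes "f \<in> unitary_part"
  shows "\<exists>g\<in>unitary_part. f \<doteq> R g"
proof -
  have ex: "\<exists>g\<in>L2. f \<doteq> R ((R ^^ n) g)" for n
  proof -
    have "\<exists>g\<in>L2. f \<doteq> (R ^^ Suc n) g" using assms unfolding unitary_part_def by blast
    then show ?thesis by simp
  qed
  obtain g where g: "g \<in> L2" "f \<doteq> R g" using ex[of 0] by auto
  have "\<exists>h\<in>L2. g \<doteq> (R ^^ n) h" for n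
  proof -
    obtain h where h: "h \<in> L2" "f \<doteq> R ((R ^^ n) h)" using ex by blast
    have "R g \<doteq> R ((R ^^ n) h)" using ae_eq_trans[OF ae_eq_sym[OF g(2)] h(2)] .
    then have "g \<doteq> (R ^^ n) h" by (rule R_injective[OF g(1) R_pow_L2[OF h(1)]])
    then show ?thesis using h(1) by blast
  qed
  then show ?thesis using g unfolding unitary_part_def by blast
qed

lemma unitary_part_sequence:
  assumes "f \<in> unitary_part"
  obtains s where "s 0 = f" "\<And>n. s n \<in> unitary_part" "\<And>n. s n \<doteq> R (s (Suc n))"
proof -
  obtain F where F: "\<And>g. g \<in> unitary_part \<Longrightarrow> F g \<in> unitary_part \<and> g \<doteq> R (F g)"
    using unitary_part_preimage by metis
  define s where "s n = (F ^^ n) f" for n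
  have s: "s n \<in> unitary_part" for n
    by (induction n) (simp_all add: s_def assms F)
  show thesis
    by (rule that[of s]) (use s F in \<open>auto simp: s_def\<close>)
qed

text \<open>
  Each pointwise inner product in the sequence is the fibre mean of the preceding one, because the
  Ruelle operator takes the later functions back to the earlier ones.
\<close>

lemma pullback_ip_tendsto:
  assumes s: "\<And>n. s n \<in> L2" "\<And>n. s n \<doteq> R (s (Suc n))"
    and t: "\<And>n. t n \<in> L2" "\<And>n. t n \<doteq> R (t (Suc n))"
  shows "(\<lambda>n. \<integral>\<omega>. cmod (ip (s n) (t n) \<omega> - inner_mean (s 0) (t 0)) \<partial>\<mu>) \<longlonglongrightarrow> 0"
proof (rule fibre_means_tendsto_mean)
  show "integrable \<mu> (ip (s n) (t n))" for n using s t by (intro ip_integrable)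
  show "fibre_mean (ip (s n) (t n)) (ip (s (Suc n)) (t (Suc n)))" for n
    using fibre_mean_ip[of "s (Suc n)" "t (Suc n)"] AE_K[OF ip_cong[OF s(2) t(2)], of n n]
    unfolding fibre_mean_def by eventually_elim simp
  show "(\<integral>\<omega>. ip (s 0) (t 0) \<omega> \<partial>\<mu>) = of_real (measure \<mu> UNIV) * inner_mean (s 0) (t 0)"
    by (rule integral_ip)
qed

definition orthonormal :: "nat \<Rightarrow> (nat \<Rightarrow> 'g vfun) \<Rightarrow> bool" where
  "orthonormal k f \<longleftrightarrow> (\<forall>a<k. f a \<in> unitary_part) \<and>
     (\<forall>a<k. \<forall>b<k. inner_mean (f a) (f b) = of_bool (a = b))"

text \<open>
  The pullbacks of an orthonormal system in the unitary part become, along a subsequence, almost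
  orthonormal at almost every point \<open>\<omega>\<close>, where there is only room for \<open>m \<omega>\<close> vectors.
\<close>

lemma orthonormal_le_multiplicity:
  assumes "orthonormal k f"
  shows "AE \<omega> in \<mu>. k \<le> m \<omega>"
proof -
  have fU: "f a \<in> unitary_part" if "a < k" for a using assms that unfolding orthonormal_def by blast
  have "\<exists>s. s 0 = f a \<and> (\<forall>n. s n \<in> L2) \<and> (\<forall>n. s n \<doteq> R (s (Suc n)))" if "a < k" for a
    using unitary_part_sequence[OF fU[OF that]] unitary_part_L2 by metis
  then obtain s where s: "\<And>a. a < k \<Longrightarrow> s a 0 = f a" "\<And>a n. a < k \<Longrightarrow> s a n \<in> L2"
    "\<And>a n. a < k \<Longrightarrow> s a n \<doteq> R (s a (Suc n))"
    by metis
  define u where "u n \<omega> = (\<Sum>a<k. \<Sum>b<k. cmod (ip (s a n) (s b n) \<omega> - of_bool (a = b)))" for n \<omega>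
  have int: "integrable \<mu> (\<lambda>\<omega>. cmod (ip (s a n) (s b n) \<omega> - of_bool (a = b)))" if "a < k" "b < k" for a b n
    using that s(2) by (intro integrable_norm Bochner_Integration.integrable_diff ip_integrable) auto
  have lim: "(\<lambda>n. \<integral>\<omega>. cmod (ip (s a n) (s b n) \<omega> - of_bool (a = b)) \<partial>\<mu>) \<longlonglongrightarrow> 0" if "a < k" "b < k" for a b
    using pullback_ip_tendsto[of "s a" "s b"] s that assms by (simp add: orthonormal_def)
  have int_u: "integrable \<mu> (u n)" for n
    unfolding u_def using int by (intro Bochner_Integration.integrable_sum) auto
  have u0: "u n \<omega> \<ge> 0" for n \<omega> unfolding u_def by (intro sum_nonneg) auto
  have "(\<integral>\<omega>. norm (u n \<omega>) \<partial>\<mu>) = (\<Sum>a<k. \<Sum>b<k. \<integral>\<omega>. cmod (ip (s a n) (s b n) \<omega> - of_bool (a = b)) \<partial>\<mu>)" for n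
  proof -
    have "(\<integral>\<omega>. norm (u n \<omega>) \<partial>\<mu>) = (\<integral>\<omega>. u n \<omega> \<partial>\<mu>)" using u0 by simp
    also have "\<dots> = (\<Sum>a<k. \<integral>\<omega>. (\<Sum>b<k. cmod (ip (s a n) (s b n) \<omega> - of_bool (a = b))) \<partial>\<mu>)"
      unfolding u_def using int
      by (intro Bochner_Integration.integral_sum Bochner_Integration.integrable_sum) auto
    also have "\<dots> = (\<Sum>a<k. \<Sum>b<k. \<integral>\<omega>. cmod (ip (s a n) (s b n) \<omega> - of_bool (a = b)) \<partial>\<mu>)"
      using int by (intro sum.cong refl Bochner_Integration.integral_sum) auto
    finally show ?thesis .
  qed
  moreover have "(\<lambda>n. \<Sum>a<k. \<Sum>b<k. \<integral>\<omega>. cmod (ip (s a n) (s b n) \<omega> - of_bool (a = b)) \<partial>\<mu>)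
      \<longlonglongrightarrow> (\<Sum>a<k. \<Sum>b<k. 0)"
    by (intro tendsto_sum lim) auto
  ultimately have "(\<lambda>n. \<integral>\<omega>. norm (u n \<omega>) \<partial>\<mu>) \<longlonglongrightarrow> 0" by simp
  \<comment> \<open>One common subsequence for all pairs of functions in the system.\<close>
  from tendsto_L1_AE_subseq[OF int_u this]
  obtain r :: "nat \<Rightarrow> nat" where "AE \<omega> in \<mu>. (\<lambda>n. u (r n) \<omega>) \<longlonglongrightarrow> 0" by blast
  then show ?thesis
  proof eventually_elim
    case (elim \<omega>)
    have conv: "(\<lambda>n. ip (s a (r n)) (s b (r n)) \<omega>) \<longlonglongrightarrow> of_bool (a = b)" if "a < k" "b < k" for a b
    proof (rule LIM_zero_cancel, rule tendsto_norm_zero_cancel, rule real_tendsto_sandwich[OF _ _ tendsto_const elim])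
      have "cmod (ip (s a (r n)) (s b (r n)) \<omega> - of_bool (a = b)) \<le> u (r n) \<omega>" for n
      proof -
        have "cmod (ip (s a (r n)) (s b (r n)) \<omega> - of_bool (a = b))
            \<le> (\<Sum>b<k. cmod (ip (s a (r n)) (s b (r n)) \<omega> - of_bool (a = b)))"
          using that by (intro member_le_sum) auto
        also have "\<dots> \<le> u (r n) \<omega>" unfolding u_def
          using that by (intro member_le_sum) (auto intro: sum_nonneg)
        finally show ?thesis .
      qed
      then show "\<forall>\<^sub>F n in sequentially. cmod (ip (s a (r n)) (s b (r n)) \<omega> - of_bool (a = b)) \<le> u (r n) \<omega>"
        by simp
    qed simp
    have sq: "sqabs g \<omega> = Re (ip g g \<omega>)" for g
      by (metis Re_complex_of_real of_real_sqabs)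
    have trace: "(\<lambda>n. (\<Sum>a<k. sqabs (s a (r n)) \<omega>)\<^sup>2) \<longlonglongrightarrow> (\<Sum>a<k. Re (of_bool (a = a)))\<^sup>2"
      unfolding sq by (intro tendsto_power tendsto_sum tendsto_Re conv) auto
    have frob: "(\<lambda>n. real (m \<omega>) * (\<Sum>a<k. \<Sum>b<k. (cmod (ip (s a (r n)) (s b (r n)) \<omega>))\<^sup>2))
        \<longlonglongrightarrow> real (m \<omega>) * (\<Sum>a<k. \<Sum>b<k. (cmod (of_bool (a = b)))\<^sup>2)"
      by (intro tendsto_mult_left tendsto_sum tendsto_power tendsto_norm conv) auto
    have "(\<Sum>a<k. Re (of_bool (a = a)))\<^sup>2 \<le> real (m \<omega>) * (\<Sum>a<k. \<Sum>b<k. (cmod (of_bool (a = b)))\<^sup>2)"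
    proof (rule LIMSEQ_le[OF trace frob], intro exI allI impI)
      show "(\<Sum>a<k. sqabs (s a (r n)) \<omega>)\<^sup>2
          \<le> real (m \<omega>) * (\<Sum>a<k. \<Sum>b<k. (cmod (ip (s a (r n)) (s b (r n)) \<omega>))\<^sup>2)" for n
        unfolding sqabs_def ip_def by (rule gram_trace_bound)
    qed
    moreover have "(\<Sum>b<k. (cmod (of_bool (a = b)))\<^sup>2) = 1" if "a < k" for a
    proof -
      have "(\<Sum>b<k. (cmod (of_bool (a = b)))\<^sup>2) = (\<Sum>b<k. if b = a then 1 else 0)"
        by (intro sum.cong) auto
      then show ?thesis using that by simp
    qed
    ultimately have "(real k)\<^sup>2 \<le> real (m \<omega>) * real k" by simp
    then show "k \<le> m \<omega>" by (cases "k = 0") (simp_all add: power2_eq_square)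
  qed
qed

text \<open>
  Hence the unitary part is finite-dimensional, because the values of \<open>m\<close> are finite. A maximal
  orthonormal system spans it.
\<close>

lemma orthonormal_basis:
  obtains k f where "orthonormal k f" "\<And>g. g \<in> unitary_part \<Longrightarrow> g \<doteq> (\<lambda>\<omega> i. \<Sum>a<k. inner_mean g (f a) * f a \<omega> i)"
proof -
  define bound where "bound \<omega> \<longleftrightarrow> (\<forall>k. (\<exists>f. orthonormal k f) \<longrightarrow> k \<le> m \<omega>)" for \<omega>
  have AE: "AE \<omega> in \<mu>. bound \<omega>"
    unfolding bound_def AE_all_countable using orthonormal_le_multiplicity by auto
  have "\<exists>\<omega>. bound \<omega>"
  proof (rule ccontr)
    assume "\<not> ?thesis"
    then have "AE \<omega> in \<mu>. False" using AE by simp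
    then show False using not_AE_False by simp
  qed
  then obtain \<omega> where \<omega>: "\<And>k f. orthonormal k f \<Longrightarrow> k \<le> m \<omega>"
    unfolding bound_def by blast
  have "orthonormal 0 (\<lambda>_ _ _. 0)" by (simp add: orthonormal_def)
  moreover have "\<forall>k. (\<exists>f. orthonormal k f) \<longrightarrow> id k < Suc (m \<omega>)"
    using \<omega> by (auto simp: less_Suc_eq_le)
  ultimately obtain k where "\<exists>f. orthonormal k f" and max: "\<And>k'. (\<exists>f. orthonormal k' f) \<Longrightarrow> k' \<le> k"
    using ex_has_greatest_nat[of "\<lambda>k. \<exists>f. orthonormal k f" 0 id "Suc (m \<omega>)"] by auto
  then obtain f where f: "orthonormal k f" by blast
  have fU: "f a \<in> unitary_part" if "a < k" for a using f that unfolding orthonormal_def by blast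
  show thesis
  proof (rule that[OF f])
    fix g assume g: "g \<in> unitary_part"
    define h where "h = (\<lambda>\<omega> i. g \<omega> i + (\<Sum>a<k. - inner_mean g (f a) * f a \<omega> i))"
    have hU: "h \<in> unitary_part"
      unfolding h_def using fU by (intro unitary_part_add g unitary_part_sum) auto
    have orth: "inner_mean h (f b) = 0" if "b < k" for b
    proof -
      have fL: "f a \<in> L2" if "a \<in> {..<k}" for a using fU that unitary_part_L2 by blast
      have "inner_mean h (f b) = inner_mean g (f b)
          + inner_mean (\<lambda>\<omega> i. \<Sum>a<k. - inner_mean g (f a) * f a \<omega> i) (f b)"
        unfolding h_def using g that by (intro inner_mean_add_left L2_sum fL unitary_part_L2) simp_all
      also have "inner_mean (\<lambda>\<omega> i. \<Sum>a<k. - inner_mean g (f a) * f a \<omega> i) (f b)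
          = (\<Sum>a<k. - inner_mean g (f a) * inner_mean (f a) (f b))"
        using that by (intro inner_mean_sum_left fL) simp_all
      also have "(\<Sum>a<k. - inner_mean g (f a) * inner_mean (f a) (f b))
          = (\<Sum>a<k. if a = b then - inner_mean g (f b) else 0)"
        using f that by (intro sum.cong) (auto simp: orthonormal_def)
      finally show ?thesis using that by simp
    qed
    have "h \<doteq> (\<lambda>\<omega> i. 0)"
    proof (rule ccontr)
      assume "\<not> ?thesis"
      then have "inner_mean h h \<noteq> 0" using inner_mean_self(3)[OF unitary_part_L2[OF hU]] by blast
      define \<rho> where "\<rho> = Re (inner_mean h h)"
      have \<rho>: "inner_mean h h = of_real \<rho>" "\<rho> > 0"
        using inner_mean_self(1,2)[OF unitary_part_L2[OF hU]] \<open>inner_mean h h \<noteq> 0\<close>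
        by (auto simp: \<rho>_def order_less_le)
      define f' where "f' = f(k := (\<lambda>\<omega> i. of_real (1 / sqrt \<rho>) * h \<omega> i))"
      have k: "inner_mean (f' k) (f' k) = 1"
      proof -
        have "inner_mean (f' k) (f' k) = of_real ((1 / sqrt \<rho>)\<^sup>2 * \<rho>)"
          unfolding f'_def fun_upd_same inner_mean_scale_self \<rho>(1) using \<rho>(2)
          by (simp add: norm_divide power2_eq_square)
        also have "\<dots> = 1" using \<rho>(2) by (simp add: power_divide)
        finally show ?thesis .
      qed
      have kb: "inner_mean (f' k) (f' b) = 0" "inner_mean (f' b) (f' k) = 0" if "b < k" for b
      proof -
        show "inner_mean (f' k) (f' b) = 0"
          using that orth[OF that] unfolding f'_def fun_upd_same inner_mean_scale_left by simp
        then show "inner_mean (f' b) (f' k) = 0" by (subst inner_mean_commute) simp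
      qed
      have ab: "inner_mean (f' a) (f' b) = of_bool (a = b)" if "a < k" "b < k" for a b
        using f that unfolding f'_def orthonormal_def by simp
      have "f' k \<in> unitary_part"
        unfolding f'_def fun_upd_same by (rule unitary_part_scale[OF hU])
      moreover have "f' a \<in> unitary_part" if "a < k" for a
        using that fU by (simp add: f'_def)
      ultimately have f'U: "f' a \<in> unitary_part" if "a < Suc k" for a
        using that by (auto simp: less_Suc_eq)
      have "orthonormal (Suc k) f'"
        unfolding orthonormal_def
      proof (intro conjI allI impI)
        fix a assume "a < Suc k"
        then show "f' a \<in> unitary_part"
          by (rule f'U)
        fix b assume "b < Suc k"
        then show "inner_mean (f' a) (f' b) = of_bool (a = b)"
          using \<open>a < Suc k\<close> k kb ab by (auto simp: less_Suc_eq)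
      qed
      then show False using max[of "Suc k"] by auto
    qed
    then show "g \<doteq> (\<lambda>\<omega> i. \<Sum>a<k. inner_mean g (f a) * f a \<omega> i)"
      unfolding h_def ae_eq_def by eventually_elim (simp add: sum_negf)
  qed
qed

text \<open>
  On the finite-dimensional unitary part the Ruelle operator has an eigenvector. Its pullbacks are
  multiples of itself, so the limit of their pointwise lengths being constant means that its own
  pointwise length is constant.
\<close>

theorem unit_eigenvector:
  assumes "f0 \<in> unitary_part" "\<not> f0 \<doteq> (\<lambda>\<omega> i. 0)"
  obtains F c where "F \<in> L2" "cmod c = 1" "R F \<doteq> (\<lambda>\<omega> i. c * F \<omega> i)" "AE \<omega> in \<mu>. ip F F \<omega> = 1"
proof -
  obtain k f where f: "orthonormal k f"
    and span: "\<And>g. g \<in> unitary_part \<Longrightarrow> g \<doteq> (\<lambda>\<omega> i. \<Sum>a<k. inner_mean g (f a) * f a \<omega> i)"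
    by (rule orthonormal_basis) blast
  have fU: "f a \<in> unitary_part" if "a < k" for a using f that unfolding orthonormal_def by blast
  have "k > 0" using span[OF assms(1)] assms(2) by (cases "k = 0") auto
  then obtain c v where v: "\<exists>a<k. v a \<noteq> 0"
    and ev: "\<And>b. b < k \<Longrightarrow> (\<Sum>a<k. v a * inner_mean (R (f a)) (f b)) = c * v b"
    by (rule complex_matrix_eigenvector[where u = "\<lambda>a b. inner_mean (R (f a)) (f b)"]) blast
  define G where "G = (\<lambda>\<omega> i. \<Sum>a<k. v a * f a \<omega> i)"
  have GU: "G \<in> unitary_part" unfolding G_def using fU by (intro unitary_part_sum) auto
  then have GL: "G \<in> L2" by (rule unitary_part_L2)
  have Gf: "inner_mean G (f b) = v b" if "b < k" for b
  proof -
    have "inner_mean G (f b) = (\<Sum>a<k. v a * inner_mean (f a) (f b))"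
      unfolding G_def using fU that unitary_part_L2 by (intro inner_mean_sum_left) auto
    also have "\<dots> = (\<Sum>a<k. if a = b then v b else 0)"
      using f that by (intro sum.cong) (auto simp: orthonormal_def)
    finally show ?thesis using that by simp
  qed
  have "R G = (\<lambda>\<omega> i. \<Sum>a<k. v a * R (f a) \<omega> i)"
  proof -
    have "R (\<lambda>\<omega> i. \<Sum>a\<in>A. v a * f a \<omega> i) = (\<lambda>\<omega> i. \<Sum>a\<in>A. v a * R (f a) \<omega> i)" if "finite A" for A
      using that
    proof induction
      case empty
      then show ?case by (simp add: R_def)
    next
      case (insert a A)
      then show ?case by (simp add: R_add R_scale)
    qed
    then show ?thesis unfolding G_def by simp
  qed
  note RG_sum = this
  have RGf: "inner_mean (R G) (f b) = c * v b" if "b < k" for b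
  proof -
    have "inner_mean (\<lambda>\<omega> i. \<Sum>a<k. v a * R (f a) \<omega> i) (f b) = (\<Sum>a<k. v a * inner_mean (R (f a)) (f b))"
      using fU that unitary_part_L2 R_L2 by (intro inner_mean_sum_left) auto
    then show ?thesis using RG_sum ev[OF that] by simp
  qed
  have "R G \<doteq> (\<lambda>\<omega> i. \<Sum>a<k. inner_mean (R G) (f a) * f a \<omega> i)"
    by (rule span[OF unitary_part_R[OF GU]])
  also have "(\<lambda>\<omega> i. \<Sum>a<k. inner_mean (R G) (f a) * f a \<omega> i) = (\<lambda>\<omega> i. c * G \<omega> i)"
  proof (intro ext)
    fix \<omega> i
    have "(\<Sum>a<k. inner_mean (R G) (f a) * f a \<omega> i) = (\<Sum>a<k. c * (v a * f a \<omega> i))"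
      by (intro sum.cong refl) (simp add: RGf)
    then show "(\<Sum>a<k. inner_mean (R G) (f a) * f a \<omega> i) = c * G \<omega> i"
      by (simp add: G_def sum_distrib_left)
  qed
  finally have RG: "R G \<doteq> (\<lambda>\<omega> i. c * G \<omega> i)" .
  have G0: "inner_mean G G \<noteq> 0"
  proof
    assume "inner_mean G G = 0"
    then have "G \<doteq> (\<lambda>\<omega> i. 0)" by (rule inner_mean_self(3)[OF GL])
    then have "inner_mean G (f b) = 0" if "b < k" for b
      using inner_mean_cong[of G "\<lambda>\<omega> i. 0" "f b" "f b"] GL L2_zero unitary_part_L2[OF fU[OF that]]
      by (simp add: inner_mean_def ip_def)
    then show False using v Gf by auto
  qed
  have "inner_mean G G = inner_mean (R G) (R G)" by (rule inner_mean_R[OF GL GL, symmetric])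
  also have "\<dots> = inner_mean (\<lambda>\<omega> i. c * G \<omega> i) (\<lambda>\<omega> i. c * G \<omega> i)"
    by (intro inner_mean_cong RG R_L2 GL L2_scale)
  also have "\<dots> = of_real ((cmod c)\<^sup>2) * inner_mean G G" by (rule inner_mean_scale_self)
  finally have "complex_of_real ((cmod c)\<^sup>2) = 1" using G0 by simp
  then have "(cmod c)\<^sup>2 = 1" by (simp only: of_real_eq_1_iff)
  then have c: "cmod c = 1" using norm_ge_zero[of c] by (simp add: power2_eq_1_iff)
  define \<rho> where "\<rho> = Re (inner_mean G G)"
  have \<rho>: "inner_mean G G = of_real \<rho>" "\<rho> > 0"
    using inner_mean_self(1,2)[OF GL] G0 by (auto simp: \<rho>_def order_less_le)
  define F where "F = (\<lambda>\<omega> i. of_real (1 / sqrt \<rho>) * G \<omega> i)"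
  have FL: "F \<in> L2" unfolding F_def by (rule L2_scale[OF GL])
  have RF: "R F \<doteq> (\<lambda>\<omega> i. c * F \<omega> i)"
    using RG unfolding F_def R_scale ae_eq_def by eventually_elim simp
  have "inner_mean F F = of_real ((1 / sqrt \<rho>)\<^sup>2 * \<rho>)"
    unfolding F_def inner_mean_scale_self \<rho>(1) using \<rho>(2) by (simp add: norm_divide power2_eq_square)
  then have FF: "inner_mean F F = 1" using \<rho>(2) by (simp add: power_divide)
  have "(\<lambda>n::nat. \<integral>\<omega>. cmod (ip F F \<omega> - 1) \<partial>\<mu>) \<longlonglongrightarrow> 0"
  proof (rule fibre_means_tendsto_mean)
    show "integrable \<mu> (ip F F)" by (rule ip_integrable[OF FL FL])
    show "(\<integral>\<omega>. ip F F \<omega> \<partial>\<mu>) = of_real (measure \<mu> UNIV) * 1" by (simp add: integral_ip FF)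
    have "ip (\<lambda>\<omega> i. c * F \<omega> i) (\<lambda>\<omega> i. c * F \<omega> i) \<omega> = ip F F \<omega>" for \<omega>
    proof -
      have "ip (\<lambda>\<omega> i. c * F \<omega> i) (\<lambda>\<omega> i. c * F \<omega> i) \<omega> = (c * cnj c) * ip F F \<omega>"
        unfolding ip_def by (simp add: sum_distrib_left mult_ac)
      also have "c * cnj c = 1" using c by (simp add: complex_norm_square[symmetric])
      finally show ?thesis by simp
    qed
    then have "AE \<omega> in \<mu>. ip (R F) (R F) \<omega> = ip F F \<omega>" using ip_cong[OF RF RF] by simp
    from AE_K[OF this] fibre_mean_ip[of F F] show "fibre_mean (ip F F) (ip F F)"
      unfolding fibre_mean_def by eventually_elim simp
  qed
  then have "(\<integral>\<omega>. cmod (ip F F \<omega> - 1) \<partial>\<mu>) = 0" by (simp add: LIMSEQ_const_iff)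
  moreover have "integrable \<mu> (\<lambda>\<omega>. cmod (ip F F \<omega> - 1))" using ip_integrable[OF FL FL] by auto
  ultimately have "AE \<omega> in \<mu>. cmod (ip F F \<omega> - 1) = 0"
    by (simp add: integral_nonneg_eq_0_iff_AE)
  then have "AE \<omega> in \<mu>. ip F F \<omega> = 1" by simp
  then show thesis using that FL c RF by blast
qed

end

section \<open>Completing a unit vector to a unitary matrix\<close>

text \<open>
  The matrix \<open>I - w w\<^sup>* / d\<close> is unitary if \<open>2 d\<close> is the squared length of \<open>w\<close>: it is the reflection
  in the hyperplane orthogonal to \<open>w\<close>.
\<close>

lemma reflection_unitary:
  fixes w :: "nat \<Rightarrow> complex"
  assumes "(\<Sum>k=1..n. w k * cnj (w k)) = 2 * d" "d \<noteq> 0" "i \<in> {1..n}" "j \<in> {1..n}"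
  shows "(\<Sum>k=1..n. (of_bool (i = k) - cnj (w i) * w k / d) * (of_bool (j = k) - w j * cnj (w k) / d))
    = of_bool (i = j)"
proof -
  have delta: "(\<Sum>k=1..n. of_bool (a = k) * g k) = g a" if "a \<in> {1..n}" for a and g :: "nat \<Rightarrow> complex"
  proof -
    have "(\<Sum>k=1..n. of_bool (a = k) * g k) = (\<Sum>k=1..n. if k = a then g a else 0)"
      by (intro sum.cong) auto
    then show ?thesis using that by simp
  qed
  have "(\<Sum>k=1..n. (of_bool (i = k) - cnj (w i) * w k / d) * (of_bool (j = k) - w j * cnj (w k) / d))
      = (\<Sum>k=1..n. of_bool (i = k) * of_bool (j = k)) - (\<Sum>k=1..n. of_bool (i = k) * (w j * cnj (w k) / d))
        - (\<Sum>k=1..n. of_bool (j = k) * (cnj (w i) * w k / d))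
        + cnj (w i) * w j / (d * d) * (\<Sum>k=1..n. w k * cnj (w k))"
    unfolding sum_distrib_left sum_subtractf[symmetric] sum.distrib[symmetric]
    by (intro sum.cong refl) (simp add: algebra_simps)
  also have "\<dots> = of_bool (j = i) - w j * cnj (w i) / d - cnj (w i) * w j / d + cnj (w i) * w j / (d * d) * (2 * d)"
    unfolding delta[OF assms(3)] delta[OF assms(4)] assms(1) by simp
  also have "\<dots> = of_bool (i = j)"
  proof -
    have "cnj (w i) * w j / (d * d) * (2 * d) = 2 * (w j * cnj (w i) / d)"
      using assms(2) by simp
    moreover have "of_bool (j = i) = (of_bool (i = j) :: complex)" by auto
    moreover have "cnj (w i) * w j / d = w j * cnj (w i) / d" by simp
    ultimately show ?thesis by (simp only:)  simp
  qed
  finally show ?thesis .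
qed

definition phase :: "complex \<Rightarrow> complex" where
  "phase z = (if z = 0 then 1 else z / of_real (cmod z))"

text \<open>
  The transpose of \<open>- \<theta>\<close> times the Householder reflection that maps \<open>f\<close> to \<open>- \<theta>\<close> times the first
  unit vector, where \<open>\<theta>\<close> is the phase of \<open>f 1\<close>. With this choice of \<open>\<theta>\<close> the normal \<open>w\<close> of the
  mirror has squared length \<open>2 (1 + |f 1|)\<close>, which never vanishes, so one formula serves for all unit
  vectors \<open>f\<close> and its entries are Borel functions of \<open>f\<close>.
\<close>

definition unitary_completion :: "nat \<Rightarrow> (nat \<Rightarrow> complex) \<Rightarrow> cmatrix" where
  "unitary_completion n f = (\<lambda>i j.
     let w = (\<lambda>i. f i + of_bool (i = 1) * phase (f 1)) in
     if i \<in> {1..n} \<and> j \<in> {1..n}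
     then - phase (f 1) * (of_bool (i = j) - cnj (w i) * w j / of_real (1 + cmod (f 1)))
     else 0)"

lemma phase_facts:
  "phase z * cnj (phase z) = 1" "phase z * of_real (cmod z) = z" "z * cnj (phase z) = of_real (cmod z)"
proof -
  have zz: "z * cnj z = of_real (cmod z) * of_real (cmod z)"
    by (simp add: complex_norm_square[symmetric] power2_eq_square)
  show "phase z * cnj (phase z) = 1" "phase z * of_real (cmod z) = z" "z * cnj (phase z) = of_real (cmod z)"
    by (auto simp: phase_def zz)
qed

lemma one_plus_cmod_nonzero: "complex_of_real (1 + cmod z) \<noteq> 0"
proof -
  have "1 + cmod z > 0" using norm_ge_zero[of z] by linarith
  then show ?thesis by (metis less_irrefl of_real_eq_0_iff)
qed

lemma unitary_completion_first_row:
  assumes "j \<in> {1..n}"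
  shows "unitary_completion n f 1 j = f j"
proof -
  let ?\<theta> = "phase (f 1)" and ?d = "complex_of_real (1 + cmod (f 1))"
  have "f 1 + ?\<theta> = ?\<theta> * ?d" using phase_facts(2)[of "f 1"] by (simp add: distrib_left)
  then have "cnj (f 1 + ?\<theta>) = cnj ?\<theta> * ?d" by (metis complex_cnj_complex_of_real complex_cnj_mult)
  moreover have "unitary_completion n f 1 j
      = - ?\<theta> * (of_bool (1 = j) - cnj (f 1 + ?\<theta>) * (f j + of_bool (j = 1) * ?\<theta>) / ?d)"
    using assms by (simp add: unitary_completion_def Let_def)
  moreover have "cnj ?\<theta> * ?d * x / ?d = cnj ?\<theta> * x" for x
    using one_plus_cmod_nonzero[of "f 1"] by simp
  ultimately have "unitary_completion n f 1 j
      = - ?\<theta> * of_bool (1 = j) + (?\<theta> * cnj ?\<theta>) * (f j + of_bool (j = 1) * ?\<theta>)"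
    by (simp only: right_diff_distrib) (simp add: mult.assoc)
  then show ?thesis unfolding phase_facts(1) by auto
qed

lemma unitary_completion_outside: "i \<notin> {1..n} \<or> j \<notin> {1..n} \<Longrightarrow> unitary_completion n f i j = 0"
  unfolding unitary_completion_def Let_def by auto

lemma unitary_block_completion:
  assumes f: "(\<Sum>i=1..n. f i * cnj (f i)) = 1"
  shows "unitary_block n (unitary_completion n f)"
proof -
  define \<theta> where "\<theta> = phase (f 1)"
  define w where "w = (\<lambda>i. f i + of_bool (i = 1) * \<theta>)"
  define d where "d = complex_of_real (1 + cmod (f 1))"
  have d: "d \<noteq> 0" "cnj d = d" unfolding d_def using one_plus_cmod_nonzero by simp_all
  have entry: "unitary_completion n f i j = - \<theta> * (of_bool (i = j) - cnj (w i) * w j / d)"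
    if "i \<in> {1..n}" "j \<in> {1..n}" for i j
    using that by (simp add: unitary_completion_def Let_def \<theta>_def w_def d_def)
  have n: "1 \<in> {1..n}" using f by (cases "n = 0") auto
  have norm_w: "(\<Sum>k=1..n. w k * cnj (w k)) = 2 * d"
  proof -
    have "(\<Sum>k=1..n. w k * cnj (w k)) = (\<Sum>k=1..n. f k * cnj (f k)
        + (if k = 1 then f 1 * cnj \<theta> + cnj (f 1 * cnj \<theta>) + \<theta> * cnj \<theta> else 0))"
      by (intro sum.cong) (auto simp: w_def algebra_simps)
    also have "\<dots> = 2 * d"
      using n f phase_facts[of "f 1"] by (simp add: sum.distrib \<theta>_def d_def)
    finally show ?thesis .
  qed
  have \<theta>: "\<theta> * cnj \<theta> = 1" unfolding \<theta>_def by (rule phase_facts)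
  show ?thesis
    unfolding unitary_block_def
  proof (intro conjI ballI allI impI)
    fix i j :: nat assume "i \<ge> 1" "j \<ge> 1" "i > n \<or> j > n"
    then show "unitary_completion n f i j = 0" by (intro unitary_completion_outside) auto
  next
    fix i j assume ij: "i \<in> {1..n}" "j \<in> {1..n}"
    let ?s = "\<Sum>k=1..n. (of_bool (i = k) - cnj (w i) * w k / d) * (of_bool (j = k) - w j * cnj (w k) / d)"
    have "(\<Sum>k=1..n. unitary_completion n f i k * cnj (unitary_completion n f j k)) = (\<theta> * cnj \<theta>) * ?s"
      unfolding sum_distrib_left
    proof (intro sum.cong refl)
      fix k assume k: "k \<in> {1..n}"
      show "unitary_completion n f i k * cnj (unitary_completion n f j k) = \<theta> * cnj \<theta> *
          ((of_bool (i = k) - cnj (w i) * w k / d) * (of_bool (j = k) - w j * cnj (w k) / d))"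
        unfolding entry[OF ij(1) k] entry[OF ij(2) k] by (auto simp: of_bool_def d(2) mult_ac)
    qed
    then show "(\<Sum>k=1..n. unitary_completion n f i k * cnj (unitary_completion n f j k)) = of_bool (i = j)"
      using reflection_unitary[OF norm_w d(1) ij] \<theta> by simp
    have "(\<Sum>k=1..n. cnj (unitary_completion n f k i) * unitary_completion n f k j) = (\<theta> * cnj \<theta>) * ?s"
      unfolding sum_distrib_left
    proof (intro sum.cong refl)
      fix k assume k: "k \<in> {1..n}"
      show "cnj (unitary_completion n f k i) * unitary_completion n f k j = \<theta> * cnj \<theta> *
          ((of_bool (i = k) - cnj (w i) * w k / d) * (of_bool (j = k) - w j * cnj (w k) / d))"
        unfolding entry[OF k ij(1)] entry[OF k ij(2)] by (auto simp: of_bool_def d(2) mult_ac)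
    qed
    then show "(\<Sum>k=1..n. cnj (unitary_completion n f k i) * unitary_completion n f k j) = of_bool (i = j)"
      using reflection_unitary[OF norm_w d(1) ij] \<theta> by simp
  qed
qed

lemma measurable_unitary_completion:
  assumes [measurable]: "n \<in> measurable M (count_space UNIV)"
    and f: "\<And>i. i \<ge> 1 \<Longrightarrow> (\<lambda>x. f x i) \<in> borel_measurable M" and ij: "i \<ge> 1" "j \<ge> 1"
  shows "(\<lambda>x. unitary_completion (n x) (f x) i j) \<in> borel_measurable M"
proof -
  have [measurable]: "(\<lambda>x. f x i) \<in> borel_measurable M" "(\<lambda>x. f x j) \<in> borel_measurable M"
    "(\<lambda>x. f x 1) \<in> borel_measurable M"
    using f ij by auto
  have [measurable]: "(\<lambda>x. phase (f x 1)) \<in> borel_measurable M" unfolding phase_def by measurable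
  show ?thesis unfolding unitary_completion_def Let_def by measurable
qed

section \<open>Equivalent filters\<close>

lemma conjugate_block:
  assumes "\<And>k. k > n \<Longrightarrow> A i k = 0" "\<And>l. l > p \<Longrightarrow> B j l = 0"
  shows "mat_mul (mat_mul A X) (mat_adj B) i j = (\<Sum>l=1..p. (\<Sum>k=1..n. A i k * X k l) * cnj (B j l))"
proof -
  have "mat_mul A X i l = (\<Sum>k=1..n. A i k * X k l)" for l
    unfolding mat_mul_def by (rule infsum_block) (simp add: assms)
  then show ?thesis
    unfolding mat_mul_def[of "mat_mul A X"] mat_adj_def using assms(2) by (subst infsum_block[of p]) simp_all
qed

lemma unitary_block_zero: "unitary_block n A \<Longrightarrow> i \<ge> 1 \<Longrightarrow> j \<ge> 1 \<Longrightarrow> i > n \<or> j > n \<Longrightarrow> A i j = 0"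
  unfolding unitary_block_def by blast

lemma unitary_block_rows: "unitary_block n A \<Longrightarrow> i \<in> {1..n} \<Longrightarrow> j \<in> {1..n} \<Longrightarrow>
    (\<Sum>k=1..n. A i k * cnj (A j k)) = of_bool (i = j)"
  unfolding unitary_block_def by blast

lemma unitary_block_columns: "unitary_block n A \<Longrightarrow> i \<in> {1..n} \<Longrightarrow> j \<in> {1..n} \<Longrightarrow>
    (\<Sum>k=1..n. cnj (A k i) * A k j) = of_bool (i = j)"
  unfolding unitary_block_def by blast

lemma unitary_block_preserves:
  assumes "unitary_block n A"
  shows "(\<Sum>j=1..n. (\<Sum>l=1..n. x l * cnj (A j l)) * cnj (\<Sum>l=1..n. y l * cnj (A j l))) = (\<Sum>l=1..n. x l * cnj (y l))"
proof -
  have "(\<Sum>j=1..n. (\<Sum>l=1..n. x l * cnj (A j l)) * cnj (\<Sum>l=1..n. y l * cnj (A j l)))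
      = (\<Sum>j=1..n. \<Sum>l=1..n. \<Sum>l'=1..n. x l * cnj (y l') * (cnj (A j l) * A j l'))"
    unfolding cnj_sum sum_product by (intro sum.cong refl) simp
  also have "\<dots> = (\<Sum>l=1..n. \<Sum>l'=1..n. x l * cnj (y l') * (\<Sum>j=1..n. cnj (A j l) * A j l'))"
    unfolding sum_distrib_left by (subst sum.swap, subst (2) sum.swap) (rule refl)
  also have "\<dots> = (\<Sum>l=1..n. \<Sum>l'=1..n. if l' = l then x l * cnj (y l) else 0)"
  proof (intro sum.cong refl)
    fix l l' assume "l \<in> {1..n}" "l' \<in> {1..n}"
    then show "x l * cnj (y l') * (\<Sum>j=1..n. cnj (A j l) * A j l') = (if l' = l then x l * cnj (y l) else 0)"
      unfolding unitary_block_columns[OF assms \<open>l \<in> {1..n}\<close> \<open>l' \<in> {1..n}\<close>] by simp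
  qed
  also have "\<dots> = (\<Sum>l=1..n. x l * cnj (y l))" by simp
  finally show ?thesis .
qed

context ruelle_operator
begin

text \<open>
  The factor \<open>A(\<zeta>)\<^sup>*\<close> on the right does not change the inner products of rows at any point \<open>\<zeta>\<close> of the
  fibre, and the factor \<open>A(\<omega>)\<close> on the left, which is the same for the whole fibre, transforms the
  orthogonal rows of squared length \<open>N\<close> unitarily.
\<close>

lemma filter_conjugate:
  assumes A: "AE \<omega> in \<mu>. unitary_block (m \<omega>) (A \<omega>)"
    and meas: "\<And>i j. i \<ge> 1 \<Longrightarrow> j \<ge> 1 \<Longrightarrow> (\<lambda>\<omega>. H' \<omega> i j) \<in> borel_measurable borel"
    and H': "AE \<omega> in \<mu>. \<forall>i\<ge>1. \<forall>j\<ge>1.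
      H' \<omega> i j = (\<Sum>l=1..m \<omega>. (\<Sum>k=1..m (T \<omega>). A (T \<omega>) i k * H \<omega> k l) * cnj (A \<omega> j l))"
  shows "filter_relative \<mu> \<alpha> N m H'"
  unfolding filter_relative_def not_in_sigma_set
proof (intro conjI allI impI)
  show "(\<lambda>\<omega>. H' \<omega> i j) \<in> borel_measurable borel" if "i \<ge> 1" "j \<ge> 1" for i j using meas that .
  show "AE \<omega> in \<mu>. \<forall>i\<ge>1. \<forall>j>m \<omega>. H' \<omega> i j = 0"
    using H' A by eventually_elim (auto simp: unitary_block_zero)
  have filter: "AE \<omega> in \<mu>. \<forall>i\<ge>1. \<forall>i'\<ge>1.
      (\<Sum>\<zeta> | T \<zeta> = \<omega>. \<Sum>\<^sub>\<infinity>j\<in>{1..}. H \<zeta> i j * cnj (H \<zeta> i' j)) =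
      of_nat N * of_bool (i = i') * indicator (sigma_set m i) \<omega>"
    using filter_H unfolding filter_relative_def by blast
  from filter A AE_fibre[OF A] AE_fibre[OF H'] AE_fibre[OF H_supported]
  show "AE \<omega> in \<mu>. \<forall>i\<ge>1. \<forall>i'\<ge>1.
      (\<Sum>\<zeta> | T \<zeta> = \<omega>. \<Sum>\<^sub>\<infinity>j\<in>{1..}. H' \<zeta> i j * cnj (H' \<zeta> i' j)) =
      of_nat N * of_bool (i = i') * indicator (sigma_set m i) \<omega>"
  proof eventually_elim
    case (elim \<omega>)
    let ?F = "{\<zeta>. T \<zeta> = \<omega>}" and ?I = "{1..m \<omega>}" and ?a = "A \<omega>"
    define row where "row \<zeta> i l = (\<Sum>k\<in>?I. ?a i k * H \<zeta> k l)" for \<zeta> i l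
    show ?case
    proof (intro allI impI)
      fix i i' :: nat assume i: "i \<ge> 1" "i' \<ge> 1"
      have H_rows: "(\<Sum>\<zeta>\<in>?F. \<Sum>l=1..m \<zeta>. H \<zeta> k l * cnj (H \<zeta> k' l)) = of_nat N * of_bool (k = k')"
        if k: "k \<in> ?I" "k' \<in> ?I" for k k'
      proof -
        have "(\<Sum>\<zeta>\<in>?F. \<Sum>l=1..m \<zeta>. H \<zeta> k l * cnj (H \<zeta> k' l))
            = (\<Sum>\<zeta>\<in>?F. \<Sum>\<^sub>\<infinity>j\<in>{1..}. H \<zeta> k j * cnj (H \<zeta> k' j))"
          using elim(5) k by (intro sum.cong refl infsum_block[symmetric]) simp
        also have "\<dots> = of_nat N * of_bool (k = k')" using elim(1) k by (simp add: sigma_set_def)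
        finally show ?thesis .
      qed
      have "(\<Sum>\<zeta>\<in>?F. \<Sum>\<^sub>\<infinity>j\<in>{1..}. H' \<zeta> i j * cnj (H' \<zeta> i' j))
          = (\<Sum>\<zeta>\<in>?F. \<Sum>l=1..m \<zeta>. row \<zeta> i l * cnj (row \<zeta> i' l))"
      proof (intro sum.cong refl)
        fix \<zeta> assume "\<zeta> \<in> ?F"
        then have \<zeta>: "T \<zeta> = \<omega>" by simp
        then have ub: "unitary_block (m \<zeta>) (A \<zeta>)" using elim(3) by blast
        have eq: "H' \<zeta> i j = (\<Sum>l=1..m \<zeta>. row \<zeta> i l * cnj (A \<zeta> j l))" if "i \<ge> 1" "j \<ge> 1" for i j
          using elim(4) \<zeta> that unfolding row_def by blast
        have "H' \<zeta> i j = 0" if "j > m \<zeta>" for j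
          using eq[of i j] i that by (simp add: unitary_block_zero[OF ub])
        then have "(\<Sum>\<^sub>\<infinity>j\<in>{1..}. H' \<zeta> i j * cnj (H' \<zeta> i' j)) = (\<Sum>j=1..m \<zeta>. H' \<zeta> i j * cnj (H' \<zeta> i' j))"
          by (intro infsum_block) simp
        also have "\<dots> = (\<Sum>j=1..m \<zeta>. (\<Sum>l=1..m \<zeta>. row \<zeta> i l * cnj (A \<zeta> j l))
            * cnj (\<Sum>l=1..m \<zeta>. row \<zeta> i' l * cnj (A \<zeta> j l)))"
          using i by (intro sum.cong refl) (simp add: eq)
        also have "\<dots> = (\<Sum>l=1..m \<zeta>. row \<zeta> i l * cnj (row \<zeta> i' l))"
          by (rule unitary_block_preserves[OF ub])
        finally show "(\<Sum>\<^sub>\<infinity>j\<in>{1..}. H' \<zeta> i j * cnj (H' \<zeta> i' j)) = (\<Sum>l=1..m \<zeta>. row \<zeta> i l * cnj (row \<zeta> i' l))" .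
      qed
      also have "\<dots> = (\<Sum>\<zeta>\<in>?F. \<Sum>l=1..m \<zeta>. \<Sum>k\<in>?I. \<Sum>k'\<in>?I.
          ?a i k * cnj (?a i' k') * (H \<zeta> k l * cnj (H \<zeta> k' l)))"
        unfolding row_def cnj_sum sum_product by (intro sum.cong refl) simp
      also have "\<dots> = (\<Sum>\<zeta>\<in>?F. \<Sum>k\<in>?I. \<Sum>k'\<in>?I. \<Sum>l=1..m \<zeta>.
          ?a i k * cnj (?a i' k') * (H \<zeta> k l * cnj (H \<zeta> k' l)))"
        by (subst sum.swap, subst (2) sum.swap) (rule refl)
      also have "\<dots> = (\<Sum>k\<in>?I. \<Sum>k'\<in>?I. \<Sum>\<zeta>\<in>?F. \<Sum>l=1..m \<zeta>.
          ?a i k * cnj (?a i' k') * (H \<zeta> k l * cnj (H \<zeta> k' l)))"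
        by (subst sum.swap, subst (2) sum.swap) (rule refl)
      also have "\<dots> = (\<Sum>k\<in>?I. \<Sum>k'\<in>?I. ?a i k * cnj (?a i' k') * (of_nat N * of_bool (k = k')))"
        by (intro sum.cong refl) (simp only: sum_distrib_left[symmetric] H_rows)
      also have "\<dots> = (\<Sum>k\<in>?I. \<Sum>k'\<in>?I. if k' = k then of_nat N * (?a i k * cnj (?a i' k)) else 0)"
        by (intro sum.cong refl) auto
      also have "\<dots> = of_nat N * (\<Sum>k\<in>?I. ?a i k * cnj (?a i' k))"
        by (simp add: sum_distrib_left)
      also have "\<dots> = of_nat N * of_bool (i = i') * indicator (sigma_set m i) \<omega>"
      proof (cases "i \<in> ?I \<and> i' \<in> ?I")
        case True
        then show ?thesis using unitary_block_rows[OF elim(2), of i i'] by (simp add: sigma_set_def)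
      next
        case False
        then have "(\<Sum>k\<in>?I. ?a i k * cnj (?a i' k)) = 0"
          using i unitary_block_zero[OF elim(2)] by (intro sum.neutral) auto
        moreover have "i \<noteq> i' \<or> \<omega> \<notin> sigma_set m i" using False i by (auto simp: sigma_set_def)
        ultimately show ?thesis by auto
      qed
      finally show "(\<Sum>\<zeta>\<in>?F. \<Sum>\<^sub>\<infinity>j\<in>{1..}. H' \<zeta> i j * cnj (H' \<zeta> i' j)) =
          of_nat N * of_bool (i = i') * indicator (sigma_set m i) \<omega>" .
    qed
  qed
qed

text \<open>
  A unit eigenvector with constant pointwise length is the first row of a unitary matrix function,
  and conjugating the filter by this matrix turns the eigenvector into the first unit vector.
\<close>

lemma eigenfilter_from_eigenvector:
  assumes F: "F \<in> L2" and c: "cmod c = 1" and RF: "R F \<doteq> (\<lambda>\<omega> i. c * F \<omega> i)"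
    and unit: "AE \<omega> in \<mu>. ip F F \<omega> = 1"
  shows "\<exists>H'. eigenfilter \<mu> \<alpha> N m H' \<and> equivalent_filters \<mu> \<alpha> N m H H'"
proof -
  define A where "A \<omega> = unitary_completion (m \<omega>) (F \<omega>)" for \<omega>
  define H' where "H' \<omega> = (\<lambda>i j. \<Sum>l=1..m \<omega>. (\<Sum>k=1..m (T \<omega>). A (T \<omega>) i k * H \<omega> k l) * cnj (A \<omega> j l))" for \<omega>
  have A_meas: "(\<lambda>\<omega>. A \<omega> i j) \<in> borel_measurable borel" if "i \<ge> 1" "j \<ge> 1" for i j
    unfolding A_def using F that
    by (intro measurable_unitary_completion m_measurable) (auto simp: L2_iff components_measurable_def)
  have A_ub: "AE \<omega> in \<mu>. unitary_block (m \<omega>) (A \<omega>)"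
    using unit unfolding A_def ip_def by eventually_elim (rule unitary_block_completion)
  have A_zero: "A \<omega> i j = 0" if "j > m \<omega>" for \<omega> i j
    unfolding A_def using that by (intro unitary_completion_outside) auto
  have A_row: "A \<omega> 1 j = F \<omega> j" if "j \<in> {1..m \<omega>}" for \<omega> j
    unfolding A_def by (rule unitary_completion_first_row[OF that])
  have meas: "(\<lambda>\<omega>. H' \<omega> i j) \<in> borel_measurable borel" if ij: "i \<ge> 1" "j \<ge> 1" for i j
    unfolding H'_def
  proof (rule measurable_block_sum[OF m_measurable])
    fix l :: nat assume l: "l \<ge> 1"
    have "(\<lambda>\<omega>. \<Sum>k=1..m (T \<omega>). A (T \<omega>) i k * H \<omega> k l) \<in> borel_measurable borel"
    proof (rule measurable_block_sum)
      fix k :: nat assume k: "k \<ge> 1"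
      have [measurable]: "(\<lambda>\<omega>. A \<omega> i k) \<in> borel_measurable borel" "(\<lambda>\<omega>. H \<omega> k l) \<in> borel_measurable borel"
        using A_meas H_measurable ij k l by auto
      show "(\<lambda>\<omega>. A (T \<omega>) i k * H \<omega> k l) \<in> borel_measurable borel" by measurable
    qed measurable
    moreover have "(\<lambda>\<omega>. A \<omega> j l) \<in> borel_measurable borel" using A_meas ij l by auto
    ultimately show "(\<lambda>\<omega>. (\<Sum>k=1..m (T \<omega>). A (T \<omega>) i k * H \<omega> k l) * cnj (A \<omega> j l)) \<in> borel_measurable borel"
      by (intro borel_measurable_times borel_measurable_cnj)
  qed
  have filter': "filter_relative \<mu> \<alpha> N m H'"
    by (rule filter_conjugate[OF A_ub meas]) (simp_all add: H'_def)
  have "H' \<omega> i j = mat_mul (mat_mul (A (T \<omega>)) (H \<omega>)) (mat_adj (A \<omega>)) i j" for \<omega> i j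
    unfolding H'_def by (rule conjugate_block[symmetric]) (simp_all add: A_zero)
  then have equiv: "equivalent_filters \<mu> \<alpha> N m H H'"
    unfolding equivalent_filters_def using filter_H filter' A_meas A_ub
    by (intro conjI exI[of _ A]) auto
  have "AE \<omega> in \<mu>. H' \<omega> 1 1 = c \<and> (\<forall>j>1. H' \<omega> 1 j = 0)"
    using RF[unfolded ae_eq_def] A_ub unit
  proof eventually_elim
    case (elim \<omega>)
    have "(\<Sum>k=1..m (T \<omega>). A (T \<omega>) 1 k * H \<omega> k l) = R F \<omega> l" for l
      unfolding R_def by (intro sum.cong refl) (simp only: A_row mult.commute)
    then have "H' \<omega> 1 j = (\<Sum>l=1..m \<omega>. R F \<omega> l * cnj (A \<omega> j l))" for j
      by (simp only: H'_def)
    also have "(\<Sum>l=1..m \<omega>. R F \<omega> l * cnj (A \<omega> j l)) = c * (\<Sum>l=1..m \<omega>. A \<omega> 1 l * cnj (A \<omega> j l))" for j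
      unfolding sum_distrib_left
    proof (intro sum.cong refl)
      fix l assume l: "l \<in> {1..m \<omega>}"
      then have "R F \<omega> l = c * F \<omega> l" using elim(1) by simp
      then show "R F \<omega> l * cnj (A \<omega> j l) = c * (A \<omega> 1 l * cnj (A \<omega> j l))"
        unfolding A_row[OF l] by simp
    qed
    finally have row: "H' \<omega> 1 j = c * (\<Sum>l=1..m \<omega>. A \<omega> 1 l * cnj (A \<omega> j l))" for j .
    have m1: "1 \<in> {1..m \<omega>}" using elim(3) by (cases "m \<omega> = 0") (auto simp: ip_def)
    have "H' \<omega> 1 j = 0" if "j > 1" for j
    proof (cases "j \<le> m \<omega>")
      case True
      then show ?thesis using row[of j] unitary_block_rows[OF elim(2) m1, of j] that by simp
    next
      case False
      then show ?thesis using row[of j] unitary_block_zero[OF elim(2), of j] by simp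
    qed
    moreover have "H' \<omega> 1 1 = c" using row[of 1] unitary_block_rows[OF elim(2) m1 m1] by simp
    ultimately show ?case by blast
  qed
  then have "eigenfilter \<mu> \<alpha> N m H'" unfolding eigenfilter_def using filter' c by blast
  then show ?thesis using equiv by blast
qed

text \<open>
  Conversely, the first row of the conjugating matrix is an eigenvector of the Ruelle operator, and
  an eigenvector to an eigenvalue of modulus 1 lies in the range of every power.
\<close>

lemma eigenvector_from_eigenfilter:
  assumes eig: "eigenfilter \<mu> \<alpha> N m H'" and equiv: "equivalent_filters \<mu> \<alpha> N m H H'"
  shows "\<exists>f\<in>unitary_part. \<not> f \<doteq> (\<lambda>\<omega> i. 0)"
proof -
  obtain c where c: "cmod c = 1" and H'1: "AE \<omega> in \<mu>. H' \<omega> 1 1 = c \<and> (\<forall>j>1. H' \<omega> 1 j = 0)"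
    using eig unfolding eigenfilter_def by blast
  obtain A where A_meas: "\<forall>i\<ge>1. \<forall>j\<ge>1. (\<lambda>\<omega>. A \<omega> i j) \<in> borel_measurable borel"
    and A_ub: "AE \<omega> in \<mu>. unitary_block (m \<omega>) (A \<omega>)"
    and H': "AE \<omega> in \<mu>. \<forall>i\<ge>1. \<forall>j\<ge>1. H' \<omega> i j = mat_mul (mat_mul (A (T \<omega>)) (H \<omega>)) (mat_adj (A \<omega>)) i j"
    using equiv unfolding equivalent_filters_def by blast
  have c0: "c \<noteq> 0" using c by auto
  define f where "f \<omega> j = A \<omega> 1 j" for \<omega> j
  have key: "AE \<omega> in \<mu>. (\<forall>j\<ge>1. R f \<omega> j = c * f \<omega> j) \<and> (\<forall>j>m \<omega>. f \<omega> j = 0) \<and> ip f f \<omega> = 1"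
    using H'1 A_ub AE_T[OF A_ub] H' H_supported
  proof eventually_elim
    case (elim \<omega>)
    have conj: "H' \<omega> 1 j = (\<Sum>l=1..m \<omega>. R f \<omega> l * cnj (A \<omega> j l))" if "j \<ge> 1" for j
    proof -
      have "H' \<omega> 1 j = mat_mul (mat_mul (A (T \<omega>)) (H \<omega>)) (mat_adj (A \<omega>)) 1 j" using elim(4) that by blast
      also have "\<dots> = (\<Sum>l=1..m \<omega>. (\<Sum>k=1..m (T \<omega>). A (T \<omega>) 1 k * H \<omega> k l) * cnj (A \<omega> j l))"
        using that by (intro conjugate_block unitary_block_zero[OF elim(3)] unitary_block_zero[OF elim(2)]) auto
      also have "\<dots> = (\<Sum>l=1..m \<omega>. R f \<omega> l * cnj (A \<omega> j l))"
      proof -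
        have "(\<Sum>k=1..m (T \<omega>). A (T \<omega>) 1 k * H \<omega> k l) = R f \<omega> l" for l
          unfolding R_def f_def by (intro sum.cong refl) (simp add: mult.commute)
        then show ?thesis by (simp only:)
      qed
      finally show ?thesis .
    qed
    have m1: "1 \<in> {1..m \<omega>}"
    proof (rule ccontr)
      assume "1 \<notin> {1..m \<omega>}"
      then have "H' \<omega> 1 1 = 0" using conj[of 1] by simp
      then show False using elim(1) c0 by simp
    qed
    have zero: "f \<omega> j = 0" if "j > m \<omega>" for j
      using that unitary_block_zero[OF elim(2), of 1 j] by (simp add: f_def)
    have "R f \<omega> j = c * f \<omega> j" if j: "j \<ge> 1" for j
    proof (cases "j \<le> m \<omega>")
      case True
      then have jm: "j \<in> {1..m \<omega>}" using j by simp
      have "c * f \<omega> j = (\<Sum>i=1..m \<omega>. if i = 1 then c * A \<omega> 1 j else 0)" using m1 j by (simp add: f_def)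
      also have "\<dots> = (\<Sum>i=1..m \<omega>. H' \<omega> 1 i * A \<omega> i j)" using elim(1) by (intro sum.cong) auto
      also have "\<dots> = (\<Sum>i=1..m \<omega>. \<Sum>l=1..m \<omega>. R f \<omega> l * (cnj (A \<omega> i l) * A \<omega> i j))"
      proof (intro sum.cong refl)
        fix i assume "i \<in> {1..m \<omega>}"
        then have i: "i \<ge> 1" by simp
        show "H' \<omega> 1 i * A \<omega> i j = (\<Sum>l=1..m \<omega>. R f \<omega> l * (cnj (A \<omega> i l) * A \<omega> i j))"
          unfolding conj[OF i] sum_distrib_right by (simp only: mult.assoc)
      qed
      also have "\<dots> = (\<Sum>l=1..m \<omega>. R f \<omega> l * (\<Sum>i=1..m \<omega>. cnj (A \<omega> i l) * A \<omega> i j))"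
        unfolding sum_distrib_left by (rule sum.swap)
      also have "\<dots> = (\<Sum>l=1..m \<omega>. if l = j then R f \<omega> j else 0)"
      proof (intro sum.cong refl)
        fix l assume l: "l \<in> {1..m \<omega>}"
        show "R f \<omega> l * (\<Sum>i=1..m \<omega>. cnj (A \<omega> i l) * A \<omega> i j) = (if l = j then R f \<omega> j else 0)"
          unfolding unitary_block_columns[OF elim(2) l jm] by simp
      qed
      also have "\<dots> = R f \<omega> j" using jm by simp
      finally show ?thesis by simp
    next
      case False
      then have "R f \<omega> j = 0" unfolding R_def using elim(5) by (intro sum.neutral) simp
      then show ?thesis using zero False by simp
    qed
    moreover have "ip f f \<omega> = 1"
    proof -
      have "ip f f \<omega> = (\<Sum>k=1..m \<omega>. A \<omega> 1 k * cnj (A \<omega> 1 k))"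
        by (simp only: ip_def f_def)
      then show ?thesis unfolding unitary_block_rows[OF elim(2) m1 m1] by simp
    qed
    ultimately show ?case using zero by blast
  qed
  then have Rf: "R f \<doteq> (\<lambda>\<omega> i. c * f \<omega> i)" unfolding ae_eq_def by (rule eventually_mono) simp
  have unit: "AE \<omega> in \<mu>. sqabs f \<omega> = 1"
    using key by eventually_elim (metis of_real_sqabs of_real_eq_1_iff)
  have fL: "f \<in> L2"
    unfolding L2_iff
  proof (intro conjI)
    show "components_measurable f" using A_meas by (simp add: components_measurable_def f_def)
    show "supported f" unfolding supported_def using key by (rule eventually_mono) simp
    have "(\<integral>\<^sup>+\<omega>. ennreal (sqabs f \<omega>) \<partial>\<mu>) = (\<integral>\<^sup>+\<omega>. 1 \<partial>\<mu>)"
      using unit by (intro nn_integral_cong_AE) (auto elim: eventually_mono)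
    then show "(\<integral>\<^sup>+\<omega>. ennreal (sqabs f \<omega>) \<partial>\<mu>) < \<infinity>"
      by (simp add: emeasure_eq_measure)
  qed
  have "f \<doteq> (R ^^ n) (\<lambda>\<omega> i. (1 / c) ^ n * f \<omega> i)" for n
  proof -
    have "(R ^^ n) f \<doteq> (\<lambda>\<omega> i. c ^ n * f \<omega> i)"
    proof (induction n)
      case (Suc n)
      have "R ((R ^^ n) f) \<doteq> (\<lambda>\<omega> i. c ^ n * R f \<omega> i)" using R_cong[OF Suc] by (simp only: R_scale)
      also have "(\<lambda>\<omega> i. c ^ n * R f \<omega> i) \<doteq> (\<lambda>\<omega> i. c ^ Suc n * f \<omega> i)"
        using Rf unfolding ae_eq_def by eventually_elim simp
      finally (ae_eq_trans) show ?case by simp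
    qed simp
    then show ?thesis
      unfolding R_pow_scale ae_eq_def by eventually_elim (simp add: power_divide c0)
  qed
  then have "f \<in> unitary_part" unfolding unitary_part_def using fL L2_scale[OF fL] by blast
  moreover have "\<not> f \<doteq> (\<lambda>\<omega> i. 0)"
  proof
    assume "f \<doteq> (\<lambda>\<omega> i. 0)"
    with unit have "AE \<omega> in \<mu>. False" unfolding ae_eq_def by eventually_elim (simp add: sqabs_def)
    then show False using not_AE_False by simp
  qed
  ultimately show ?thesis by blast
qed

theorem not_pure_iff_equivalent_eigenfilter:
  "\<not> pure_isometry_of (L2_sum \<mu> m) (ruelle \<mu> \<alpha> m H) \<longleftrightarrow>
    (\<exists>H'. eigenfilter \<mu> \<alpha> N m H' \<and> equivalent_filters \<mu> \<alpha> N m H H')"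
  unfolding not_pure_iff
proof
  assume "\<exists>f\<in>unitary_part. \<not> f \<doteq> (\<lambda>\<omega> i. 0)"
  then obtain f where "f \<in> unitary_part" "\<not> f \<doteq> (\<lambda>\<omega> i. 0)" by blast
  then obtain F c where "F \<in> L2" "cmod c = 1" "R F \<doteq> (\<lambda>\<omega> i. c * F \<omega> i)" "AE \<omega> in \<mu>. ip F F \<omega> = 1"
    by (rule unit_eigenvector)
  then show "\<exists>H'. eigenfilter \<mu> \<alpha> N m H' \<and> equivalent_filters \<mu> \<alpha> N m H H'"
    by (rule eigenfilter_from_eigenvector)
qed (use eigenvector_from_eigenfilter in blast)

end

theorem proposition19:
  fixes \<alpha> :: "'g::{ab_group_add,countable} \<Rightarrow> 'g"
    and N :: nat
    and \<mu> :: "'g dual measure"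
    and m :: "'g dual \<Rightarrow> nat"
    and H :: "'g dual \<Rightarrow> cmatrix"
  assumes "Modules.additive \<alpha>"
    and "inj \<alpha>"
    and "card (range (\<lambda>g. (+) g ` range \<alpha>)) = N"
    and "N > 1"
    and "(\<Inter>n. range (\<alpha> ^^ n)) = {0}"
    and "haar_measure \<mu>"
    and "multiplicity_function \<mu> \<alpha> m"
    and "filter_relative \<mu> \<alpha> N m H"
  shows "\<not> pure_isometry_of (L2_sum \<mu> m) (ruelle \<mu> \<alpha> m H) \<longleftrightarrow>
    (\<exists>H'. eigenfilter \<mu> \<alpha> N m H' \<and> equivalent_filters \<mu> \<alpha> N m H H')"
proof -
  interpret ruelle_operator \<alpha> N \<mu> m H
    using assms
    by (intro ruelle_operator.intro dual_endomorphism.intro ruelle_operator_axioms.intro)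
      (simp_all add: multiplicity_function_def)
  show ?thesis by (rule not_pure_iff_equivalent_eigenfilter)
qed

end
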